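(* Let $n\ge2$. There are exactly four types of boundaries of simple non-generic domains in the hyperbolic space $\mathbb{H}^n$: (i) horospheres, (ii) hyperspheres, (iii) geodesic spheres, (iv) (nonempty) intersections with $\mathbb{H}^n$ of hyperplanes of $\mathbb{R}^n$ (in the upper half-space model). That is, a hypersurface $\Sigma\subset\mathbb{H}^n$ is the boundary of some simple non-generic domain $(\Omega,\Sigma)$ in $\mathbb{H}^n$ if and only if it is of one of these types.
   Context: Use the upper half-space model $\mathbb{H}^n=\{y\in\mathbb{R}^n: y_n>0\}$ with metric $y_n^{-2}\delta$, $\delta$ the Euclidean metric, and $\partial\mathbb{H}^n=\{y_n=0\}$. For a Euclidean $(n-1)$-sphere $S\subset\mathbb{R}^n$ with $S\cap\mathbb{H}^n\ne\emptyset$, the hypersurface $S\cap\mathbb{H}^n$ is called a horosphere if $S$ is tangent to $\partial\mathbb{H}^n$, a hypersphere if $S$ meets $\partial\mathbb{H}^n$ transversally (at some angle), and a geodesic sphere if $S\subset\mathbb{H}^n$. A domain $(\Omega,\Sigma)$ in an $n$-dimensional Riemannian manifold $(M,g)$ is a complete, connected, smooth domain $\Omega\subset M$ with (nonempty) smooth boundary hypersurface $\Sigma=\partial\Omega$, so that $\overline{\Omega}$ is itself a complete Riemannian manifold with boundary. Let $\nu$ be the outward unit normal to $\Sigma$, $\hat g$ the induced metric on $\Sigma$, and $h(X,Y)=-\langle \nu, D_XY\rangle$ the second fundamental form of $\Sigma$. For $u\in C^\infty(\overline\Omega)$ put $L^*u=-(\Delta u)g+\operatorname{Hess}u-u\operatorname{Ric}$.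 The domain $(\Omega,\Sigma)$ is called non-generic if there is a function $u\in C^\infty(\overline\Omega)$, not identically zero, with $L^*u=0$ in $\Omega$ and $u_\nu\hat g=u h$ on $\Sigma$. It is called simple if $\Sigma$ has exactly one connected component. *)

theory Defs
  imports "HOL-Analysis.Analysis"
begin

section \<open>Smooth functions\<close>

definition partial :: "'n \<Rightarrow> (real ^ 'n \<Rightarrow> real) \<Rightarrow> real ^ 'n \<Rightarrow> real" where
  "partial i f p = frechet_derivative f (at p) (axis i 1)"

text \<open>Only meant for open \<open>U\<close>.\<close>

primrec Ck_on :: "nat \<Rightarrow> (real ^ 'n) set \<Rightarrow> (real ^ 'n \<Rightarrow> real) \<Rightarrow> bool" where
  "Ck_on 0 U f \<longleftrightarrow> continuous_on U f"
| "Ck_on (Suc k) U f \<longleftrightarrow> f differentiable_on U \<and> (\<forall>i. Ck_on k U (partial i f))"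

definition smooth_on :: "(real ^ 'n) set \<Rightarrow> (real ^ 'n \<Rightarrow> real) \<Rightarrow> bool" where
  "smooth_on U f \<longleftrightarrow> (\<forall>k. Ck_on k U f)"

definition smooth_field_on :: "(real ^ 'n) set \<Rightarrow> (real ^ 'n \<Rightarrow> real ^ 'n) \<Rightarrow> bool" where
  "smooth_field_on U Y \<longleftrightarrow> (\<forall>k. smooth_on U (\<lambda>q. Y q $ k))"

text \<open>
  Smoothness on a set that need not be open (here: a manifold with boundary) means the existence
  of local smooth extensions. The values of \<open>u\<close> outside \<open>S\<close> are irrelevant.
\<close>

definition smooth_upto :: "(real ^ 'n) set \<Rightarrow> (real ^ 'n \<Rightarrow> real) \<Rightarrow> bool" where
  "smooth_upto S u \<longleftrightarrow>
     (\<forall>p\<in>S. \<exists>W v. open W \<and> p \<in> W \<and> smooth_on W v \<and> (\<forall>q\<in>W \<inter> S. u q = v q))"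


section \<open>Riemannian metrics in a global chart\<close>

text \<open>
  A Riemannian metric on an open subset of \<open>real ^ 'n\<close> is given by its matrix-valued
  function \<open>g\<close> in the standard coordinates; covariant 2-tensors are matrices as well.
\<close>

type_synonym 'n metric = "real ^ 'n \<Rightarrow> real ^ 'n ^ 'n"

definition metric_inner :: "'n::finite metric \<Rightarrow> real ^ 'n \<Rightarrow> real ^ 'n \<Rightarrow> real ^ 'n \<Rightarrow> real" where
  "metric_inner g p X Y = (\<Sum>i\<in>UNIV. \<Sum>j\<in>UNIV. g p $ i $ j * X $ i * Y $ j)"

text \<open>\<open>christoffel g k i j\<close> has the upper index \<open>k\<close>.\<close>

definition christoffel :: "'n::finite metric \<Rightarrow> 'n \<Rightarrow> 'n \<Rightarrow> 'n \<Rightarrow> real ^ 'n \<Rightarrow> real" where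
  "christoffel g k i j p =
     (1 / 2) * (\<Sum>l\<in>UNIV. matrix_inv (g p) $ k $ l *
        (partial i (\<lambda>q. g q $ j $ l) p + partial j (\<lambda>q. g q $ i $ l) p
          - partial l (\<lambda>q. g q $ i $ j) p))"

text \<open>The derivative of the field \<open>Y\<close> along the vector \<open>X\<close> at \<open>p\<close> for the Levi-Civita connection.\<close>

definition cov_deriv ::
  "'n::finite metric \<Rightarrow> real ^ 'n \<Rightarrow> (real ^ 'n \<Rightarrow> real ^ 'n) \<Rightarrow> real ^ 'n \<Rightarrow> real ^ 'n" where
  "cov_deriv g X Y p =
     (\<chi> k. (\<Sum>i\<in>UNIV. X $ i * partial i (\<lambda>q. Y q $ k) p)
          + (\<Sum>i\<in>UNIV. \<Sum>j\<in>UNIV. christoffel g k i j p * X $ i * Y p $ j))"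

definition hessian :: "'n::finite metric \<Rightarrow> (real ^ 'n \<Rightarrow> real) \<Rightarrow> real ^ 'n \<Rightarrow> real ^ 'n ^ 'n" where
  "hessian g u p =
     (\<chi> i j. partial i (partial j u) p - (\<Sum>k\<in>UNIV. christoffel g k i j p * partial k u p))"

definition laplacian :: "'n::finite metric \<Rightarrow> (real ^ 'n \<Rightarrow> real) \<Rightarrow> real ^ 'n \<Rightarrow> real" where
  "laplacian g u p =
     (\<Sum>i\<in>UNIV. \<Sum>j\<in>UNIV. matrix_inv (g p) $ i $ j * hessian g u p $ i $ j)"

text \<open>
  \<open>riemann g l k i j\<close> is the \<open>l\<close>-th component of \<open>R(e\<^sub>i, e\<^sub>j) e\<^sub>k\<close>, where
  \<open>R(X, Y) = D\<^sub>X D\<^sub>Y - D\<^sub>Y D\<^sub>X\<close> for commuting \<open>X\<close>, \<open>Y\<close>; then \<open>Ric(Y, Z)\<close> is the trace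
  of \<open>X \<mapsto> R(X, Y) Z\<close>, which is positive on round spheres.
\<close>

definition riemann :: "'n::finite metric \<Rightarrow> 'n \<Rightarrow> 'n \<Rightarrow> 'n \<Rightarrow> 'n \<Rightarrow> real ^ 'n \<Rightarrow> real" where
  "riemann g l k i j p =
     partial i (christoffel g l j k) p - partial j (christoffel g l i k) p
     + (\<Sum>m\<in>UNIV. christoffel g l i m p * christoffel g m j k p
                  - christoffel g l j m p * christoffel g m i k p)"

definition ricci :: "'n::finite metric \<Rightarrow> real ^ 'n \<Rightarrow> real ^ 'n ^ 'n" where
  "ricci g p = (\<chi> j k. \<Sum>i\<in>UNIV. riemann g i k i j p)"

definition Lstar :: "'n::finite metric \<Rightarrow> (real ^ 'n \<Rightarrow> real) \<Rightarrow> real ^ 'n \<Rightarrow> real ^ 'n ^ 'n" where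
  "Lstar g u p = - (laplacian g u p *\<^sub>R g p) + hessian g u p - u p *\<^sub>R ricci g p"

text \<open>
  The length distance of \<open>S\<close>. The curves may have zero velocity, so concatenations
  can be reparametrized to be C1 and restricting to C1 curves does not change the
  infimum. It is infinite if no curve exists.
\<close>

definition curve_length :: "'n::finite metric \<Rightarrow> (real \<Rightarrow> real ^ 'n) \<Rightarrow> real" where
  "curve_length g c =
     integral {0..1} (\<lambda>t. sqrt (metric_inner g (c t) (vector_derivative c (at t))
                                                    (vector_derivative c (at t))))"

definition riem_dist ::
  "'n::finite metric \<Rightarrow> (real ^ 'n) set \<Rightarrow> real ^ 'n \<Rightarrow> real ^ 'n \<Rightarrow> ennreal" where
  "riem_dist g S x y =
     (INF c\<in>{c. c C1_differentiable_on {0..1} \<and> c ` {0..1} \<subseteq> S \<and> c 0 = x \<and> c 1 = y}.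
        ennreal (curve_length g c))"

definition riem_complete :: "'n::finite metric \<Rightarrow> (real ^ 'n) set \<Rightarrow> bool" where
  "riem_complete g S \<longleftrightarrow>
     (\<forall>s :: nat \<Rightarrow> real ^ 'n.
        range s \<subseteq> S \<and> (\<forall>e>0. \<exists>N. \<forall>i\<ge>N. \<forall>j\<ge>N. riem_dist g S (s i) (s j) < e)
        \<longrightarrow> (\<exists>x\<in>S. (\<lambda>i. riem_dist g S (s i) x) \<longlonglongrightarrow> 0))"


section \<open>Domains\<close>

text \<open>
  The velocities of curves in \<open>T\<close> through \<open>p\<close>. For a smooth embedded hypersurface \<open>T\<close>
  this is the usual tangent space, although the curve need only be differentiable at \<open>0\<close>.
\<close>

definition tangent_space :: "(real ^ 'n) set \<Rightarrow> real ^ 'n \<Rightarrow> (real ^ 'n) set" where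
  "tangent_space T p =
     {v. \<exists>c. range c \<subseteq> T \<and> c 0 = p \<and> (c has_vector_derivative v) (at (0::real))}"

text \<open>
  A domain in the open set \<open>M\<close> with metric \<open>g\<close>, with \<open>\<Sigma>\<close> its boundary relative to \<open>M\<close>, so that
  \<open>\<Omega> \<union> \<Sigma>\<close> is its closure in \<open>M\<close>. Smoothness is expressed by local defining functions; in
  particular \<open>\<Omega>\<close> lies locally on one side of \<open>\<Sigma>\<close>.
\<close>

definition domain_in ::
  "'n::finite metric \<Rightarrow> (real ^ 'n) set \<Rightarrow> (real ^ 'n) set \<Rightarrow> (real ^ 'n) set \<Rightarrow> bool" where
  "domain_in g M \<Omega> \<Sigma> \<longleftrightarrow>
     \<Omega> \<subseteq> M \<and> open \<Omega> \<and> connected \<Omega> \<and> \<Sigma> = M \<inter> frontier \<Omega> \<and> \<Sigma> \<noteq> {} \<and>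
     (\<forall>p\<in>\<Sigma>. \<exists>W \<phi>. open W \<and> p \<in> W \<and> W \<subseteq> M \<and> smooth_on W \<phi> \<and>
        (\<forall>q\<in>W. \<exists>i. partial i \<phi> q \<noteq> 0) \<and>
        W \<inter> \<Omega> = {q \<in> W. \<phi> q < 0} \<and> W \<inter> \<Sigma> = {q \<in> W. \<phi> q = 0}) \<and>
     riem_complete g (\<Omega> \<union> \<Sigma>)"

definition simple_domain :: "(real ^ 'n) set \<Rightarrow> bool" where
  "simple_domain \<Sigma> \<longleftrightarrow> (\<exists>!C. C \<in> components \<Sigma>)"

definition outward_unit_normal ::
  "'n::finite metric \<Rightarrow> (real ^ 'n) set \<Rightarrow> (real ^ 'n) set \<Rightarrow> real ^ 'n \<Rightarrow> real ^ 'n \<Rightarrow> bool" where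
  "outward_unit_normal g \<Omega> \<Sigma> p \<nu> \<longleftrightarrow>
     metric_inner g p \<nu> \<nu> = 1 \<and> (\<forall>X\<in>tangent_space \<Sigma> p. metric_inner g p \<nu> X = 0) \<and>
     (\<forall>\<^sub>F t in at_right 0. p - t *\<^sub>R \<nu> \<in> \<Omega>)"

text \<open>
  One-sided, since \<open>u\<close> is only meaningful on the closure of the domain, which for small \<open>t < 0\<close>
  contains \<open>p + t \<nu>\<close>.
\<close>

definition normal_deriv :: "(real ^ 'n \<Rightarrow> real) \<Rightarrow> real ^ 'n \<Rightarrow> real ^ 'n \<Rightarrow> real" where
  "normal_deriv u \<nu> p = vector_derivative (\<lambda>t. u (p + t *\<^sub>R \<nu>)) (at_left 0)"

text \<open>
  Here \<open>X\<close> is a tangent vector of the hypersurface at \<open>p\<close>, and \<open>Y\<close> a vector field near \<open>p\<close>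
  that is tangent to the hypersurface along it.
\<close>

definition second_fund_form ::
  "'n::finite metric \<Rightarrow> real ^ 'n \<Rightarrow> real ^ 'n \<Rightarrow> (real ^ 'n \<Rightarrow> real ^ 'n) \<Rightarrow> real ^ 'n \<Rightarrow> real" where
  "second_fund_form g \<nu> X Y p = - metric_inner g p \<nu> (cov_deriv g X Y p)"

definition non_generic ::
  "'n::finite metric \<Rightarrow> (real ^ 'n) set \<Rightarrow> (real ^ 'n) set \<Rightarrow> bool" where
  "non_generic g \<Omega> \<Sigma> \<longleftrightarrow>
     (\<exists>u. smooth_upto (\<Omega> \<union> \<Sigma>) u \<and> (\<exists>p\<in>\<Omega> \<union> \<Sigma>. u p \<noteq> 0) \<and>
        (\<forall>p\<in>\<Omega>. Lstar g u p = 0) \<and>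
        (\<forall>p\<in>\<Sigma>. \<forall>\<nu> X W Y.
           outward_unit_normal g \<Omega> \<Sigma> p \<nu> \<and> X \<in> tangent_space \<Sigma> p \<and>
           open W \<and> p \<in> W \<and> smooth_field_on W Y \<and> (\<forall>q\<in>W \<inter> \<Sigma>. Y q \<in> tangent_space \<Sigma> q)
           \<longrightarrow> normal_deriv u \<nu> p * metric_inner g p X (Y p)
               = u p * second_fund_form g \<nu> X Y p))"


section \<open>The upper half-space model\<close>

text \<open>The index \<open>d\<close> plays the role of the last coordinate.\<close>

definition hyp_space :: "'n \<Rightarrow> (real ^ 'n) set" where
  "hyp_space d = {y. y $ d > 0}"

definition hyp_boundary :: "'n \<Rightarrow> (real ^ 'n) set" where
  "hyp_boundary d = {y. y $ d = 0}"

definition hyp_metric :: "'n::finite \<Rightarrow> 'n metric" where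
  "hyp_metric d y = (1 / (y $ d)\<^sup>2) *\<^sub>R mat 1"

definition tangent_at :: "(real ^ 'n) set \<Rightarrow> (real ^ 'n) set \<Rightarrow> real ^ 'n \<Rightarrow> bool" where
  "tangent_at S T p \<longleftrightarrow> p \<in> S \<inter> T \<and> tangent_space S p = tangent_space T p"

definition transversal :: "(real ^ 'n) set \<Rightarrow> (real ^ 'n) set \<Rightarrow> bool" where
  "transversal S T \<longleftrightarrow>
     (\<forall>p\<in>S \<inter> T. {v + w | v w. v \<in> tangent_space S p \<and> w \<in> tangent_space T p} = UNIV)"

definition horosphere :: "'n::finite \<Rightarrow> (real ^ 'n) set \<Rightarrow> bool" where
  "horosphere d \<Sigma> \<longleftrightarrow>
     (\<exists>a r. r > 0 \<and> \<Sigma> = sphere a r \<inter> hyp_space d \<and> \<Sigma> \<noteq> {} \<and>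
        (\<exists>p. tangent_at (sphere a r) (hyp_boundary d) p))"

definition hypersphere :: "'n::finite \<Rightarrow> (real ^ 'n) set \<Rightarrow> bool" where
  "hypersphere d \<Sigma> \<longleftrightarrow>
     (\<exists>a r. r > 0 \<and> \<Sigma> = sphere a r \<inter> hyp_space d \<and> \<Sigma> \<noteq> {} \<and>
        sphere a r \<inter> hyp_boundary d \<noteq> {} \<and> transversal (sphere a r) (hyp_boundary d))"

definition geodesic_sphere :: "'n::finite \<Rightarrow> (real ^ 'n) set \<Rightarrow> bool" where
  "geodesic_sphere d \<Sigma> \<longleftrightarrow>
     (\<exists>a r. r > 0 \<and> \<Sigma> = sphere a r \<inter> hyp_space d \<and> \<Sigma> \<noteq> {} \<and> sphere a r \<subseteq> hyp_space d)"

definition hyperplane_section :: "'n::finite \<Rightarrow> (real ^ 'n) set \<Rightarrow> bool" where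
  "hyperplane_section d \<Sigma> \<longleftrightarrow>
     (\<exists>a b. a \<noteq> 0 \<and> \<Sigma> = {y. a \<bullet> y = b} \<inter> hyp_space d \<and> \<Sigma> \<noteq> {})"

end

theory Submission
  imports Defs
begin

text \<open>
  On the half-space the equation \<open>L\<^sup>* u = 0\<close> is \<open>Hess u = u g\<close>, because the space has constant curvature
  \<open>-1\<close>. For \<open>V = y\<^sub>d u\<close> this says that the Euclidean Hessian of \<open>V\<close> is \<open>V\<^sub>d / y\<^sub>d\<close> times the identity,
  and it follows that \<open>V = A |y|\<^sup>2 + b \<bullet> y + c\<close> with \<open>b\<^sub>d = 0\<close> (\<open>potential_quadratic\<close>).

  The metric is conformal to the Euclidean one, and in terms of \<open>V\<close> and the Euclidean outward normal \<open>N\<close> the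
  boundary condition loses all reference to hyperbolic geometry (\<open>boundary_condition_iff\<close>):
  \<open>(N \<bullet> grad V) (X \<bullet> Y) = V (Y \<bullet> dN X)\<close> for tangent vectors \<open>X\<close> and \<open>Y\<close>.

  Let \<open>V\<close> be a nontrivial solution. Where \<open>V\<close> does not vanish, the hypersurface is umbilic with principal
  curvature \<open>\<kappa> = (N \<bullet> grad V) / V\<close>. Differentiating \<open>V \<kappa> = N \<bullet> grad V\<close> along the hypersurface shows that
  \<open>\<kappa>\<close> is constant. The zeros of \<open>V\<close> are nowhere dense in the hypersurface, so both facts extend to
  all of it (\<open>static_boundary_normal_affine_locally\<close>). Then \<open>N - \<kappa> q\<close> is constant, which places the connected
  hypersurface in a sphere (\<open>\<kappa> \<noteq> 0\<close>) or a hyperplane (\<open>\<kappa> = 0\<close>). Being closed and open in the connected part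
  of this sphere or hyperplane inside the half-space, it is all of it
  (\<open>static_boundary_sphere_or_hyperplane\<close>). The height of the centre of a sphere decides between the first
  three types (\<open>sphere_hyp_cases\<close>).

  Conversely, the part above \<open>y\<^sub>d = 0\<close> of a side of a hyperplane has the potential \<open>V = 1\<close>, and that of a ball with
  centre \<open>a\<close> the potential \<open>V = y\<^sub>i - a\<^sub>i\<close> for a coordinate \<open>i \<noteq> d\<close>. The closures of these domains are convex, and a convex
  subset of the half-space that is closed in it is complete (\<open>riem_complete_hyp_convex\<close>).
\<close>

section \<open>Calculus of smooth functions\<close>

lemma partial_eq:
  assumes "(f has_derivative f') (at p)"
  shows "partial i f p = f' (axis i 1)"
  using assms frechet_derivative_at partial_def by metis

lemma partial_cong:
  assumes "open U" "p \<in> U" "\<And>q. q \<in> U \<Longrightarrow> f q = g q"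
  shows "partial i f p = partial i g p"
proof -
  have "(f has_derivative D) (at p) \<longleftrightarrow> (g has_derivative D) (at p)" for D
    using assms has_derivative_transform_within_open[of _ _ p UNIV U]
    by metis
  then show ?thesis
    by (simp add: partial_def frechet_derivative_def)
qed

definition grad :: "(real ^ 'n \<Rightarrow> real) \<Rightarrow> real ^ 'n \<Rightarrow> real ^ 'n" where
  "grad f p = (\<chi> i. partial i f p)"

lemma grad_nth [simp]: "grad f p $ i = partial i f p"
  by (simp add: grad_def)

lemma linear_vec_expand:
  fixes L :: "real ^ 'n::finite \<Rightarrow> 'b::real_vector"
  assumes "linear L"
  shows "L h = (\<Sum>i\<in>UNIV. h $ i *\<^sub>R L (axis i 1))"
proof -
  have "L h = L (\<Sum>i\<in>UNIV. h $ i *\<^sub>R axis i 1)"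
    using basis_expansion[of h] by (simp add: scalar_mult_eq_scaleR)
  then show ?thesis
    using assms by (simp add: linear_sum linear_scale)
qed

lemma has_derivative_grad:
  fixes f :: "real ^ 'n::finite \<Rightarrow> real"
  assumes "f differentiable (at p)"
  shows "(f has_derivative (\<lambda>h. grad f p \<bullet> h)) (at p)"
proof -
  obtain D where D: "(f has_derivative D) (at p)"
    using assms differentiable_def by blast
  have "D h = grad f p \<bullet> h" for h
    using linear_vec_expand[OF has_derivative_linear[OF D], of h] partial_eq[OF D]
    by (simp add: inner_vec_def mult.commute)
  then show ?thesis
    using D by presburger
qed

lemma grad_eqI:
  fixes f :: "real ^ 'n::finite \<Rightarrow> real"
  assumes "(f has_derivative (\<lambda>h. v \<bullet> h)) (at p)"
  shows "grad f p = v"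
  by (simp add: vec_eq_iff partial_eq[OF assms] inner_axis)

lemma Ck_on_cong:
  assumes "open U" "\<And>q. q \<in> U \<Longrightarrow> f q = g q" "Ck_on k U f"
  shows "Ck_on k U g"
  using assms
proof (induction k arbitrary: f g)
  case 0
  then show ?case by (simp cong: continuous_on_cong)
next
  case (Suc k)
  have "g differentiable_on U"
    using Suc.prems unfolding differentiable_on_def
    by (metis Ck_on.simps(2) Suc.prems(2) differentiable_on_def differentiable_transform_within zero_less_one)
  moreover have "Ck_on k U (partial i g)" for i
  proof (rule Suc.IH[OF Suc.prems(1)])
    show "partial i f q = partial i g q" if "q \<in> U" for q
      using partial_cong[OF Suc.prems(1) that Suc.prems(2)] .
  qed (use Suc.prems in simp)
  ultimately show ?case by simp
qed

lemma Ck_on_SucD: "Ck_on (Suc k) U f \<Longrightarrow> Ck_on k U f"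
proof (induction k arbitrary: f)
  case 0
  then show ?case by (simp add: differentiable_imp_continuous_on)
next
  case (Suc k)
  then show ?case by (metis Ck_on.simps(2))
qed

lemma Ck_on_subset: "Ck_on k U f \<Longrightarrow> V \<subseteq> U \<Longrightarrow> Ck_on k V f"
  by (induction k arbitrary: f) (auto intro: continuous_on_subset differentiable_on_subset)

lemma partial_const: "partial i (\<lambda>_. c) = (\<lambda>_. 0)"
  by (rule ext) (simp add: partial_eq[OF has_derivative_const])

lemma Ck_on_const: "Ck_on k U (\<lambda>_. c)"
proof (induction k arbitrary: c)
  case (Suc k)
  then show ?case by (simp add: partial_const)
qed simp

lemma Ck_on_coord: "Ck_on k U (\<lambda>q::real ^ 'n::finite. q $ i)"
proof (cases k)
  case (Suc m)
  have d: "((\<lambda>q::real ^ 'n. q $ i) has_derivative (\<lambda>h. h $ i)) (at p)" for p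
    by (rule bounded_linear.has_derivative[OF bounded_linear_vec_nth has_derivative_ident])
  have p: "partial j (\<lambda>q::real ^ 'n. q $ i) = (\<lambda>_. axis j 1 $ i)" for j
    by (rule ext) (simp add: partial_eq[OF d])
  have "(\<lambda>q::real ^ 'n. q $ i) differentiable_on U"
    using d by (meson differentiable_at_withinI differentiable_def differentiable_on_def)
  then show ?thesis
    by (simp add: Suc p Ck_on_const)
qed (simp add: continuous_intros)

text \<open>
  Reduces the smoothness of a function given by a formula to that of the formula for its derivative,
  so that the closure properties below need no partial derivatives of compound expressions.
\<close>

lemma Ck_on_SucI:
  assumes "open U" "\<And>q. q \<in> U \<Longrightarrow> (f has_derivative f' q) (at q)"
    and "\<And>i. Ck_on k U (\<lambda>q. f' q (axis i 1))"
  shows "Ck_on (Suc k) U f"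
proof -
  have "f differentiable_on U"
    using assms(2) by (meson differentiable_at_withinI differentiable_def differentiable_on_def)
  moreover have "Ck_on k U (partial i f)" for i
    using Ck_on_cong[OF assms(1) _ assms(3)[of i]] partial_eq[OF assms(2)] by metis
  ultimately show ?thesis by simp
qed

lemma Ck_on_Suc_has_derivative:
  fixes f :: "real ^ 'n::finite \<Rightarrow> real"
  assumes "open U" "Ck_on (Suc k) U f" "q \<in> U"
  shows "(f has_derivative (\<lambda>h. grad f q \<bullet> h)) (at q)"
  using assms by (auto intro!: has_derivative_grad simp: differentiable_on_eq_differentiable_at)

lemma Ck_on_add:
  fixes f :: "real ^ 'n::finite \<Rightarrow> real"
  assumes "open U" "Ck_on k U f" "Ck_on k U g"
  shows "Ck_on k U (\<lambda>q. f q + g q)"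
  using assms
proof (induction k arbitrary: f g)
  case 0
  then show ?case by (simp add: continuous_intros)
next
  case (Suc k)
  show ?case
  proof (rule Ck_on_SucI)
    show "((\<lambda>q. f q + g q) has_derivative (\<lambda>h. grad f q \<bullet> h + grad g q \<bullet> h)) (at q)"
      if "q \<in> U" for q
      using Suc.prems that by (intro has_derivative_add Ck_on_Suc_has_derivative)
    show "Ck_on k U (\<lambda>q. grad f q \<bullet> axis i 1 + grad g q \<bullet> axis i 1)" for i
      using Suc.prems by (simp add: inner_axis Suc.IH)
  qed (use Suc.prems in auto)
qed

lemma Ck_on_mult:
  fixes f :: "real ^ 'n::finite \<Rightarrow> real"
  assumes "open U" "Ck_on k U f" "Ck_on k U g"
  shows "Ck_on k U (\<lambda>q. f q * g q)"
  using assms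
proof (induction k arbitrary: f g)
  case 0
  then show ?case by (simp add: continuous_intros)
next
  case (Suc k)
  show ?case
  proof (rule Ck_on_SucI)
    show "((\<lambda>q. f q * g q) has_derivative (\<lambda>h. f q * (grad g q \<bullet> h) + (grad f q \<bullet> h) * g q)) (at q)"
      if "q \<in> U" for q
      using Suc.prems that by (intro has_derivative_mult Ck_on_Suc_has_derivative)
    show "Ck_on k U (\<lambda>q. f q * (grad g q \<bullet> axis i 1) + grad f q \<bullet> axis i 1 * g q)" for i
    proof -
      have "Ck_on k U f" "Ck_on k U g" "Ck_on k U (partial i f)" "Ck_on k U (partial i g)"
        using Suc.prems Ck_on_SucD by auto
      then show ?thesis
        by (simp add: inner_axis Ck_on_add Suc.IH Suc.prems(1))
    qed
  qed (use Suc.prems in auto)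
qed

text \<open>
  The derivative of a power is again a power times a derivative of the base. With the exponent
  generalized, one induction therefore settles reciprocals and inverse square roots together.
\<close>

lemma Ck_on_powr:
  fixes f :: "real ^ 'n::finite \<Rightarrow> real"
  assumes "open U" "Ck_on k U f" "\<And>q. q \<in> U \<Longrightarrow> f q > 0"
  shows "Ck_on k U (\<lambda>q. f q powr s)"
  using assms
proof (induction k arbitrary: f s)
  case 0
  then have "continuous_on U f" by simp
  then have "continuous_on U (\<lambda>q. f q powr s)"
    by (rule continuous_on_powr[OF _ continuous_on_const]) (use 0 in force)
  then show ?case by simp
next
  case (Suc k)
  show ?case
  proof (rule Ck_on_SucI)
    show "((\<lambda>q. f q powr s) has_derivative (\<lambda>h. s * f q powr (s - 1) * (grad f q \<bullet> h))) (at q)"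
      if "q \<in> U" for q
    proof -
      have "((\<lambda>x. x powr s) has_real_derivative s * f q powr (s - 1)) (at (f q))"
        using Suc.prems(3)[OF that] by (rule has_real_derivative_powr)
      from has_derivative_compose[OF Ck_on_Suc_has_derivative[OF Suc.prems(1,2) that]
          this[unfolded has_field_derivative_def]]
      show ?thesis .
    qed
    show "Ck_on k U (\<lambda>q. s * f q powr (s - 1) * (grad f q \<bullet> axis i 1))" for i
    proof -
      have "Ck_on k U f" "Ck_on k U (partial i f)"
        using Suc.prems Ck_on_SucD by auto
      then show ?thesis
        by (simp add: inner_axis Ck_on_mult Ck_on_const Suc.IH Suc.prems)
    qed
  qed (use Suc.prems in auto)
qed

lemma smooth_on_cong:
  "open U \<Longrightarrow> (\<And>q. q \<in> U \<Longrightarrow> f q = g q) \<Longrightarrow> smooth_on U f \<Longrightarrow> smooth_on U g"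
  unfolding smooth_on_def using Ck_on_cong by blast

lemma smooth_on_subset: "smooth_on U f \<Longrightarrow> V \<subseteq> U \<Longrightarrow> smooth_on V f"
  unfolding smooth_on_def using Ck_on_subset by blast

lemma Ck_on_local:
  assumes "\<And>p. p \<in> U \<Longrightarrow> \<exists>W. open W \<and> p \<in> W \<and> Ck_on k W f"
  shows "Ck_on k U f"
  using assms
proof (induction k arbitrary: f)
  case 0
  have "isCont f p" if "p \<in> U" for p
    using 0[OF that] by (auto simp: continuous_on_eq_continuous_at)
  then show ?case
    by (simp add: continuous_at_imp_continuous_on)
next
  case (Suc k)
  have "f differentiable (at p)" if "p \<in> U" for p
    using Suc.prems[OF that] by (auto simp: differentiable_on_eq_differentiable_at)
  then have "f differentiable_on U"
    by (meson differentiable_at_withinI differentiable_on_def)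
  moreover have "Ck_on k U (partial i f)" for i
    by (rule Suc.IH) (use Suc.prems in fastforce)
  ultimately show ?case by simp
qed

lemma smooth_on_local:
  assumes "\<And>p. p \<in> U \<Longrightarrow> \<exists>W. open W \<and> p \<in> W \<and> smooth_on W f"
  shows "smooth_on U f"
  unfolding smooth_on_def
proof (intro allI Ck_on_local)
  show "\<exists>W. open W \<and> p \<in> W \<and> Ck_on k W f" if "p \<in> U" for k p
    using assms[OF that] by (auto simp: smooth_on_def)
qed

lemma smooth_on_const [intro, simp]: "smooth_on U (\<lambda>_. c)"
  by (simp add: smooth_on_def Ck_on_const)

lemma smooth_on_coord [intro, simp]: "smooth_on U (\<lambda>q::real ^ 'n::finite. q $ i)"
  by (simp add: smooth_on_def Ck_on_coord)

lemma smooth_on_partial: "smooth_on U f \<Longrightarrow> smooth_on U (partial i f)"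
  unfolding smooth_on_def by (metis Ck_on.simps(2))

context
  fixes U :: "(real ^ 'n::finite) set"
  assumes U: "open U"
begin

lemma smooth_on_add: "smooth_on U f \<Longrightarrow> smooth_on U g \<Longrightarrow> smooth_on U (\<lambda>q. f q + g q)"
  by (simp add: smooth_on_def Ck_on_add U)

lemma smooth_on_mult: "smooth_on U f \<Longrightarrow> smooth_on U g \<Longrightarrow> smooth_on U (\<lambda>q. f q * g q)"
  by (simp add: smooth_on_def Ck_on_mult U)

lemma smooth_on_powr:
  "smooth_on U f \<Longrightarrow> (\<And>q. q \<in> U \<Longrightarrow> f q > 0) \<Longrightarrow> smooth_on U (\<lambda>q. f q powr s)"
  by (simp add: smooth_on_def Ck_on_powr U)

lemma smooth_on_diff: "smooth_on U f \<Longrightarrow> smooth_on U g \<Longrightarrow> smooth_on U (\<lambda>q. f q - g q)"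
  using smooth_on_add[of f "\<lambda>q. -1 * g q"] smooth_on_mult[of "\<lambda>_. -1" g] by simp

lemma smooth_on_sum: "(\<And>i. i \<in> I \<Longrightarrow> smooth_on U (f i)) \<Longrightarrow> smooth_on U (\<lambda>q. \<Sum>i\<in>I. f i q)"
  by (induction I rule: infinite_finite_induct) (auto intro: smooth_on_add)

lemma smooth_on_inner:
  "(\<And>i. smooth_on U (\<lambda>q. X q $ i)) \<Longrightarrow> (\<And>i. smooth_on U (\<lambda>q. Y q $ i))
    \<Longrightarrow> smooth_on U (\<lambda>q. X q \<bullet> (Y q :: real ^ 'm::finite))"
  by (simp add: inner_vec_def smooth_on_sum smooth_on_mult)

lemma smooth_on_has_derivative:
  "smooth_on U f \<Longrightarrow> q \<in> U \<Longrightarrow> (f has_derivative (\<lambda>h. grad f q \<bullet> h)) (at q)"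
  using Ck_on_Suc_has_derivative[OF U] smooth_on_def by blast

lemma smooth_on_continuous: "smooth_on U f \<Longrightarrow> continuous_on U f"
  unfolding smooth_on_def by (metis Ck_on.simps(1))

lemma smooth_on_continuous_grad: "smooth_on U f \<Longrightarrow> continuous_on U (grad f)"
  unfolding grad_def by (intro continuous_on_vec_lambda smooth_on_continuous smooth_on_partial)

end

section \<open>Level sets\<close>

text \<open>
  Straightening a level set: the map \<open>F\<close> replaces the component of \<open>y\<close> along the unit normal \<open>n\<close> at \<open>p\<close>
  by \<open>\<phi> y\<close>. Its derivative at \<open>p\<close> only rescales the direction \<open>n\<close>, so the inverse function theorem applies,
  and the local inverse \<open>g\<close> carries the hyperplane \<open>n \<bullet> z = 0\<close> to the zero set of \<open>\<phi>\<close>.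
\<close>

lemma level_set_chart:
  fixes \<phi> :: "real ^ 'n::finite \<Rightarrow> real"
  assumes "open W" "smooth_on W \<phi>" "p \<in> W" "grad \<phi> p \<noteq> 0"
    and n_def: "n = grad \<phi> p /\<^sub>R norm (grad \<phi> p)"
    and F_def: "F = (\<lambda>y. y + (\<phi> y - n \<bullet> y) *\<^sub>R n)"
  obtains U V g g' where "open U" "U \<subseteq> W" "p \<in> U" "open V" "F p \<in> V"
    "\<And>y. y \<in> U \<Longrightarrow> F y \<in> V \<and> g (F y) = y"
    "\<And>z. z \<in> V \<Longrightarrow> g z \<in> U \<and> F (g z) = z"
    "\<And>z. z \<in> V \<Longrightarrow> (g has_derivative g' z) (at z)"
    "\<And>z. z \<in> V \<Longrightarrow> \<phi> (g z) = n \<bullet> z"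
    "continuous_on U F"
proof -
  have n: "n \<bullet> n = 1" "grad \<phi> p = norm (grad \<phi> p) *\<^sub>R n"
    using assms(4) by (simp_all add: n_def dot_square_norm power2_eq_square)
  define F' where "F' y = id_blinfun + (blinfun_scaleR_left n o\<^sub>L blinfun_inner_right (grad \<phi> y - n))" for y
  have F'_apply: "blinfun_apply (F' y) h = h + (grad \<phi> y \<bullet> h - n \<bullet> h) *\<^sub>R n" for y h
    by (simp add: F'_def blinfun.add_left inner_diff_left)
  have derF: "(F has_derivative blinfun_apply (F' y)) (at y)" if "y \<in> W" for y
    unfolding F'_apply[abs_def] F_def
    by (rule derivative_eq_intros smooth_on_has_derivative[OF assms(1,2) that] refl)+ simp
  have contF': "continuous_on W F'"
    unfolding F'_def
    by (intro continuous_intros bounded_linear.continuous_on[OF bounded_linear_blinfun_inner_right]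
        bounded_bilinear.continuous_on[OF bounded_bilinear_blinfun_compose]
        smooth_on_continuous_grad[OF assms(1,2)])
  \<comment> \<open>The left inverse of \<open>F'\<close> at \<open>p\<close> undoes the rescaling in direction \<open>n\<close> by \<open>|grad \<phi>|\<close>.\<close>
  define I where "I = id_blinfun + (blinfun_scaleR_left n o\<^sub>L
      blinfun_inner_right ((1 / norm (grad \<phi> p) - 1) *\<^sub>R n))"
  have "I o\<^sub>L F' p = id_blinfun"
  proof (rule blinfun_eqI)
    fix h
    have gh: "grad \<phi> p \<bullet> h = norm (grad \<phi> p) * (n \<bullet> h)"
      by (subst n(2)) simp
    have "blinfun_apply (I o\<^sub>L F' p) h = h + (norm (grad \<phi> p) * (n \<bullet> h) - n \<bullet> h) *\<^sub>R n
       + ((1 / norm (grad \<phi> p) - 1) * (n \<bullet> h + (norm (grad \<phi> p) * (n \<bullet> h) - n \<bullet> h) * (n \<bullet> n))) *\<^sub>R n"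
      by (simp add: I_def F'_apply blinfun.add_left gh inner_add_right algebra_simps)
    also have "(1 / norm (grad \<phi> p) - 1) * (n \<bullet> h + (norm (grad \<phi> p) * (n \<bullet> h) - n \<bullet> h) * (n \<bullet> n))
        = - (norm (grad \<phi> p) * (n \<bullet> h) - n \<bullet> h)"
      using assms(4) by (simp add: n(1) field_simps)
    finally show "blinfun_apply (I o\<^sub>L F' p) h = blinfun_apply id_blinfun h"
      by (simp flip: scaleR_add_left)
  qed
  then obtain U V g g' where UV: "open U" "U \<subseteq> W" "p \<in> U" "open V" "F p \<in> V"
      and hom: "homeomorphism U V F g"
      and g: "\<And>z. z \<in> V \<Longrightarrow> (g has_derivative (g' z)) (at z)"
    using inverse_function_theorem[OF assms(1) derF contF' assms(3)] by metis
  have Fg: "F (g z) = z" "g z \<in> U" if "z \<in> V" for z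
    using hom that by (auto simp: homeomorphism_def)
  have "\<phi> (g z) = n \<bullet> z" if "z \<in> V" for z
  proof -
    have "n \<bullet> F (g z) = \<phi> (g z)"
      by (simp add: F_def inner_add_right n(1))
    then show ?thesis using Fg that by simp
  qed
  moreover have "F y \<in> V \<and> g (F y) = y" if "y \<in> U" for y
    using hom that by (auto simp: homeomorphism_def)
  ultimately show ?thesis
    using that[OF UV, of g g'] Fg g homeomorphism_cont1[OF hom] by blast
qed

lemma tangent_space_imp_grad_orthogonal:
  fixes f :: "real ^ 'n::finite \<Rightarrow> real"
  assumes W: "open W" "p \<in> W" and f: "f differentiable (at p)"
    and 0: "\<And>q. q \<in> W \<inter> T \<Longrightarrow> f q = 0" and v: "v \<in> tangent_space T p"
  shows "grad f p \<bullet> v = 0"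
proof -
  obtain c where c: "range c \<subseteq> T" "c 0 = p" "(c has_vector_derivative v) (at (0::real))"
    using v by (auto simp: tangent_space_def)
  have "((\<lambda>t. f (c t)) has_derivative (\<lambda>t. grad f p \<bullet> (t *\<^sub>R v))) (at 0)"
    using has_derivative_compose[OF c(3)[unfolded has_vector_derivative_def]]
      has_derivative_grad[OF f] c(2) by blast
  moreover have "((\<lambda>t. f (c t)) has_derivative (\<lambda>t. 0)) (at 0)"
  proof (rule has_derivative_transform_eventually[OF has_derivative_const])
    have "isCont c 0"
      using c(3) has_vector_derivative_continuous by blast
    then have "\<forall>\<^sub>F t in at 0. c t \<in> W"
      using W c(2) topological_tendstoD by (fastforce simp: isCont_def)
    then show "\<forall>\<^sub>F t in at 0. 0 = f (c t)"
      by (rule eventually_mono) (use 0 c(1) in force)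
    show "0 = f (c 0)"
      using 0[of p] c(1,2) W by force
  qed simp
  ultimately have "(\<lambda>t. grad f p \<bullet> (t *\<^sub>R v)) = (\<lambda>t. 0)"
    by (rule has_derivative_unique)
  from fun_cong[OF this, of 1] show ?thesis
    by simp
qed

text \<open>
  A vector in the kernel of the gradient is the velocity of the image under the chart of a straight
  line in the hyperplane \<open>n \<bullet> z = 0\<close>. The curves of a tangent space are defined for all times, hence the
  constant continuation where the line has left the domain of the chart.
\<close>

lemma level_set_tangent_space:
  fixes \<phi> :: "real ^ 'n::finite \<Rightarrow> real"
  assumes W: "open W" "smooth_on W \<phi>" "p \<in> W" "grad \<phi> p \<noteq> 0"
    and T: "W \<inter> T = {q \<in> W. \<phi> q = 0}" "p \<in> T"
  shows "tangent_space T p = {v. grad \<phi> p \<bullet> v = 0}"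
proof (intro set_eqI iffI)
  fix v assume "v \<in> tangent_space T p"
  then show "v \<in> {v. grad \<phi> p \<bullet> v = 0}"
    using tangent_space_imp_grad_orthogonal[OF W(1,3)] smooth_on_has_derivative[OF W(1-3)] T(1)
    by (auto simp: differentiable_def)
next
  fix v assume "v \<in> {v. grad \<phi> p \<bullet> v = 0}"
  then have v: "grad \<phi> p \<bullet> v = 0" by simp
  define n where "n = grad \<phi> p /\<^sub>R norm (grad \<phi> p)"
  define F where "F = (\<lambda>y. y + (\<phi> y - n \<bullet> y) *\<^sub>R n)"
  obtain U V g g' where UV: "open U" "U \<subseteq> W" "p \<in> U" "open V" "F p \<in> V"
    and gF: "\<And>y. y \<in> U \<Longrightarrow> F y \<in> V \<and> g (F y) = y"
    and Fg: "\<And>z. z \<in> V \<Longrightarrow> g z \<in> U \<and> F (g z) = z"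
    and g: "\<And>z. z \<in> V \<Longrightarrow> (g has_derivative g' z) (at z)"
    and \<phi>g: "\<And>z. z \<in> V \<Longrightarrow> \<phi> (g z) = n \<bullet> z"
    by (rule level_set_chart[OF W n_def F_def]) blast
  have nv: "n \<bullet> v = 0"
    using v by (simp add: n_def)
  have \<phi>p: "\<phi> p = 0"
    using T W by force
  define c where "c t = (if F p + t *\<^sub>R v \<in> V then g (F p + t *\<^sub>R v) else p)" for t :: real
  have "c t \<in> T" for t
  proof (cases "F p + t *\<^sub>R v \<in> V")
    case True
    have "n \<bullet> F p = 0"
      using \<phi>g[OF UV(5)] gF[OF UV(3)] \<phi>p by simp
    then have "\<phi> (c t) = 0"
      using True \<phi>g nv by (simp add: c_def inner_add_right)
    moreover have "c t \<in> W"
      using True Fg UV by (auto simp: c_def)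
    ultimately show ?thesis using T by blast
  qed (simp add: c_def T)
  moreover have "c 0 = p"
    using gF UV by (simp add: c_def)
  moreover have "(c has_vector_derivative v) (at 0)"
  proof -
    have "(g has_derivative g' (F p)) (at (F p + 0 *\<^sub>R v))"
      using g UV(5) by simp
    moreover have "((\<lambda>t. F p + t *\<^sub>R v) has_derivative (\<lambda>t. t *\<^sub>R v)) (at 0)"
      by (auto intro!: derivative_eq_intros)
    ultimately have d: "((\<lambda>t. g (F p + t *\<^sub>R v)) has_derivative (\<lambda>t. g' (F p) (t *\<^sub>R v))) (at 0)"
      by (rule has_derivative_compose[rotated])
    have lin: "linear (g' (F p))"
      using g UV(5) has_derivative_linear by blast
    define h where "h = g' (F p) v"
    \<comment> \<open>Differentiating \<open>\<phi> \<circ> g = (\<bullet>) n\<close> and \<open>F \<circ> g = id\<close> shows that the chart is the identity to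
      first order on \<open>n\<close>-orthogonal directions.\<close>
    have dg: "((\<lambda>z. \<phi> (g z)) has_derivative (\<lambda>k. grad \<phi> p \<bullet> g' (F p) k)) (at (F p))"
      using has_derivative_compose[OF g[OF UV(5)]] smooth_on_has_derivative[OF W(1-3)]
        gF[OF UV(3)] by metis
    have "((\<lambda>z. n \<bullet> z) has_derivative (\<lambda>k. grad \<phi> p \<bullet> g' (F p) k)) (at (F p))"
      by (rule has_derivative_transform_within_open[OF dg UV(4,5)]) (rule \<phi>g)
    moreover have "((\<lambda>z. n \<bullet> z) has_derivative (\<lambda>k. n \<bullet> k)) (at (F p))"
      by (auto intro!: derivative_eq_intros)
    ultimately have "(\<lambda>k. grad \<phi> p \<bullet> g' (F p) k) = (\<lambda>k. n \<bullet> k)"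
      by (rule has_derivative_unique)
    from fun_cong[OF this, of v] have "grad \<phi> p \<bullet> h = 0"
      using nv by (simp add: h_def)
    then have nh: "n \<bullet> h = 0"
      by (simp add: n_def)
    have gz: "g z + (n \<bullet> z - n \<bullet> g z) *\<^sub>R n = z" if "z \<in> V" for z
      using Fg[OF that] \<phi>g[OF that] by (simp add: F_def)
    have "((\<lambda>z. g z + (n \<bullet> z - n \<bullet> g z) *\<^sub>R n) has_derivative
        (\<lambda>k. g' (F p) k + (n \<bullet> k - n \<bullet> g' (F p) k) *\<^sub>R n)) (at (F p))"
      by (rule derivative_eq_intros g[OF UV(5)] refl)+ simp
    from has_derivative_transform_within_open[OF this UV(4,5) gz]
    have "((\<lambda>z. z) has_derivative
        (\<lambda>k. g' (F p) k + (n \<bullet> k - n \<bullet> g' (F p) k) *\<^sub>R n)) (at (F p))" .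
    from has_derivative_unique[OF this has_derivative_ident]
    have "h + (n \<bullet> v - n \<bullet> h) *\<^sub>R n = v"
      unfolding h_def by metis
    then have "h = v"
      using nh nv by simp
    then have "((\<lambda>t. g (F p + t *\<^sub>R v)) has_vector_derivative v) (at 0)"
      using d linear_scale[OF lin] by (simp add: has_vector_derivative_def h_def)
    moreover have "open {t. F p + t *\<^sub>R v \<in> V}"
      using open_vimage[OF UV(4), of "\<lambda>t. F p + t *\<^sub>R v"] by (simp add: vimage_def continuous_intros)
    ultimately show ?thesis
      by (rule has_vector_derivative_transform_within_open) (use UV in \<open>auto simp: c_def\<close>)
  qed
  ultimately show "v \<in> tangent_space T p"
    unfolding tangent_space_def by (intro CollectI exI[of _ c]) auto
qed

text \<open>
  In the chart, the points of the level set near \<open>p\<close> are joined to \<open>p\<close> by segments of a hyperplane, and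
  \<open>f\<close> has derivative zero along the image of such a segment.
\<close>

lemma level_set_locally_constant:
  fixes \<phi> :: "real ^ 'n::finite \<Rightarrow> real" and f :: "real ^ 'n \<Rightarrow> 'b::real_normed_vector"
  assumes W: "open W" "smooth_on W \<phi>" "p \<in> W" "grad \<phi> p \<noteq> 0"
    and T: "W \<inter> T = {q \<in> W. \<phi> q = 0}" "p \<in> T"
    and f: "\<And>q. q \<in> W \<inter> T \<Longrightarrow> (f has_derivative f' q) (at q)"
    and 0: "\<And>q X. q \<in> W \<inter> T \<Longrightarrow> grad \<phi> q \<bullet> X = 0 \<Longrightarrow> f' q X = 0"
  obtains W' where "open W'" "p \<in> W'" "\<And>q. q \<in> W' \<inter> T \<Longrightarrow> f q = f p"
proof -
  define n where "n = grad \<phi> p /\<^sub>R norm (grad \<phi> p)"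
  define F where "F = (\<lambda>y. y + (\<phi> y - n \<bullet> y) *\<^sub>R n)"
  obtain U V g g' where UV: "open U" "U \<subseteq> W" "p \<in> U" "open V" "F p \<in> V"
    and gF: "\<And>y. y \<in> U \<Longrightarrow> F y \<in> V \<and> g (F y) = y"
    and Fg: "\<And>z. z \<in> V \<Longrightarrow> g z \<in> U \<and> F (g z) = z"
    and g: "\<And>z. z \<in> V \<Longrightarrow> (g has_derivative g' z) (at z)"
    and \<phi>g: "\<And>z. z \<in> V \<Longrightarrow> \<phi> (g z) = n \<bullet> z"
    and contF: "continuous_on U F"
    by (rule level_set_chart[OF W n_def F_def]) blast
  obtain e where e: "e > 0" "ball (F p) e \<subseteq> V"
    using UV(4,5) openE by blast
  define W' where "W' = U \<inter> F -` ball (F p) e"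
  have "open W'"
    unfolding W'_def using continuous_open_preimage[OF contF UV(1)] by blast
  moreover have "p \<in> W'"
    using UV e by (simp add: W'_def)
  moreover have "f q = f p" if q: "q \<in> W' \<inter> T" for q
  proof -
    define k where "k = F q - F p"
    have nF: "n \<bullet> F y = 0" if "y \<in> U" "y \<in> T" for y
      using \<phi>g[of "F y"] gF[of y] that UV T(1) by force
    have nk: "n \<bullet> k = 0" and np: "n \<bullet> F p = 0"
      using nF UV(3) q T(2) by (auto simp: k_def W'_def inner_diff_right)
    have zV: "F p + t *\<^sub>R k \<in> V" if "t \<in> {0..1}" for t
    proof -
      have "F p \<in> ball (F p) e" "F q \<in> ball (F p) e"
        using q e by (auto simp: W'_def)
      then have "(1 - t) *\<^sub>R F p + t *\<^sub>R F q \<in> ball (F p) e"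
        using that by (intro convexD_alt[OF convex_ball]) auto
      moreover have "(1 - t) *\<^sub>R F p + t *\<^sub>R F q = F p + t *\<^sub>R k"
        by (simp add: k_def scaleR_left_diff_distrib scaleR_right_diff_distrib)
      ultimately show ?thesis
        using e(2) by (metis subsetD)
    qed
    have "((\<lambda>t. f (g (F p + t *\<^sub>R k))) has_derivative (\<lambda>t. 0)) (at t within {0..1})"
      if t: "t \<in> {0..1}" for t
    proof -
      define z where "z = F p + t *\<^sub>R k"
      have z: "z \<in> V" using zV t z_def by blast
      have nz: "n \<bullet> z = 0"
        by (simp add: z_def inner_add_right nk np)
      have gz: "g z \<in> W \<inter> T"
        using Fg[OF z] \<phi>g[OF z] nz UV(2) T(1) by auto
      have "((\<lambda>z. \<phi> (g z)) has_derivative (\<lambda>k. grad \<phi> (g z) \<bullet> g' z k)) (at z)"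
        using has_derivative_compose[OF g[OF z]] smooth_on_has_derivative[OF W(1,2)] gz by blast
      then have "((\<lambda>z. n \<bullet> z) has_derivative (\<lambda>k. grad \<phi> (g z) \<bullet> g' z k)) (at z)"
        by (rule has_derivative_transform_within_open[OF _ UV(4) z]) (rule \<phi>g)
      moreover have "((\<lambda>z. n \<bullet> z) has_derivative (\<lambda>k. n \<bullet> k)) (at z)"
        by (auto intro!: derivative_eq_intros)
      ultimately have "(\<lambda>k. grad \<phi> (g z) \<bullet> g' z k) = (\<lambda>k. n \<bullet> k)"
        by (rule has_derivative_unique)
      then have tang: "grad \<phi> (g z) \<bullet> g' z (s *\<^sub>R k) = 0" for s
        using nk by (metis inner_scaleR_right mult_zero_right)
      have "((\<lambda>t. F p + t *\<^sub>R k) has_derivative (\<lambda>s. s *\<^sub>R k)) (at t)"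
        by (auto intro!: derivative_eq_intros)
      then have "((\<lambda>t. g (F p + t *\<^sub>R k)) has_derivative (\<lambda>s. g' z (s *\<^sub>R k))) (at t)"
        using has_derivative_compose g[OF z] z_def by blast
      then have "((\<lambda>t. f (g (F p + t *\<^sub>R k))) has_derivative (\<lambda>s. f' (g z) (g' z (s *\<^sub>R k)))) (at t)"
        using has_derivative_compose f[OF gz] z_def by blast
      then show ?thesis
        using 0[OF gz tang] by (simp add: has_derivative_at_withinI)
    qed
    from has_derivative_zero_unique[OF _ this, of 1 0]
    have "f (g (F p + k)) = f (g (F p))" by simp
    then show ?thesis
      using gF UV(3) q by (simp add: k_def W'_def)
  qed
  ultimately show ?thesis using that by blast
qed

text \<open>
  Both hypersurfaces are transversal to the normal \<open>n\<close> of the smaller one at \<open>p\<close>. A point \<open>y\<close> of \<open>S\<close> near \<open>p\<close>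
  has a companion \<open>z\<close> in \<open>T\<close> on the line through \<open>y\<close> in direction \<open>n\<close>. As \<open>z\<close> lies in \<open>S\<close> too, and \<open>\<psi>\<close> is
  strictly monotone along this line near \<open>p\<close>, the two points agree.
\<close>

lemma level_set_subset_imp_open:
  fixes \<phi> \<psi> :: "real ^ 'n::finite \<Rightarrow> real"
  assumes W: "open W" "smooth_on W \<phi>" "p \<in> W" "grad \<phi> p \<noteq> 0"
    and T: "W \<inter> T = {q \<in> W. \<phi> q = 0}" "p \<in> T"
    and Z: "open Z" "smooth_on Z \<psi>" "p \<in> Z" "grad \<psi> p \<noteq> 0"
    and S: "Z \<inter> S = {q \<in> Z. \<psi> q = 0}" and sub: "T \<subseteq> S"
  obtains W' where "open W'" "p \<in> W'" "W' \<inter> S \<subseteq> T"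
proof -
  define n where "n = grad \<phi> p /\<^sub>R norm (grad \<phi> p)"
  define F where "F = (\<lambda>y. y + (\<phi> y - n \<bullet> y) *\<^sub>R n)"
  obtain U V g g' where UV: "open U" "U \<subseteq> W" "p \<in> U" "open V" "F p \<in> V"
    and gF: "\<And>y. y \<in> U \<Longrightarrow> F y \<in> V \<and> g (F y) = y"
    and Fg: "\<And>z. z \<in> V \<Longrightarrow> g z \<in> U \<and> F (g z) = z"
    and g: "\<And>z. z \<in> V \<Longrightarrow> (g has_derivative g' z) (at z)"
    and \<phi>g: "\<And>z. z \<in> V \<Longrightarrow> \<phi> (g z) = n \<bullet> z"
    by (rule level_set_chart[OF W n_def F_def]) blast
  have n1: "n \<bullet> n = 1"
    using W(4) by (simp add: n_def dot_square_norm power2_eq_square)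
  have \<phi>p: "\<phi> p = 0"
    using T W by force
  have "tangent_space T p \<subseteq> tangent_space S p"
    using sub by (fastforce simp: tangent_space_def)
  moreover have "p \<in> S" using T sub by blast
  ultimately have ker: "grad \<phi> p \<bullet> v = 0 \<Longrightarrow> grad \<psi> p \<bullet> v = 0" for v
    using level_set_tangent_space[OF W T] level_set_tangent_space[OF Z S] by blast
  have "grad \<psi> p \<bullet> n \<noteq> 0"
  proof
    assume *: "grad \<psi> p \<bullet> n = 0"
    have "grad \<phi> p \<bullet> (v - (n \<bullet> v) *\<^sub>R n) = 0" for v
      using W(4) by (simp add: n_def inner_diff_right dot_square_norm power2_eq_square field_simps)
    from ker[OF this] have "grad \<psi> p \<bullet> v = 0" for v
      using * by (simp add: inner_diff_right)
    then show False using Z(4) inner_eq_zero_iff by blast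
  qed
  then obtain O1 where O1: "open O1" "p \<in> O1" "\<And>q. q \<in> O1 \<Longrightarrow> q \<in> Z \<and> grad \<psi> q \<bullet> n \<noteq> 0"
  proof -
    have "continuous_on Z (\<lambda>q. grad \<psi> q \<bullet> n)"
      by (intro continuous_intros smooth_on_continuous_grad Z)
    then have "open (Z \<inter> (\<lambda>q. grad \<psi> q \<bullet> n) -` (- {0}))"
      using continuous_open_preimage[OF _ Z(1)] by blast
    then show ?thesis
      using that[of "Z \<inter> (\<lambda>q. grad \<psi> q \<bullet> n) -` (- {0})"] Z \<open>grad \<psi> p \<bullet> n \<noteq> 0\<close> by auto
  qed
  obtain r where r: "r > 0" "ball p r \<subseteq> O1"
    using O1(1,2) openE by blast
  define P where "P y = y - (n \<bullet> y) *\<^sub>R n" for y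
  have Pp: "P p = F p"
    by (simp add: P_def F_def \<phi>p)
  have contP: "isCont P p"
    unfolding P_def by (intro continuous_intros)
  have cg: "isCont g (P p)"
    using g[OF UV(5)] Pp has_derivative_continuous by metis
  have cont: "isCont (\<lambda>y. g (P y)) p"
    using isCont_o2[OF contP cg] .
  have near: "\<forall>\<^sub>F y in nhds p. f y \<in> A"
    if "isCont f p" "open A" "f p \<in> A" for f :: "real ^ 'n \<Rightarrow> real ^ 'n" and A
    using that by (metis isCont_def tendsto_at_iff_tendsto_nhds topological_tendstoD)
  have "\<forall>\<^sub>F y in nhds p. g (P y) \<in> ball p r"
    using gF[OF UV(3)] Pp r(1) by (intro near cont) auto
  moreover have "\<forall>\<^sub>F y in nhds p. P y \<in> V"
    using UV(4,5) Pp by (intro near contP) auto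
  moreover have "\<forall>\<^sub>F y in nhds p. y \<in> ball p r"
    using r(1) by (intro eventually_nhds_in_open) auto
  ultimately have "\<forall>\<^sub>F y in nhds p. g (P y) \<in> ball p r \<and> P y \<in> V \<and> y \<in> ball p r"
    by eventually_elim simp
  then obtain W' where W': "open W'" "p \<in> W'"
      "\<And>y. y \<in> W' \<Longrightarrow> g (P y) \<in> ball p r \<and> P y \<in> V \<and> y \<in> ball p r"
    unfolding eventually_nhds by auto
  have "y \<in> T" if y: "y \<in> W'" "y \<in> S" for y
  proof -
    define z where "z = g (P y)"
    have z0: "\<phi> z = 0"
      using \<phi>g[of "P y"] W'(3)[OF y(1)] by (simp add: z_def P_def inner_diff_right n1)
    then have zT: "z \<in> T"
      using Fg[of "P y"] W'(3)[OF y(1)] UV(2) T(1) by (auto simp: z_def)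
    have "z - (n \<bullet> z) *\<^sub>R n = y - (n \<bullet> y) *\<^sub>R n"
      using Fg[of "P y"] W'(3)[OF y(1)] z0 by (simp add: z_def F_def P_def)
    then have "z = y + (n \<bullet> z - n \<bullet> y) *\<^sub>R n"
      by (simp add: algebra_simps)
    then obtain s where s: "z = y + s *\<^sub>R n" ..
    have "z = y"
    proof (rule ccontr)
      assume "z \<noteq> y"
      then have "s \<noteq> 0" using s by auto
      have seg: "y + t *\<^sub>R (s *\<^sub>R n) \<in> O1" if "0 \<le> t" "t \<le> 1" for t
      proof -
        have "(1 - t) *\<^sub>R y + t *\<^sub>R z \<in> ball p r"
          using W'(3)[OF y(1)] that by (intro convexD_alt[OF convex_ball]) (auto simp: z_def)
        moreover have "(1 - t) *\<^sub>R y + t *\<^sub>R z = y + t *\<^sub>R (s *\<^sub>R n)"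
          by (simp add: s scaleR_left_diff_distrib scaleR_right_distrib)
        ultimately show ?thesis
          using r(2) by (metis subsetD)
      qed
      have "((\<lambda>t. \<psi> (y + t *\<^sub>R (s *\<^sub>R n))) has_real_derivative (grad \<psi> (y + t *\<^sub>R (s *\<^sub>R n)) \<bullet> (s *\<^sub>R n))) (at t)"
        if "0 \<le> t" "t \<le> 1" for t
      proof -
        have "((\<lambda>t. y + t *\<^sub>R (s *\<^sub>R n)) has_derivative (\<lambda>t. t *\<^sub>R (s *\<^sub>R n))) (at t)"
          by (auto intro!: derivative_eq_intros)
        from has_derivative_compose[OF this smooth_on_has_derivative[OF Z(1,2)]]
        show ?thesis
          by (rule has_derivative_imp_has_field_derivative) (use O1(3)[OF seg[OF that]] in auto)
      qed
      then obtain t where t: "0 < t" "t < 1"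
        and "\<psi> (y + 1 *\<^sub>R (s *\<^sub>R n)) - \<psi> (y + 0 *\<^sub>R (s *\<^sub>R n)) = (1 - 0) * (grad \<psi> (y + t *\<^sub>R (s *\<^sub>R n)) \<bullet> (s *\<^sub>R n))"
        using MVT2[of 0 1 "\<lambda>t. \<psi> (y + t *\<^sub>R (s *\<^sub>R n))" "\<lambda>t. grad \<psi> (y + t *\<^sub>R (s *\<^sub>R n)) \<bullet> (s *\<^sub>R n)"]
        by auto
      moreover have "\<psi> z = 0" "\<psi> y = 0"
        using S zT sub y W'(3)[OF y(1)] r(2) O1(3) z_def by blast+
      ultimately have "s * (grad \<psi> (y + t *\<^sub>R (s *\<^sub>R n)) \<bullet> n) = 0"
        using s by simp
      then show False
        using O1(3)[OF seg[of t]] t \<open>s \<noteq> 0\<close> by simp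
    qed
    then show ?thesis using zT by simp
  qed
  then show ?thesis
    using that W'(1,2) by blast
qed

section \<open>Curvature of the half-space model and static potentials\<close>

lemma hyp_space_iff: "y \<in> hyp_space d \<longleftrightarrow> y $ d > 0"
  by (simp add: hyp_space_def)

lemma open_hyp_space: "open (hyp_space d)"
proof -
  have "hyp_space d = (\<lambda>y. y $ d) -` {0<..}"
    by (auto simp: hyp_space_def)
  then show ?thesis
    by (simp add: open_vimage continuous_on_component)
qed

lemma convex_hyp_space: "convex (hyp_space d)"
proof -
  have "hyp_space d = {y. axis d 1 \<bullet> y > 0}"
    by (auto simp: hyp_space_def inner_axis')
  then show ?thesis
    by (simp add: convex_halfspace_gt)
qed

text \<open>
  The Kronecker delta. As a constant it lets index sums be evaluated by rewriting with \<open>sum_kd\<close>, without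
  splitting conditionals.
\<close>

definition kd :: "'n \<Rightarrow> 'n \<Rightarrow> real" where
  "kd i j = (if i = j then 1 else 0)"

lemma kd_refl [simp]: "kd i i = 1"
  by (simp add: kd_def)

lemma axis_kd: "axis i 1 $ j = kd i j"
  by (simp add: axis_def kd_def)

lemma kd_sym: "kd i j = kd j i"
  by (simp add: kd_def)

lemma sum_kd:
  fixes f :: "'n::finite \<Rightarrow> real"
  shows "(\<Sum>i\<in>UNIV. kd a i * f i) = f a" "(\<Sum>i\<in>UNIV. f i * kd a i) = f a"
    "(\<Sum>i\<in>UNIV. kd i a * f i) = f a" "(\<Sum>i\<in>UNIV. f i * kd i a) = f a"
    "(\<Sum>i\<in>UNIV. kd a i) = 1" "(\<Sum>i\<in>UNIV. kd i a) = 1"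
  by (simp_all add: kd_def if_distrib[of "\<lambda>x. x * _"] if_distrib[of "\<lambda>x. _ * x"] cong: if_cong)

lemma hyp_metric_nth: "hyp_metric d p $ i $ j = kd i j * (1 / (p $ d)\<^sup>2)"
  by (simp add: hyp_metric_def mat_def kd_def)

lemma metric_inner_hyp: "metric_inner (hyp_metric d) p X Y = (X \<bullet> Y) / (p $ d)\<^sup>2"
proof -
  have "metric_inner (hyp_metric d) p X Y
      = (\<Sum>i\<in>UNIV. \<Sum>j\<in>UNIV. kd i j * (1 / (p $ d)\<^sup>2 * X $ i * Y $ j))"
    by (simp add: metric_inner_def hyp_metric_nth mult.assoc)
  also have "\<dots> = (\<Sum>i\<in>UNIV. 1 / (p $ d)\<^sup>2 * X $ i * Y $ i)"
    by (simp only: sum_kd)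
  finally show ?thesis
    by (simp add: inner_vec_def sum_divide_distrib)
qed

lemma matrix_inv_hyp_metric:
  assumes "p \<in> hyp_space d"
  shows "matrix_inv (hyp_metric d p) $ i $ j = (p $ d)\<^sup>2 * kd i j"
proof -
  let ?A = "hyp_metric d p" and ?B = "(p $ d)\<^sup>2 *\<^sub>R mat 1 :: real ^ 'a ^ 'a"
  have AB: "?A ** ?B = mat 1" "?B ** ?A = mat 1"
    using assms by (simp_all add: hyp_metric_def hyp_space_iff matrix_scalar_ac flip: scalar_matrix_assoc)
  then have "?A ** matrix_inv ?A = mat 1 \<and> matrix_inv ?A ** ?A = mat 1"
    unfolding matrix_inv_def by (intro someI[where P = "\<lambda>X. ?A ** X = mat 1 \<and> X ** ?A = mat 1"] conjI)
  then have "matrix_inv ?A = ?B"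
    using AB(2) matrix_mul_assoc[of ?B ?A "matrix_inv ?A"] by (simp only: matrix_mul_lid matrix_mul_rid)
  then show ?thesis
    by (simp add: mat_def kd_def)
qed

lemma has_derivative_coord [derivative_intros]:
  "((\<lambda>q::real ^ 'n::finite. q $ i) has_derivative (\<lambda>h. h $ i)) (at p within S)"
  by (rule bounded_linear.has_derivative[OF bounded_linear_vec_nth has_derivative_ident])

lemma partial_hyp_metric:
  assumes "p \<in> hyp_space d"
  shows "partial i (\<lambda>q. hyp_metric d q $ j $ l) p = - 2 * kd j l * kd i d / (p $ d) ^ 3"
proof -
  have "((\<lambda>q. kd j l * (1 / (q $ d)\<^sup>2)) has_derivative (\<lambda>h. kd j l * (- 2 * h $ d / (p $ d) ^ 3))) (at p)"
    using assms by (auto intro!: derivative_eq_intros simp: hyp_space_iff field_simps eval_nat_numeral)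
  from partial_eq[OF this] show ?thesis
    by (simp add: hyp_metric_nth axis_kd kd_sym)
qed

text \<open>
  The Christoffel symbols of the half-space metric without their common factor \<open>- 1 / y\<^sub>d\<close>.
\<close>

definition hyp_christoffel :: "'n \<Rightarrow> 'n \<Rightarrow> 'n \<Rightarrow> 'n \<Rightarrow> real" where
  "hyp_christoffel d k i j = kd k j * kd i d + kd k i * kd j d - kd i j * kd k d"

lemma christoffel_hyp:
  assumes "p \<in> hyp_space d"
  shows "christoffel (hyp_metric d) k i j p = - hyp_christoffel d k i j / p $ d"
proof -
  have "christoffel (hyp_metric d) k i j p = (\<Sum>l\<in>UNIV. kd k l * ((p $ d)\<^sup>2 *
      (- kd j l * kd i d / (p $ d) ^ 3 - kd i l * kd j d / (p $ d) ^ 3 + kd i j * kd l d / (p $ d) ^ 3)))"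
    unfolding christoffel_def matrix_inv_hyp_metric[OF assms] partial_hyp_metric[OF assms] sum_distrib_left
    by (rule sum.cong) (simp_all add: algebra_simps)
  also have "\<dots> = (p $ d)\<^sup>2 *
      (- kd j k * kd i d / (p $ d) ^ 3 - kd i k * kd j d / (p $ d) ^ 3 + kd i j * kd k d / (p $ d) ^ 3)"
    by (simp only: sum_kd)
  also have "\<dots> = - hyp_christoffel d k i j / p $ d"
    using assms by (simp add: hyp_christoffel_def hyp_space_iff kd_sym[of _ k] field_simps eval_nat_numeral)
  finally show ?thesis .
qed

lemma partial_christoffel_hyp:
  assumes "p \<in> hyp_space d"
  shows "partial m (christoffel (hyp_metric d) k i j) p = kd m d * hyp_christoffel d k i j / (p $ d)\<^sup>2"
proof -
  have "((\<lambda>q. - hyp_christoffel d k i j / q $ d) has_derivative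
      (\<lambda>h. hyp_christoffel d k i j * h $ d / (p $ d)\<^sup>2)) (at p)"
    using assms
    by - (rule derivative_eq_intros refl | simp add: hyp_space_iff field_simps power2_eq_square)+
  moreover have "partial m (christoffel (hyp_metric d) k i j) p
      = partial m (\<lambda>q. - hyp_christoffel d k i j / q $ d) p"
    by (rule partial_cong[OF open_hyp_space assms]) (rule christoffel_hyp)
  ultimately show ?thesis
    by (simp add: partial_eq axis_kd kd_sym)
qed

text \<open>
  The half-space model has constant curvature \<open>-1\<close>, so that \<open>Ric = - (n - 1) g\<close>.
\<close>

lemma ricci_hyp:
  fixes d :: "'n::finite"
  assumes "p \<in> hyp_space d"
  shows "ricci (hyp_metric d) p $ j $ k = - (real CARD('n) - 1) * kd j k / (p $ d)\<^sup>2"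
proof -
  let ?G = "hyp_christoffel d"
  have Gii: "?G i i m = kd m d" for i m
    by (simp add: hyp_christoffel_def)
  have s1: "(\<Sum>m\<in>UNIV. ?G i i m * ?G m j k) = ?G d j k" for i
    by (simp only: Gii sum_kd)
  have s2: "(\<Sum>m\<in>UNIV. ?G i j m * ?G m i k) = kd j d * kd k d + kd i j * ?G d i k - kd i d * ?G j i k" for i
  proof -
    have "(\<Sum>m\<in>UNIV. ?G i j m * ?G m i k)
        = (\<Sum>m\<in>UNIV. kd i m * (kd j d * ?G m i k)) + (\<Sum>m\<in>UNIV. kd m d * (kd i j * ?G m i k))
        - (\<Sum>m\<in>UNIV. kd j m * (kd i d * ?G m i k))"
      by (simp add: hyp_christoffel_def[of d i j] algebra_simps flip: sum.distrib sum_subtractf)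
    then show ?thesis
      by (simp only: sum_kd Gii)
  qed
  have "riemann (hyp_metric d) i k i j p = (kd i d * ?G i j k - kd j d * kd k d + ?G d j k
        - kd j d * kd k d - kd i j * ?G d i k + kd i d * ?G j i k) / (p $ d)\<^sup>2" for i
  proof -
    have "riemann (hyp_metric d) i k i j p = (kd i d * ?G i j k - kd j d * ?G i i k
        + (\<Sum>m\<in>UNIV. ?G i i m * ?G m j k - ?G i j m * ?G m i k)) / (p $ d)\<^sup>2"
      unfolding riemann_def partial_christoffel_hyp[OF assms] christoffel_hyp[OF assms]
      by (simp add: sum_divide_distrib diff_divide_distrib add_divide_distrib power2_eq_square)
    then show ?thesis
      by (simp only: sum_subtractf s1 s2) (simp add: Gii)
  qed
  then have "ricci (hyp_metric d) p $ j $ k = (\<Sum>i\<in>UNIV. kd i d * ?G i j k - kd j d * kd k d + ?G d j k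
        - kd j d * kd k d - kd i j * ?G d i k + kd i d * ?G j i k) / (p $ d)\<^sup>2"
    by (simp add: ricci_def sum_divide_distrib)
  also have "(\<Sum>i\<in>UNIV. kd i d * ?G i j k - kd j d * kd k d + ?G d j k
        - kd j d * kd k d - kd i j * ?G d i k + kd i d * ?G j i k)
      = real CARD('n) * (?G d j k - 2 * (kd j d * kd k d)) + ?G j d k"
    by (simp add: sum.distrib sum_subtractf sum_kd algebra_simps)
  also have "\<dots> = - (real CARD('n) - 1) * kd j k"
    by (simp add: hyp_christoffel_def kd_sym[of d] algebra_simps)
  finally show ?thesis .
qed

lemma hessian_hyp:
  assumes "p \<in> hyp_space d"
  shows "hessian (hyp_metric d) u p $ i $ j = partial i (partial j u) p
    + (kd i d * partial j u p + kd j d * partial i u p - kd i j * partial d u p) / p $ d"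
proof -
  have "(\<Sum>k\<in>UNIV. christoffel (hyp_metric d) k i j p * partial k u p)
      = (\<Sum>k\<in>UNIV. kd k j * (- kd i d * partial k u p / p $ d))
      + (\<Sum>k\<in>UNIV. kd k i * (- kd j d * partial k u p / p $ d))
      - (\<Sum>k\<in>UNIV. kd k d * (- kd i j * partial k u p / p $ d))"
    unfolding christoffel_hyp[OF assms] hyp_christoffel_def sum.distrib[symmetric] sum_subtractf[symmetric]
    by (intro sum.cong refl) (simp add: algebra_simps add_divide_distrib diff_divide_distrib)
  also have "\<dots> = - (kd i d * partial j u p + kd j d * partial i u p - kd i j * partial d u p) / p $ d"
    by (simp only: sum_kd) (simp add: add_divide_distrib diff_divide_distrib)
  finally have "(\<Sum>k\<in>UNIV. christoffel (hyp_metric d) k i j p * partial k u p)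
      = - ((kd i d * partial j u p + kd j d * partial i u p - kd i j * partial d u p) / p $ d)"
    by (simp only: minus_divide_left)
  then show ?thesis
    unfolding hessian_def by simp
qed

text \<open>
  The entries of \<open>L\<^sup>* u\<close> off the diagonal are those of the Hessian; the diagonal part of \<open>L\<^sup>* u = 0\<close> says that
  the diagonal entries of the Hessian agree, and the trace then fixes their value. Altogether the equation becomes
  \<open>Hess u = u g\<close>; the trace step divides by \<open>n - 1\<close>.
\<close>

lemma Lstar_hyp_eq_0_iff:
  fixes d :: "'n::finite"
  assumes n: "CARD('n) \<ge> 2" and p: "p \<in> hyp_space d"
  shows "Lstar (hyp_metric d) u p = 0 \<longleftrightarrow>
    (\<forall>i j. hessian (hyp_metric d) u p $ i $ j = kd i j * (u p / (p $ d)\<^sup>2))"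
proof -
  let ?n = "real CARD('n)" and ?h = "hessian (hyp_metric d) u p"
  have pos: "p $ d > 0" using p by (simp add: hyp_space_iff)
  have lap: "laplacian (hyp_metric d) u p = (p $ d)\<^sup>2 * (\<Sum>i\<in>UNIV. ?h $ i $ i)"
  proof -
    have "laplacian (hyp_metric d) u p = (\<Sum>i\<in>UNIV. \<Sum>j\<in>UNIV. kd i j * ((p $ d)\<^sup>2 * ?h $ i $ j))"
      by (simp add: laplacian_def matrix_inv_hyp_metric[OF p] mult_ac)
    then show ?thesis
      by (simp only: sum_kd) (simp add: sum_distrib_left)
  qed
  have L: "Lstar (hyp_metric d) u p $ i $ j =
      - (kd i j * (\<Sum>k\<in>UNIV. ?h $ k $ k)) + ?h $ i $ j + u p * ((?n - 1) * kd i j / (p $ d)\<^sup>2)" for i j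
    using pos by (simp add: Lstar_def lap ricci_hyp[OF p] hyp_metric_nth field_simps)
  show ?thesis
  proof
    assume "Lstar (hyp_metric d) u p = 0"
    define s where "s = (\<Sum>k\<in>UNIV. ?h $ k $ k)"
    have h: "?h $ i $ j = kd i j * (s - (?n - 1) * (u p / (p $ d)\<^sup>2))" for i j
      using L[of i j] \<open>Lstar (hyp_metric d) u p = 0\<close> unfolding s_def[symmetric]
      by (simp add: algebra_simps)
    have h_diag: "?h $ k $ k = s - (?n - 1) * (u p / (p $ d)\<^sup>2)" for k
      using h[of k k] by (simp add: s_def)
    have "s = (\<Sum>k\<in>(UNIV::'n set). s - (?n - 1) * (u p / (p $ d)\<^sup>2))"
      by (subst s_def) (simp only: h_diag)
    also have "\<dots> = ?n * (s - (?n - 1) * (u p / (p $ d)\<^sup>2))"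
      by simp
    finally have "(?n - 1) * (s - ?n * (u p / (p $ d)\<^sup>2)) = 0"
      by (simp add: algebra_simps)
    moreover have "?n - 1 \<noteq> 0"
      using n by simp
    ultimately have "s = ?n * (u p / (p $ d)\<^sup>2)" by simp
    moreover have "?n * x - (?n - 1) * x = x" for x
      by (simp add: algebra_simps)
    ultimately have "s - (?n - 1) * (u p / (p $ d)\<^sup>2) = u p / (p $ d)\<^sup>2"
      by metis
    then show "\<forall>i j. ?h $ i $ j = kd i j * (u p / (p $ d)\<^sup>2)"
      using h by simp
  next
    assume h: "\<forall>i j. ?h $ i $ j = kd i j * (u p / (p $ d)\<^sup>2)"
    then have s: "(\<Sum>k\<in>UNIV. ?h $ k $ k) = ?n * (u p / (p $ d)\<^sup>2)"
      by simp
    have "Lstar (hyp_metric d) u p $ i $ j = 0" for i j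
      unfolding L s h[rule_format] using pos by (simp add: field_simps)
    then show "Lstar (hyp_metric d) u p = 0"
      by (simp add: vec_eq_iff)
  qed
qed

text \<open>
  The substitution \<open>V = y\<^sub>d u\<close> absorbs the first-order terms of the hyperbolic Hessian: what remains is
  that the Euclidean Hessian of \<open>V\<close> is \<open>V\<^sub>d / y\<^sub>d\<close> times the identity.
\<close>

lemma Lstar_hyp_eq_0_iff_potential:
  fixes d :: "'n::finite"
  assumes n: "CARD('n) \<ge> 2" and U: "open U" "U \<subseteq> hyp_space d" "p \<in> U" and u: "smooth_on U u"
    and V: "\<And>q. q \<in> U \<Longrightarrow> V q = q $ d * u q"
  shows "Lstar (hyp_metric d) u p = 0 \<longleftrightarrow>
    (\<forall>i j. partial i (partial j V) p = kd i j * (partial d V p / p $ d))"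
proof -
  have p: "p \<in> hyp_space d" using U by blast
  have pos: "p $ d > 0" using p by (simp add: hyp_space_iff)
  have pV: "partial j V q = q $ d * partial j u q + kd j d * u q" if "q \<in> U" for j q
  proof -
    have "((\<lambda>q. q $ d * u q) has_derivative (\<lambda>h. q $ d * (grad u q \<bullet> h) + h $ d * u q)) (at q)"
      by (rule derivative_eq_intros smooth_on_has_derivative[OF U(1) u that] refl)+
    moreover have "partial j V q = partial j (\<lambda>q. q $ d * u q) q"
      by (rule partial_cong[OF U(1) that]) (rule V)
    ultimately show ?thesis
      by (simp add: partial_eq inner_axis axis_kd kd_sym)
  qed
  have ppV: "partial i (partial j V) p
      = p $ d * partial i (partial j u) p + kd i d * partial j u p + kd j d * partial i u p" for i j
  proof -
    have "((\<lambda>q. q $ d * partial j u q + kd j d * u q) has_derivative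
       (\<lambda>h. (p $ d * (grad (partial j u) p \<bullet> h) + h $ d * partial j u p) + kd j d * (grad u p \<bullet> h))) (at p)"
      by (rule derivative_eq_intros refl smooth_on_has_derivative[OF U(1) smooth_on_partial[OF u] U(3)]
          smooth_on_has_derivative[OF U(1) u U(3)])+ simp
    moreover have "partial i (partial j V) p = partial i (\<lambda>q. q $ d * partial j u q + kd j d * u q) p"
      by (rule partial_cong[OF U(1,3)]) (rule pV)
    ultimately show ?thesis
      by (simp add: partial_eq inner_axis axis_kd kd_sym)
  qed
  have "hessian (hyp_metric d) u p $ i $ j = kd i j * (u p / (p $ d)\<^sup>2) \<longleftrightarrow>
      partial i (partial j V) p = kd i j * (partial d V p / p $ d)" for i j
  proof -
    have *: "(a + (b - k * e) / t = k * (v / t\<^sup>2)) \<longleftrightarrow> (t * a + b = k * ((t * e + v) / t))"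
      if "t > 0" for a b k e v t :: real
    proof -
      have "t * (a + (b - k * e) / t) = (t * a + b) - k * e"
          "t * (k * (v / t\<^sup>2)) = k * ((t * e + v) / t) - k * e"
        using that by (simp_all add: field_simps power2_eq_square)
      then show ?thesis
        using that by (smt (verit) mult_left_cancel)
    qed
    show ?thesis
      using *[OF pos] by (simp add: hessian_hyp[OF p] ppV pV[OF U(3)] add.assoc)
  qed
  then show ?thesis
    by (simp add: Lstar_hyp_eq_0_iff[OF n p])
qed

text \<open>
  The factor \<open>V\<^sub>d / y\<^sub>d\<close> is constant, because the equation itself gives \<open>V\<^sub>d\<close> the derivative
  \<open>(V\<^sub>d / y\<^sub>d) dy\<^sub>d\<close>. With \<open>2 A\<close> for this constant, \<open>grad V - 2 A y\<close> and then
  \<open>V - A |y|\<^sup>2 - b \<bullet> y\<close> are constant as well.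
\<close>

lemma potential_quadratic:
  fixes d :: "'n::finite"
  assumes \<Omega>: "open \<Omega>" "connected \<Omega>" "\<Omega> \<subseteq> hyp_space d" and V: "smooth_on \<Omega> V"
    and hess: "\<And>p i j. p \<in> \<Omega> \<Longrightarrow> partial i (partial j V) p = kd i j * (partial d V p / p $ d)"
  obtains A b c where "b $ d = 0" "\<And>q. q \<in> \<Omega> \<Longrightarrow> V q = A * (q \<bullet> q) + b \<bullet> q + c"
proof (cases "\<Omega> = {}")
  case True
  then show ?thesis using that[of 0] by simp
next
  case False
  then obtain p0 where p0: "p0 \<in> \<Omega>" by blast
  have pos: "q $ d > 0" if "q \<in> \<Omega>" for q
    using that \<Omega>(3) by (auto simp: hyp_space_iff)
  have dp: "(partial j V has_derivative (\<lambda>h. (partial d V q / q $ d) * h $ j)) (at q)" if "q \<in> \<Omega>" for q j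
  proof -
    have "grad (partial j V) q = (partial d V q / q $ d) *\<^sub>R axis j 1"
      by (simp add: vec_eq_iff hess[OF that] axis_kd kd_sym)
    then show ?thesis
      using smooth_on_has_derivative[OF \<Omega>(1) smooth_on_partial[OF V] that, of j]
      by (simp add: inner_axis')
  qed
  define A where "A = partial d V p0 / p0 $ d / 2"
  have A: "partial d V q / q $ d = 2 * A" if "q \<in> \<Omega>" for q
  proof -
    have "((\<lambda>q. partial d V q / q $ d) has_derivative (\<lambda>h. 0)) (at q)" if "q \<in> \<Omega>" for q
      using pos[OF that]
      by (auto intro!: derivative_eq_intros dp[OF that] simp: field_simps)
    from has_derivative_zero_unique_connected[OF \<Omega>(1,2) this that p0]
    show ?thesis by (simp add: A_def)
  qed
  define b where "b = (\<chi> j. partial j V p0 - 2 * A * p0 $ j)"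
  have b: "partial j V q = 2 * A * q $ j + b $ j" if "q \<in> \<Omega>" for q j
  proof -
    have "((\<lambda>q. partial j V q - 2 * A * q $ j) has_derivative (\<lambda>h. 0)) (at q)" if "q \<in> \<Omega>" for q
      using dp[OF that, of j] unfolding A[OF that] by (auto intro!: derivative_eq_intros)
    from has_derivative_zero_unique_connected[OF \<Omega>(1,2) this that p0]
    show ?thesis by (simp add: b_def)
  qed
  define c where "c = V p0 - A * (p0 \<bullet> p0) - b \<bullet> p0"
  have gV: "grad V q = (2 * A) *\<^sub>R q + b" if "q \<in> \<Omega>" for q
    using b[OF that] by (simp add: vec_eq_iff)
  have "V q = A * (q \<bullet> q) + b \<bullet> q + c" if "q \<in> \<Omega>" for q
  proof -
    have "((\<lambda>q. V q - A * (q \<bullet> q) - b \<bullet> q) has_derivative (\<lambda>h. 0)) (at q)" if "q \<in> \<Omega>" for q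
      using smooth_on_has_derivative[OF \<Omega>(1) V that] unfolding gV[OF that]
      by (auto intro!: derivative_eq_intros simp: inner_add_left inner_commute algebra_simps)
    from has_derivative_zero_unique_connected[OF \<Omega>(1,2) this that p0]
    show ?thesis by (simp add: c_def)
  qed
  moreover have "b $ d = 0"
    using A[OF p0] pos[OF p0] by (simp add: b_def field_simps)
  ultimately show ?thesis using that by blast
qed

section \<open>The boundary condition in Euclidean terms\<close>

text \<open>
  The metric is conformal to the Euclidean one with factor \<open>1 / y\<^sub>d\<^sup>2\<close>: the hyperbolic normal is the Euclidean
  one rescaled by \<open>y\<^sub>d\<close>. Its sign is decided by the side on which \<open>\<phi>\<close> is negative.
\<close>

lemma outward_unit_normal_hyp_iff:
  fixes \<phi> :: "real ^ 'n::finite \<Rightarrow> real"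
  assumes W: "open W" "smooth_on W \<phi>" "p \<in> W" "grad \<phi> p \<noteq> 0" and p: "p \<in> hyp_space d"
    and \<Omega>: "W \<inter> \<Omega> = {q \<in> W. \<phi> q < 0}" and \<Sigma>: "W \<inter> \<Sigma> = {q \<in> W. \<phi> q = 0}" "p \<in> \<Sigma>"
  shows "outward_unit_normal (hyp_metric d) \<Omega> \<Sigma> p \<nu> \<longleftrightarrow>
    \<nu> = p $ d *\<^sub>R (grad \<phi> p /\<^sub>R norm (grad \<phi> p))" (is "?L \<longleftrightarrow> ?R")
proof -
  have pos: "p $ d > 0" using p by (simp add: hyp_space_iff)
  define r where "r = norm (grad \<phi> p)"
  define n where "n = grad \<phi> p /\<^sub>R r"
  have r0: "r > 0" using W(4) by (simp add: r_def)
  have n1: "n \<bullet> n = 1"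
    using r0 by (simp add: n_def dot_square_norm power2_eq_square r_def[symmetric])
  have gn: "grad \<phi> p = r *\<^sub>R n"
    using r0 by (simp add: n_def)
  have n0: "n \<bullet> v = 0 \<longleftrightarrow> grad \<phi> p \<bullet> v = 0" for v
    using r0 by (simp add: n_def)
  have \<phi>p: "\<phi> p = 0" using \<Sigma> W by blast
  have tan: "tangent_space \<Sigma> p = {v. n \<bullet> v = 0}"
    using level_set_tangent_space[OF W \<Sigma>] n0 by simp
  have der: "((\<lambda>t. \<phi> (p - t *\<^sub>R v)) has_real_derivative - (grad \<phi> p \<bullet> v)) (at 0)" for v
  proof -
    have 1: "((\<lambda>t. p - t *\<^sub>R v) has_derivative (\<lambda>t. - t *\<^sub>R v)) (at 0)"
      by (auto intro!: derivative_eq_intros)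
    have "(\<phi> has_derivative (\<lambda>h. grad \<phi> p \<bullet> h)) (at (p - 0 *\<^sub>R v))"
      using smooth_on_has_derivative[OF W(1-3)] by simp
    from has_derivative_compose[OF 1 this] show ?thesis
      by (rule has_derivative_imp_has_field_derivative) simp
  qed
  have inW: "\<forall>\<^sub>F t in at_right 0. p - t *\<^sub>R v \<in> W" for v
  proof -
    have "((\<lambda>t. p - t *\<^sub>R v) \<longlongrightarrow> p - 0 *\<^sub>R v) (at_right 0)"
      by (intro tendsto_intros)
    then show ?thesis
      using topological_tendstoD[OF _ W(1)] W(3) by fastforce
  qed
  have neg: "\<forall>\<^sub>F t in at_right 0. \<phi> (p - t *\<^sub>R v) < 0" if "grad \<phi> p \<bullet> v > 0" for v
    using DERIV_neg_dec_right[OF der[of v]] that \<phi>p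
    by (auto simp: eventually_at_right_field)
  have nonneg: "\<forall>\<^sub>F t in at_right 0. \<phi> (p - t *\<^sub>R v) > 0" if "grad \<phi> p \<bullet> v < 0" for v
    using DERIV_pos_inc_right[OF der[of v]] that \<phi>p
    by (auto simp: eventually_at_right_field)
  show ?thesis
    unfolding n_def[symmetric] r_def[symmetric]
  proof
    assume L: ?L
    have "n \<bullet> (\<nu> - (n \<bullet> \<nu>) *\<^sub>R n) = 0"
      by (simp add: inner_diff_right n1)
    then have "\<nu> \<bullet> (\<nu> - (n \<bullet> \<nu>) *\<^sub>R n) = 0"
      using L pos unfolding outward_unit_normal_def tan metric_inner_hyp by auto
    then have "(\<nu> - (n \<bullet> \<nu>) *\<^sub>R n) \<bullet> (\<nu> - (n \<bullet> \<nu>) *\<^sub>R n) = 0"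
      by (simp add: inner_diff_left inner_diff_right n1 inner_commute)
    then have \<nu>: "\<nu> = (n \<bullet> \<nu>) *\<^sub>R n" by simp
    have "\<nu> \<bullet> \<nu> = (p $ d)\<^sup>2"
      using L pos unfolding outward_unit_normal_def metric_inner_hyp by simp
    then have sq: "(n \<bullet> \<nu>)\<^sup>2 = (p $ d)\<^sup>2"
      using \<nu> n1 by (metis inner_scaleR_left inner_scaleR_right mult.right_neutral power2_eq_square)
    have "\<not> grad \<phi> p \<bullet> \<nu> < 0"
    proof
      assume "grad \<phi> p \<bullet> \<nu> < 0"
      have "\<forall>\<^sub>F t in at_right 0. p - t *\<^sub>R \<nu> \<in> \<Omega>"
        using L by (simp add: outward_unit_normal_def)
      then have "\<forall>\<^sub>F t in at_right (0::real). False"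
        using inW[of \<nu>] nonneg[OF \<open>grad \<phi> p \<bullet> \<nu> < 0\<close>] by eventually_elim (use \<Omega> in force)
      then show False by simp
    qed
    then have "n \<bullet> \<nu> \<ge> 0"
      using r0 by (simp add: gn zero_le_mult_iff not_less)
    then have "n \<bullet> \<nu> = p $ d"
      using sq pos by (simp add: power2_eq_iff)
    then show "\<nu> = p $ d *\<^sub>R n" using \<nu> by simp
  next
    assume R: "\<nu> = p $ d *\<^sub>R n"
    have "grad \<phi> p \<bullet> \<nu> > 0"
      using pos r0 n1 by (simp add: gn R)
    from neg[OF this] inW[of \<nu>] have "\<forall>\<^sub>F t in at_right 0. p - t *\<^sub>R \<nu> \<in> \<Omega>"
      by eventually_elim (use \<Omega> in blast)
    then show ?L
      using pos n1 by (simp add: outward_unit_normal_def metric_inner_hyp R tan power2_eq_square)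
  qed
qed

text \<open>
  The one-sided derivative only sees \<open>p\<close> and points of \<open>\<Omega>\<close>, so \<open>u\<close> may be replaced by any differentiable
  function that agrees with it there.
\<close>

lemma normal_deriv_eq_grad:
  fixes w :: "real ^ 'n::finite \<Rightarrow> real"
  assumes \<nu>: "outward_unit_normal g \<Omega> \<Sigma> p \<nu>" and w: "w differentiable (at p)"
    and eq: "\<And>q. q \<in> insert p \<Omega> \<Longrightarrow> u q = w q"
  shows "normal_deriv u \<nu> p = grad w p \<bullet> \<nu>"
proof -
  \<comment> \<open>The filter is rewritten so that the base point belongs to the set, where the values agree as well.\<close>
  have left: "at_left 0 = at (0::real) within {..0}"
    unfolding at_within_def by (intro arg_cong[where f = "\<lambda>A. inf (nhds 0) (principal A)"]) auto
  have "((\<lambda>t. p + t *\<^sub>R \<nu>) has_derivative (\<lambda>t. t *\<^sub>R \<nu>)) (at 0)"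
    by (auto intro!: derivative_eq_intros)
  moreover have "(w has_derivative (\<lambda>h. grad w p \<bullet> h)) (at (p + 0 *\<^sub>R \<nu>))"
    using has_derivative_grad[OF w] by simp
  ultimately have "((\<lambda>t. w (p + t *\<^sub>R \<nu>)) has_derivative (\<lambda>t. grad w p \<bullet> (t *\<^sub>R \<nu>))) (at 0)"
    by (rule has_derivative_compose)
  then have "((\<lambda>t. w (p + t *\<^sub>R \<nu>)) has_vector_derivative (grad w p \<bullet> \<nu>)) (at_left 0)"
    by (simp add: has_vector_derivative_def has_derivative_at_withinI)
  moreover have "\<forall>\<^sub>F t in at_left 0. w (p + t *\<^sub>R \<nu>) = u (p + t *\<^sub>R \<nu>)"
  proof -
    have "\<forall>\<^sub>F t in at_right 0. p + (- t) *\<^sub>R \<nu> \<in> \<Omega>"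
      using \<nu> by (simp add: outward_unit_normal_def)
    then have "\<forall>\<^sub>F t in at_left 0. p + t *\<^sub>R \<nu> \<in> \<Omega>"
      by (simp add: at_left_minus[of 0] eventually_filtermap)
    then show ?thesis
      by eventually_elim (simp add: eq)
  qed
  ultimately have "((\<lambda>t. u (p + t *\<^sub>R \<nu>)) has_vector_derivative (grad w p \<bullet> \<nu>)) (at_left 0)"
    unfolding has_vector_derivative_def left
    by (rule has_derivative_transform_eventually) (use eq[of p] in simp_all)
  then show ?thesis
    unfolding normal_deriv_def by (rule vector_derivative_within[OF trivial_limit_at_left_real])
qed

text \<open>
  The Euclidean directional derivative of the field \<open>Y\<close>, written with partial derivatives because those of a
  smooth field depend continuously on the point.
\<close>

definition dfield :: "(real ^ 'n \<Rightarrow> real ^ 'n) \<Rightarrow> real ^ 'n \<Rightarrow> real ^ 'n \<Rightarrow> real ^ 'n::finite" where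
  "dfield Y p X = (\<chi> k. grad (\<lambda>q. Y q $ k) p \<bullet> X)"

lemma smooth_field_has_derivative:
  assumes "open W" "smooth_field_on W Y" "p \<in> W"
  shows "(Y has_derivative dfield Y p) (at p)"
proof -
  have "((\<lambda>q. Y q $ k) has_derivative (\<lambda>h. dfield Y p h $ k)) (at p)" for k
    using smooth_on_has_derivative[OF assms(1) _ assms(3)] assms(2)
    by (simp add: smooth_field_on_def dfield_def)
  then show ?thesis
    by (subst has_derivative_componentwise_within) (auto simp: Basis_vec_def inner_axis)
qed

lemma cov_deriv_hyp:
  assumes p: "p \<in> hyp_space d"
  shows "cov_deriv (hyp_metric d) X Y p = dfield Y p X
    + (1 / p $ d) *\<^sub>R ((X \<bullet> Y p) *\<^sub>R axis d 1 - X $ d *\<^sub>R Y p - Y p $ d *\<^sub>R X)"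
proof -
  have "(\<Sum>i\<in>UNIV. \<Sum>j\<in>UNIV. christoffel (hyp_metric d) k i j p * X $ i * Y p $ j)
      = (1 / p $ d) * ((X \<bullet> Y p) * kd d k - X $ d * Y p $ k - Y p $ d * X $ k)" for k
  proof -
    have "(\<Sum>j\<in>UNIV. christoffel (hyp_metric d) k i j p * X $ i * Y p $ j)
        = kd i d * (- 1 / p $ d * X $ i * Y p $ k) + kd k i * (- 1 / p $ d * X $ i * Y p $ d)
        + kd k d / p $ d * (X $ i * Y p $ i)" for i
    proof -
      have "(\<Sum>j\<in>UNIV. christoffel (hyp_metric d) k i j p * X $ i * Y p $ j)
        = (\<Sum>j\<in>UNIV. kd k j * (- kd i d / p $ d * X $ i * Y p $ j))
        + (\<Sum>j\<in>UNIV. kd j d * (- kd k i / p $ d * X $ i * Y p $ j))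
        + (\<Sum>j\<in>UNIV. kd i j * (kd k d / p $ d * X $ i * Y p $ j))"
        unfolding christoffel_hyp[OF p] hyp_christoffel_def sum.distrib[symmetric]
        by (intro sum.cong refl) (simp add: field_simps add_divide_distrib diff_divide_distrib)
      then show ?thesis
        by (simp only: sum_kd) simp
    qed
    then have "(\<Sum>i\<in>UNIV. \<Sum>j\<in>UNIV. christoffel (hyp_metric d) k i j p * X $ i * Y p $ j)
        = - 1 / p $ d * X $ d * Y p $ k + - 1 / p $ d * X $ k * Y p $ d + kd k d / p $ d * (X \<bullet> Y p)"
      by (simp only: sum.distrib sum_kd sum_distrib_left[symmetric] inner_vec_def inner_real_def)
    then show ?thesis
      by (simp add: kd_sym[of d] algebra_simps)
  qed
  moreover have "(\<Sum>i\<in>UNIV. X $ i * partial i (\<lambda>q. Y q $ k) p) = dfield Y p X $ k" for k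
    by (simp add: dfield_def inner_vec_def mult.commute)
  ultimately show ?thesis
    by (simp add: vec_eq_iff cov_deriv_def axis_kd)
qed

text \<open>
  The bridge between the hyperbolic boundary condition and Euclidean geometry. With \<open>\<nu> = y\<^sub>d N\<close> and
  \<open>u = V / y\<^sub>d\<close>, both sides contain the term \<open>V N\<^sub>d (X \<bullet> Y)\<close> with the same factor: on the left from
  differentiating \<open>1 / y\<^sub>d\<close>, on the right from the Christoffel symbols. After cancelling it, the condition compares
  the normal derivative of \<open>V\<close> with the Euclidean shape operator \<open>dN\<close>. The latter enters because
  \<open>Y \<bullet> N = 0\<close> along \<open>\<Sigma>\<close>, whence \<open>N \<bullet> dY X = - Y \<bullet> dN X\<close>.
\<close>

lemma boundary_condition_iff:
  fixes V :: "real ^ 'n::finite \<Rightarrow> real"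
  assumes p: "p \<in> hyp_space d" and \<nu>: "outward_unit_normal (hyp_metric d) \<Omega> \<Sigma> p (p $ d *\<^sub>R N p)"
    and V: "V differentiable (at p)" and u: "\<And>q. q \<in> insert p \<Omega> \<Longrightarrow> u q = V q / q $ d"
    and W: "open W" "p \<in> W" and N: "smooth_field_on W N" and Y: "smooth_field_on W Y"
    and YN: "\<And>q. q \<in> W \<inter> \<Sigma> \<Longrightarrow> Y q \<bullet> N q = 0" and "p \<in> \<Sigma>"
    and X: "X \<in> tangent_space \<Sigma> p" "N p \<bullet> X = 0"
  shows "normal_deriv u (p $ d *\<^sub>R N p) p * metric_inner (hyp_metric d) p X (Y p)
      = u p * second_fund_form (hyp_metric d) (p $ d *\<^sub>R N p) X Y p
    \<longleftrightarrow> (N p \<bullet> grad V p) * (X \<bullet> Y p) = V p * (Y p \<bullet> dfield N p X)"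
proof -
  have pos: "p $ d > 0" using p by (simp add: hyp_space_iff)
  have w: "((\<lambda>q. V q / q $ d) has_derivative
      (\<lambda>h. ((1 / p $ d) *\<^sub>R grad V p - (V p / (p $ d)\<^sup>2) *\<^sub>R axis d 1) \<bullet> h)) (at p)"
    using pos
    by - (rule derivative_eq_intros has_derivative_grad[OF V] refl
        | simp add: inner_diff_left inner_axis' field_simps power2_eq_square)+
  have "normal_deriv u (p $ d *\<^sub>R N p) p = grad (\<lambda>q. V q / q $ d) p \<bullet> (p $ d *\<^sub>R N p)"
    using w by (intro normal_deriv_eq_grad[OF \<nu> _ u]) (auto simp: differentiable_def)
  then have nd: "normal_deriv u (p $ d *\<^sub>R N p) p = N p \<bullet> grad V p - V p * N p $ d / p $ d"
    using pos by (simp add: grad_eqI[OF w] inner_diff_right inner_diff_left inner_axis inner_commute power2_eq_square field_simps)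
  have Y0: "Y p \<bullet> N p = 0"
    using YN[of p] W(2) \<open>p \<in> \<Sigma>\<close> by simp
  have "((\<lambda>q. Y q \<bullet> N q) has_derivative (\<lambda>h. Y p \<bullet> dfield N p h + dfield Y p h \<bullet> N p)) (at p)"
    by (rule has_derivative_inner smooth_field_has_derivative[OF W(1) _ W(2)] Y N)+
  moreover have "grad (\<lambda>q. Y q \<bullet> N q) p \<bullet> X = 0"
    using calculation by (intro tangent_space_imp_grad_orthogonal[OF W _ YN X(1)]) (auto simp: differentiable_def)
  ultimately have DY: "dfield Y p X \<bullet> N p = - (Y p \<bullet> dfield N p X)"
    using has_derivative_grad[of "\<lambda>q. Y q \<bullet> N q" p] has_derivative_unique
    by (smt (verit) differentiable_def)
  have sff: "second_fund_form (hyp_metric d) (p $ d *\<^sub>R N p) X Y p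
      = (Y p \<bullet> dfield N p X) / p $ d - (X \<bullet> Y p) * N p $ d / (p $ d)\<^sup>2"
    using pos DY Y0 X(2)
    by (simp add: second_fund_form_def metric_inner_hyp cov_deriv_hyp[OF p] inner_add_right inner_diff_right
        inner_axis inner_commute power2_eq_square field_simps)
  have up: "u p = V p / p $ d"
    by (simp add: u)
  show ?thesis
    unfolding nd sff up metric_inner_hyp using pos
    by (simp add: field_simps power2_eq_square)
qed

section \<open>Completeness\<close>

text \<open>
  The logarithm of the height changes at most by the length of the curve, since \<open>|c\<^sub>d'| / c\<^sub>d\<close> is at most the
  hyperbolic speed. This bounds the height along the whole curve and thereby its Euclidean length.
\<close>

lemma hyp_curve_bounds:
  assumes c: "c C1_differentiable_on {0..1}" "c ` {0..1} \<subseteq> hyp_space d"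
  defines "L \<equiv> curve_length (hyp_metric d) c"
  shows "\<bar>ln (c 1 $ d) - ln (c 0 $ d)\<bar> \<le> L"
    and "norm (c 1 - c 0) \<le> c 0 $ d * exp L * L"
proof -
  define c' where "c' t = vector_derivative c (at t)" for t
  define f where "f t = norm (c' t) / c t $ d" for t
  have dc: "(c has_vector_derivative c' t) (at t)" if "t \<in> {0..1}" for t
    using c(1) that by (auto simp: c'_def C1_differentiable_on_eq vector_derivative_works)
  have cont': "continuous_on {0..1} c'"
    using c(1) by (simp add: C1_differentiable_on_eq c'_def[abs_def])
  have cont: "continuous_on {0..1} c"
    using dc by (meson continuous_at_imp_continuous_on has_vector_derivative_continuous)
  have pos: "c t $ d > 0" if "t \<in> {0..1}" for t
    using c(2) that by (simp add: image_subset_iff hyp_space_iff)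
  have contf: "continuous_on {0..1} f"
    unfolding f_def using pos by (intro continuous_intros cont' cont) force
  have L: "L = integral {0..1} f"
    unfolding L_def curve_length_def
  proof (rule integral_cong)
    fix t :: real assume "t \<in> {0..1}"
    from pos[OF this]
    show "sqrt (metric_inner (hyp_metric d) (c t) (vector_derivative c (at t)) (vector_derivative c (at t))) = f t"
      by (simp add: metric_inner_hyp f_def c'_def real_sqrt_divide norm_eq_sqrt_inner)
  qed
  have f0: "f t \<ge> 0" if "t \<in> {0..1}" for t
    using pos[OF that] by (simp add: f_def)
  have sub: "integral {0..s} f \<le> L" if "s \<in> {0..1}" for s
    unfolding L using that f0
    by (intro integral_subset_le integrable_continuous_interval continuous_on_subset[OF contf]) auto
  have ln: "\<bar>ln (c s $ d) - ln (c 0 $ d)\<bar> \<le> L" if s: "s \<in> {0..1}" for s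
  proof -
    have dl: "((\<lambda>t. ln (c t $ d)) has_vector_derivative c' t $ d / c t $ d) (at t within {0..s})"
      if "t \<in> {0..s}" for t
    proof -
      have t: "t \<in> {0..1}" using that s by auto
      have "((\<lambda>t. c t $ d) has_real_derivative c' t $ d) (at t)"
        using bounded_linear.has_vector_derivative[OF bounded_linear_vec_nth dc[OF t]]
        by (simp add: has_real_derivative_iff_has_vector_derivative)
      from DERIV_chain2[OF DERIV_ln[OF pos[OF t]] this]
      have "((\<lambda>t. ln (c t $ d)) has_real_derivative c' t $ d / c t $ d) (at t)"
        by (simp add: field_simps)
      then show ?thesis
        by (simp add: has_real_derivative_iff_has_vector_derivative has_vector_derivative_at_within)
    qed
    have ft: "((\<lambda>t. c' t $ d / c t $ d) has_integral (ln (c s $ d) - ln (c 0 $ d))) {0..s}"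
      using fundamental_theorem_of_calculus[OF _ dl] s by simp
    have "norm (integral {0..s} (\<lambda>t. c' t $ d / c t $ d)) \<le> integral {0..s} f"
    proof (rule integral_norm_bound_integral)
      show "(\<lambda>t. c' t $ d / c t $ d) integrable_on {0..s}"
        using ft by blast
      show "f integrable_on {0..s}"
        using s by (intro integrable_continuous_interval continuous_on_subset[OF contf]) auto
      show "norm (c' t $ d / c t $ d) \<le> f t" if "t \<in> {0..s}" for t
        using pos[of t] that s component_le_norm_cart[of "c' t" d]
        by (simp add: f_def divide_right_mono)
    qed
    then show ?thesis
      using integral_unique[OF ft] sub[OF s] by simp
  qed
  show "\<bar>ln (c 1 $ d) - ln (c 0 $ d)\<bar> \<le> L"
    using ln by simp
  have ft: "(c' has_integral (c 1 - c 0)) {0..1}"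
    using fundamental_theorem_of_calculus[of 0 1 c c'] has_vector_derivative_at_within[OF dc] by simp
  have "norm (integral {0..1} c') \<le> integral {0..1} (\<lambda>t. c 0 $ d * exp L * f t)"
  proof (rule integral_norm_bound_integral)
    show "c' integrable_on {0..1}"
      using ft by blast
    show "(\<lambda>t. c 0 $ d * exp L * f t) integrable_on {0..1}"
      by (intro integrable_continuous_interval continuous_intros contf)
    show "norm (c' t) \<le> c 0 $ d * exp L * f t" if t: "t \<in> {0..1}" for t
    proof -
      have "c t $ d = exp (ln (c t $ d))"
        using pos[OF t] by simp
      also have "\<dots> \<le> exp (ln (c 0 $ d) + L)"
        using ln[OF t] by simp
      also have "\<dots> = c 0 $ d * exp L"
        using pos[of 0] by (simp add: exp_add)
      finally have "c t $ d * f t \<le> c 0 $ d * exp L * f t"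
        using f0[OF t] by (rule mult_right_mono)
      then show ?thesis
        using pos[OF t] by (simp add: f_def)
    qed
  qed
  then show "norm (c 1 - c 0) \<le> c 0 $ d * exp L * L"
    using integral_unique[OF ft] by (simp add: L)
qed

lemma riem_dist_hyp_bounds:
  assumes T: "T \<subseteq> hyp_space d" and D: "riem_dist (hyp_metric d) T x y < ennreal e"
  shows "\<bar>ln (y $ d) - ln (x $ d)\<bar> < e" and "norm (y - x) \<le> x $ d * exp e * e"
proof -
  obtain c where c: "c C1_differentiable_on {0..1}" "c ` {0..1} \<subseteq> T" "c 0 = x" "c 1 = y"
    and "ennreal (curve_length (hyp_metric d) c) < ennreal e"
    using D unfolding riem_dist_def INF_less_iff by auto
  then have lt: "curve_length (hyp_metric d) c < e"
    by (metis ennreal_leI not_less)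
  note b = hyp_curve_bounds[OF c(1) order_trans[OF c(2) T], unfolded c(3,4)]
  show "\<bar>ln (y $ d) - ln (x $ d)\<bar> < e"
    using b(1) lt by simp
  have "x \<in> T" using c(2,3) by auto
  then have "x $ d > 0" using T by (auto simp: hyp_space_iff)
  moreover have "curve_length (hyp_metric d) c \<ge> 0"
    using b(1) by linarith
  ultimately have "x $ d * exp (curve_length (hyp_metric d) c) * curve_length (hyp_metric d) c
      \<le> x $ d * exp e * e"
    using lt by (intro mult_mono) auto
  then show "norm (y - x) \<le> x $ d * exp e * e"
    using b(2) by linarith
qed

lemma riem_dist_hyp_le_segment:
  assumes T: "T \<subseteq> hyp_space d" "convex T" and xy: "x \<in> T" "y \<in> T"
    and m: "m > 0" "x $ d \<ge> m" "y $ d \<ge> m"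
  shows "riem_dist (hyp_metric d) T x y \<le> ennreal (norm (y - x) / m)"
proof -
  define c where "c t = x + t *\<^sub>R (y - x)" for t :: real
  have dc: "(c has_vector_derivative (y - x)) (at t)" for t
    unfolding c_def by (auto intro!: derivative_eq_intros)
  have c1: "c C1_differentiable_on {0..1}"
    using dc unfolding C1_differentiable_on_def by (intro exI[of _ "\<lambda>_. y - x"]) auto
  have cc: "c t = (1 - t) *\<^sub>R x + t *\<^sub>R y" for t
    by (simp add: c_def algebra_simps)
  have cT: "c ` {0..1} \<subseteq> T"
    using convexD_alt[OF T(2) xy] by (auto simp: cc)
  have cm: "c t $ d \<ge> m" if "t \<in> {0..1}" for t
  proof -
    have "(1 - t) * m + t * m \<le> (1 - t) * x $ d + t * y $ d"
      using that m by (intro add_mono mult_left_mono) auto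
    then show ?thesis by (simp add: cc algebra_simps)
  qed
  have "curve_length (hyp_metric d) c \<le> integral {0..1::real} (\<lambda>t. norm (y - x) / m)"
    unfolding curve_length_def vector_derivative_at[OF dc] metric_inner_hyp
  proof (rule integral_le)
    have "\<forall>t\<in>{0..1}. c t $ d \<noteq> 0"
      using cm m(1) by (metis not_le)
    moreover have "continuous_on {0..1} c"
      unfolding c_def by (intro continuous_intros)
    ultimately show "(\<lambda>t. sqrt ((y - x) \<bullet> (y - x) / (c t $ d)\<^sup>2)) integrable_on {0..1}"
      by (intro integrable_continuous_interval continuous_intros) auto
    show "sqrt ((y - x) \<bullet> (y - x) / (c t $ d)\<^sup>2) \<le> norm (y - x) / m" if "t \<in> {0..1}" for t
      using cm[OF that] m(1) by (simp add: real_sqrt_divide norm_eq_sqrt_inner[symmetric] frac_le)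
  qed (rule integrable_const_ivl)
  then have "curve_length (hyp_metric d) c \<le> norm (y - x) / m" by simp
  moreover have "riem_dist (hyp_metric d) T x y \<le> ennreal (curve_length (hyp_metric d) c)"
    unfolding riem_dist_def by (rule INF_lower) (use c1 cT in \<open>auto simp: c_def\<close>)
  ultimately show ?thesis
    by (meson ennreal_leI order_trans)
qed

text \<open>
  By the curve bounds, a Cauchy sequence for the length distance stays between two positive heights and is
  Cauchy in the Euclidean sense, so it has a Euclidean limit in the half-space, hence in \<open>T\<close>. Convexity enters for the
  converse comparison: the segment to the limit lies in \<open>T\<close>, and its length tends to zero.
\<close>

lemma riem_complete_hyp_convex:
  assumes T: "T \<subseteq> hyp_space d" "convex T" and cl: "closure T \<inter> hyp_space d \<subseteq> T"
  shows "riem_complete (hyp_metric d) T"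
  unfolding riem_complete_def
proof (intro allI impI, elim conjE)
  fix s :: "nat \<Rightarrow> real ^ 'a"
  assume sT: "range s \<subseteq> T"
    and cau: "\<forall>e>0. \<exists>N. \<forall>i\<ge>N. \<forall>j\<ge>N. riem_dist (hyp_metric d) T (s i) (s j) < e"
  have pos: "s i $ d > 0" for i
  proof -
    have "s i \<in> hyp_space d" using sT T(1) by blast
    then show ?thesis by (simp add: hyp_space_iff)
  qed
  have cauE: "\<exists>N. \<forall>i\<ge>N. \<forall>j\<ge>N. riem_dist (hyp_metric d) T (s i) (s j) < ennreal e" if "e > 0" for e
    using cau that by simp
  obtain N where N: "\<And>i j. i \<ge> N \<Longrightarrow> j \<ge> N \<Longrightarrow> riem_dist (hyp_metric d) T (s i) (s j) < ennreal 1"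
    using cauE[of 1] by auto
  define m where "m = s N $ d * exp (- 1)"
  define M where "M = s N $ d * exp 1"
  have m0: "m > 0" and M0: "M > 0" using pos by (simp_all add: m_def M_def)
  have mM: "m \<le> s i $ d \<and> s i $ d \<le> M" if "i \<ge> N" for i
  proof -
    have b: "\<bar>ln (s i $ d) - ln (s N $ d)\<bar> < 1"
      using riem_dist_hyp_bounds(1)[OF T(1) N[OF order_refl that]] .
    have "m = exp (ln (s N $ d) - 1)" "M = exp (ln (s N $ d) + 1)"
      using pos by (simp_all add: m_def M_def exp_add exp_diff exp_minus field_simps)
    moreover have "s i $ d = exp (ln (s i $ d))"
      using pos by simp
    ultimately show ?thesis
      using b by (metis abs_less_iff add.commute diff_less_eq exp_le_cancel_iff less_imp_le
          minus_diff_eq less_diff_eq)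
  qed
  have "Cauchy s"
    unfolding Cauchy_def
  proof (intro allI impI)
    fix \<epsilon> :: real assume \<epsilon>: "\<epsilon> > 0"
    \<comment> \<open>Length below \<open>e \<le> 1\<close> at height at most \<open>M\<close> forces Euclidean distance at most \<open>M * exp 1 * e\<close>.\<close>
    define e where "e = min 1 (\<epsilon> / (2 * M * exp 1))"
    have e: "e > 0" "e \<le> 1" "M * exp 1 * e < \<epsilon>"
    proof -
      show "e > 0" "e \<le> 1" using \<epsilon> M0 by (auto simp: e_def)
      have "M * exp 1 * e \<le> M * exp 1 * (\<epsilon> / (2 * M * exp 1))"
        using M0 by (intro mult_left_mono) (auto simp: e_def)
      also have "\<dots> < \<epsilon>" using M0 \<epsilon> by (simp add: field_simps)
      finally show "M * exp 1 * e < \<epsilon>" .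
    qed
    obtain N' where N': "\<And>i j. i \<ge> N' \<Longrightarrow> j \<ge> N' \<Longrightarrow> riem_dist (hyp_metric d) T (s i) (s j) < ennreal e"
      using cauE[OF e(1)] by auto
    have "dist (s i) (s j) < \<epsilon>" if "i \<ge> max N N'" "j \<ge> max N N'" for i j
    proof -
      have "norm (s j - s i) \<le> s i $ d * exp e * e"
        using riem_dist_hyp_bounds(2)[OF T(1) N'] that by simp
      also have "\<dots> \<le> M * exp 1 * e"
        using mM[of i] that e M0 pos[of i] by (intro mult_mono) auto
      finally show ?thesis
        using e(3) by (simp add: dist_norm norm_minus_commute)
    qed
    then show "\<exists>N. \<forall>m\<ge>N. \<forall>n\<ge>N. dist (s m) (s n) < \<epsilon>" by blast
  qed
  then obtain x where x: "s \<longlonglongrightarrow> x"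
    using Cauchy_convergent convergent_def by blast
  have xm: "x $ d \<ge> m"
    using tendsto_lowerbound[OF tendsto_vec_nth[OF x], of m] mM
    by (auto simp: eventually_sequentially)
  have "x \<in> closure T"
    using x sT unfolding closure_sequential by blast
  then have xT: "x \<in> T"
    using cl xm m0 by (auto simp: hyp_space_iff)
  have "(\<lambda>i. riem_dist (hyp_metric d) T (s i) x) \<longlonglongrightarrow> 0"
  proof (rule tendsto_sandwich)
    show "\<forall>\<^sub>F i in sequentially. 0 \<le> riem_dist (hyp_metric d) T (s i) x" by simp
    show "\<forall>\<^sub>F i in sequentially. riem_dist (hyp_metric d) T (s i) x \<le> ennreal (norm (x - s i) / m)"
      unfolding eventually_sequentially
      using riem_dist_hyp_le_segment[OF T _ xT m0 _ xm] sT mM by (intro exI[of _ N]) blast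
    have "(\<lambda>i. norm (x - s i) / m) \<longlonglongrightarrow> norm (x - x) / m"
      using m0 by (intro tendsto_intros x) auto
    then show "(\<lambda>i. ennreal (norm (x - s i) / m)) \<longlonglongrightarrow> 0"
      using tendsto_ennrealI by fastforce
  qed simp
  then show "\<exists>x\<in>T. (\<lambda>i. riem_dist (hyp_metric d) T (s i) x) \<longlonglongrightarrow> 0"
    using xT by blast
qed

section \<open>Spheres and hyperplanes bound static domains\<close>

text \<open>
  The assumption \<open>bc\<close> is the Euclidean form of the boundary condition, and that on the partial derivatives of
  \<open>V\<close> says that \<open>V / y\<^sub>d\<close> is a static potential. Convexity of the sublevel sets yields connectedness of \<open>\<Omega>\<close> and
  completeness of its closure.
\<close>

lemma static_domainI:
  fixes d :: "'n::finite" and \<phi> V :: "real ^ 'n \<Rightarrow> real"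
  assumes n: "CARD('n) \<ge> 2"
    and \<phi>: "smooth_on UNIV \<phi>" and \<Sigma>: "\<Sigma> = {q \<in> hyp_space d. \<phi> q = 0}" "\<Sigma> \<noteq> {}" "connected \<Sigma>"
    and conv: "convex {q \<in> hyp_space d. \<phi> q < 0}" "convex {q \<in> hyp_space d. \<phi> q \<le> 0}"
    and reg: "\<And>p. p \<in> \<Sigma> \<Longrightarrow> grad \<phi> p \<noteq> 0"
    and N: "smooth_field_on UNIV N" "\<And>p. p \<in> \<Sigma> \<Longrightarrow> N p = grad \<phi> p /\<^sub>R norm (grad \<phi> p)"
    and V: "smooth_on UNIV V"
      "\<And>p i j. p \<in> hyp_space d \<Longrightarrow> partial i (partial j V) p = kd i j * (partial d V p / p $ d)"
    and V0: "p0 \<in> hyp_space d" "\<phi> p0 \<le> 0" "V p0 \<noteq> 0"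
    and bc: "\<And>p X Y. p \<in> \<Sigma> \<Longrightarrow> N p \<bullet> X = 0 \<Longrightarrow> N p \<bullet> Y = 0 \<Longrightarrow>
        (N p \<bullet> grad V p) * (X \<bullet> Y) = V p * (Y \<bullet> dfield N p X)"
  shows "\<exists>\<Omega>. domain_in (hyp_metric d) (hyp_space d) \<Omega> \<Sigma> \<and> simple_domain \<Sigma> \<and>
    non_generic (hyp_metric d) \<Omega> \<Sigma>"
proof -
  define \<Omega> where "\<Omega> = {q \<in> hyp_space d. \<phi> q < 0}"
  define H where "H = hyp_space d"
  have oH: "open H" by (simp add: H_def open_hyp_space)
  have cont\<phi>: "continuous_on A \<phi>" for A
    using smooth_on_continuous[OF open_UNIV \<phi>] continuous_on_subset by blast
  have \<Omega>: "\<Omega> \<subseteq> H" "open \<Omega>" "connected \<Omega>"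
  proof -
    show "\<Omega> \<subseteq> H" by (auto simp: \<Omega>_def H_def)
    have "\<Omega> = H \<inter> \<phi> -` {..<0}" by (auto simp: \<Omega>_def H_def)
    then show "open \<Omega>"
      using continuous_open_preimage[OF cont\<phi> oH open_lessThan] by simp
    show "connected \<Omega>"
      unfolding \<Omega>_def by (rule convex_connected[OF conv(1)])
  qed
  have cl: "closure (\<Omega> \<union> \<Sigma>) \<inter> H \<subseteq> {q \<in> H. \<phi> q \<le> 0}"
  proof -
    have "closed {q. \<phi> q \<le> 0}"
      by (intro closed_Collect_le cont\<phi> continuous_on_const)
    then have "closure (\<Omega> \<union> \<Sigma>) \<subseteq> {q. \<phi> q \<le> 0}"
      by (rule closure_minimal[rotated]) (auto simp: \<Omega>_def \<Sigma>)
    then show ?thesis by blast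
  qed
  have un: "\<Omega> \<union> \<Sigma> = {q \<in> H. \<phi> q \<le> 0}"
    by (auto simp: \<Omega>_def \<Sigma> H_def)
  define W where "W = {q \<in> H. grad \<phi> q \<noteq> 0}"
  have oW: "open W"
  proof -
    have "continuous_on H (grad \<phi>)"
      using smooth_on_continuous_grad[OF open_UNIV \<phi>] continuous_on_subset by blast
    then have "open (H \<inter> grad \<phi> -` (- {0}))"
      using continuous_open_preimage[OF _ oH] by blast
    moreover have "W = H \<inter> grad \<phi> -` (- {0})"
      by (auto simp: W_def)
    ultimately show ?thesis by simp
  qed
  have W: "W \<inter> \<Omega> = {q \<in> W. \<phi> q < 0}" "W \<inter> \<Sigma> = {q \<in> W. \<phi> q = 0}" "W \<subseteq> H"
    by (auto simp: W_def \<Omega>_def \<Sigma> H_def)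
  have smW: "smooth_on W \<phi>"
    using smooth_on_subset[OF \<phi>] by blast
  have pW: "p \<in> W" if "p \<in> \<Sigma>" for p
    using that reg by (auto simp: W_def \<Sigma> H_def)
  have normal: "outward_unit_normal (hyp_metric d) \<Omega> \<Sigma> p \<nu> \<longleftrightarrow> \<nu> = p $ d *\<^sub>R N p" if "p \<in> \<Sigma>" for p \<nu>
    using outward_unit_normal_hyp_iff[OF oW smW pW[OF that] reg[OF that] _ W(1,2) that] N(2)[OF that]
      that by (auto simp: \<Sigma>)
  have tan: "tangent_space \<Sigma> p = {v. N p \<bullet> v = 0}" if "p \<in> \<Sigma>" for p
    using level_set_tangent_space[OF oW smW pW[OF that] reg[OF that] W(2) that] reg[OF that]
    by (simp add: N(2)[OF that])
  have front: "\<Sigma> = H \<inter> frontier \<Omega>"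
  proof (intro set_eqI iffI)
    fix p assume p: "p \<in> \<Sigma>"
    have "outward_unit_normal (hyp_metric d) \<Omega> \<Sigma> p (p $ d *\<^sub>R N p)"
      using normal[OF p] by blast
    then have "\<forall>\<^sub>F t in at_right 0. p - t *\<^sub>R (p $ d *\<^sub>R N p) \<in> \<Omega>"
      unfolding outward_unit_normal_def by blast
    then have "\<forall>\<^sub>F t in at_right 0. p - t *\<^sub>R (p $ d *\<^sub>R N p) \<in> closure \<Omega>"
      by eventually_elim (use closure_subset in blast)
    moreover have "((\<lambda>t. p - t *\<^sub>R (p $ d *\<^sub>R N p)) \<longlongrightarrow> p - 0 *\<^sub>R (p $ d *\<^sub>R N p)) (at_right 0)"
      by (intro tendsto_intros)
    ultimately have "p \<in> closure \<Omega>"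
      using Lim_in_closed_set[OF closed_closure _ trivial_limit_at_right_real] by fastforce
    then show "p \<in> H \<inter> frontier \<Omega>"
      using p interior_subset[of \<Omega>] by (auto simp: \<Sigma> H_def \<Omega>_def frontier_def)
  next
    fix p assume "p \<in> H \<inter> frontier \<Omega>"
    then have "p \<in> H" "p \<in> closure \<Omega>" "p \<notin> \<Omega>"
      using \<Omega>(2) by (auto simp: frontier_def interior_open)
    moreover have "closure \<Omega> \<subseteq> closure (\<Omega> \<union> \<Sigma>)"
      by (rule closure_mono) simp
    ultimately show "p \<in> \<Sigma>"
      using cl by (auto simp: \<Sigma> H_def \<Omega>_def)
  qed
  have "domain_in (hyp_metric d) (hyp_space d) \<Omega> \<Sigma>"
    unfolding domain_in_def H_def[symmetric]
  proof (intro conjI ballI)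
    fix p assume "p \<in> \<Sigma>"
    moreover have "\<forall>q\<in>W. \<exists>i. partial i \<phi> q \<noteq> 0"
      by (auto simp: W_def vec_eq_iff)
    ultimately show "\<exists>W \<phi>. open W \<and> p \<in> W \<and> W \<subseteq> H \<and> smooth_on W \<phi> \<and>
        (\<forall>q\<in>W. \<exists>i. partial i \<phi> q \<noteq> 0) \<and>
        W \<inter> \<Omega> = {q \<in> W. \<phi> q < 0} \<and> W \<inter> \<Sigma> = {q \<in> W. \<phi> q = 0}"
      using oW smW W pW by blast
  next
    show "riem_complete (hyp_metric d) (\<Omega> \<union> \<Sigma>)"
      by (rule riem_complete_hyp_convex) (use cl conv(2) un in \<open>auto simp: H_def\<close>)
  qed (use \<Omega> front \<Sigma>(2) in auto)
  moreover have "simple_domain \<Sigma>"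
  proof -
    have "components \<Sigma> = {\<Sigma>}"
      using \<Sigma>(2,3) components_eq_sing_iff by blast
    then show ?thesis by (simp add: simple_domain_def)
  qed
  moreover have "non_generic (hyp_metric d) \<Omega> \<Sigma>"
  proof -
    define u where "u q = V q / q $ d" for q
    have smu: "smooth_on H u"
    proof (rule smooth_on_cong[OF oH])
      show "smooth_on H (\<lambda>q. V q * (q $ d) powr (- 1))"
        using smooth_on_subset[OF V(1)] by (intro smooth_on_mult smooth_on_powr oH) (auto simp: H_def hyp_space_iff)
      show "V q * (q $ d) powr (- 1) = u q" if "q \<in> H" for q
        using that by (simp add: u_def H_def hyp_space_iff powr_minus_divide)
    qed
    have "smooth_upto (\<Omega> \<union> \<Sigma>) u"
      unfolding smooth_upto_def
      by (intro ballI exI[of _ H] exI[of _ u] conjI oH smu) (auto simp: un)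
    moreover have "\<exists>p\<in>\<Omega> \<union> \<Sigma>. u p \<noteq> 0"
      unfolding un by (rule bexI[of _ p0]) (use V0 in \<open>auto simp: u_def H_def hyp_space_iff\<close>)
    moreover have "Lstar (hyp_metric d) u p = 0" if "p \<in> \<Omega>" for p
    proof -
      have sub: "\<Omega> \<subseteq> hyp_space d" using \<Omega>(1) by (simp add: H_def)
      have Vu: "V q = q $ d * u q" if "q \<in> \<Omega>" for q
        using that by (simp add: u_def \<Omega>_def hyp_space_iff)
      have "p \<in> hyp_space d" using sub that by blast
      then show ?thesis
        using V(2) by (subst Lstar_hyp_eq_0_iff_potential[OF n \<Omega>(2) sub that smooth_on_subset[OF smu \<Omega>(1)] Vu]) auto
    qed
    moreover have "normal_deriv u \<nu> p * metric_inner (hyp_metric d) p X (Y p)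
        = u p * second_fund_form (hyp_metric d) \<nu> X Y p"
      if p: "p \<in> \<Sigma>" and \<nu>: "outward_unit_normal (hyp_metric d) \<Omega> \<Sigma> p \<nu>" and X: "X \<in> tangent_space \<Sigma> p"
        and Z: "open Z" "p \<in> Z" and Y: "smooth_field_on Z Y" "\<forall>q\<in>Z \<inter> \<Sigma>. Y q \<in> tangent_space \<Sigma> q"
      for p \<nu> X Z Y
    proof -
      have \<nu>N: "\<nu> = p $ d *\<^sub>R N p"
        using normal[OF p] \<nu> by simp
      have NZ: "smooth_field_on Z N"
        using N(1) unfolding smooth_field_on_def by (blast intro: smooth_on_subset[OF _ subset_UNIV])
      have YN: "Y q \<bullet> N q = 0" if "q \<in> Z \<inter> \<Sigma>" for q
      proof -
        have "Y q \<in> tangent_space \<Sigma> q" using Y(2) that by blast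
        then show ?thesis using tan[of q] that by (simp add: inner_commute)
      qed
      have XN: "N p \<bullet> X = 0"
        using X tan[OF p] by simp
      have "p \<in> hyp_space d" using p by (simp add: \<Sigma>)
      moreover have "V differentiable (at p)"
        using smooth_on_has_derivative[OF open_UNIV V(1)] by (auto simp: differentiable_def)
      ultimately show ?thesis
        unfolding \<nu>N
        using boundary_condition_iff[of p d \<Omega> \<Sigma> N V u Z Y X] \<nu>[unfolded \<nu>N] Z NZ Y(1) YN p X XN
          bc[OF p XN, of "Y p"] YN[of p]
        by (simp add: u_def inner_commute)
    qed
    ultimately show ?thesis
      unfolding non_generic_def by (intro exI[of _ u]) blast
  qed
  ultimately show ?thesis by blast
qed

lemma smooth_on_sphere_eq:
  fixes a :: "real ^ 'n::finite"
  shows "smooth_on UNIV (\<lambda>q. (q - a) \<bullet> (q - a) - r\<^sup>2)"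
  by (intro smooth_on_diff smooth_on_inner open_UNIV) (auto intro!: smooth_on_diff)

lemma grad_sphere_eq:
  fixes a :: "real ^ 'n::finite"
  shows "grad (\<lambda>q. (q - a) \<bullet> (q - a) - r\<^sup>2) p = 2 *\<^sub>R (p - a)"
  by (rule grad_eqI) (auto intro!: derivative_eq_intros simp: inner_commute)

lemma sphere_eq_iff: "r > 0 \<Longrightarrow> (q - a) \<bullet> (q - a) - r\<^sup>2 = 0 \<longleftrightarrow> q \<in> sphere a r"
  by (simp add: dist_norm norm_minus_commute dot_square_norm power2_eq_iff_nonneg)

lemma smooth_on_plane_eq:
  fixes a :: "real ^ 'n::finite"
  shows "smooth_on UNIV (\<lambda>q. a \<bullet> q - b)"
  by (intro smooth_on_diff smooth_on_inner open_UNIV) auto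

lemma grad_plane_eq:
  fixes a :: "real ^ 'n::finite"
  shows "grad (\<lambda>q. a \<bullet> q - b) p = a"
  by (rule grad_eqI) (auto intro!: derivative_eq_intros)

lemma exists_other_index:
  fixes d :: "'n::finite"
  assumes "CARD('n) \<ge> 2"
  obtains i where "i \<noteq> d"
proof -
  have "\<exists>i. i \<noteq> d"
  proof (rule ccontr)
    assume "\<nexists>i. i \<noteq> d"
    then have "(UNIV :: 'n set) = {d}" by auto
    then have "CARD('n) = card {d}" by (rule arg_cong)
    then show False using assms by simp
  qed
  then show ?thesis using that by blast
qed

lemma connected_hyperplane_hyp: "connected ({y. a \<bullet> y = b} \<inter> hyp_space d)"
  by (intro convex_connected convex_Int convex_hyperplane convex_hyp_space)

text \<open>
  Unless the whole sphere lies in the half-space, its part there is, up to translation and scaling, a spherical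
  cap \<open>w\<^sub>d > \<tau>\<close> with \<open>\<tau> \<ge> -1\<close>. For \<open>\<tau> < 1\<close> this is the radial projection of the cone \<open>w\<^sub>d > \<tau> |w|\<close>. This cone omits the origin, and it is
  starlike around the pole even when it is not convex.
\<close>

lemma connected_sphere_hyp:
  fixes a :: "real ^ 'n::finite"
  assumes n: "CARD('n) \<ge> 2" and r: "r > 0"
  shows "connected (sphere a r \<inter> hyp_space d)"
proof (cases "a $ d > r")
  case True
  have "sphere a r \<subseteq> hyp_space d"
  proof
    fix y assume "y \<in> sphere a r"
    then have "norm (y - a) = r" by (simp add: dist_norm norm_minus_commute)
    then have "\<bar>(y - a) $ d\<bar> \<le> r"
      using component_le_norm_cart[of "y - a" d] by simp
    then show "y \<in> hyp_space d"
      using True by (simp add: hyp_space_iff)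
  qed
  then show ?thesis
    using connected_sphere[of a r] n by (simp add: inf_absorb1)
next
  case False
  define \<tau> where "\<tau> = - a $ d / r"
  have \<tau>1: "\<tau> \<ge> -1"
    using False r by (simp add: \<tau>_def field_simps)
  define C where "C = {w :: real ^ 'n. w $ d > \<tau> * norm w}"
  have H: "a + r *\<^sub>R w \<in> hyp_space d \<longleftrightarrow> w $ d > \<tau>" for w
    using r by (simp add: hyp_space_iff \<tau>_def field_simps) linarith
  show ?thesis
  proof (cases "\<tau> < 1")
    case True
    have e: "axis d 1 \<in> C"
      using True by (simp add: C_def)
    have "starlike C"
      unfolding starlike_def
    proof (intro bexI[OF _ e] ballI subsetI)
      fix w z assume w: "w \<in> C" and "z \<in> closed_segment (axis d 1) w"
      then obtain s where s: "0 \<le> s" "s \<le> 1" and z: "z = (1 - s) *\<^sub>R axis d 1 + s *\<^sub>R w"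
        by (auto simp: closed_segment_def)
      have up: "norm z \<le> (1 - s) + s * norm w"
        using norm_triangle_ineq[of "(1 - s) *\<^sub>R axis d 1 :: real ^ 'n" "s *\<^sub>R w"] s by (simp add: z)
      have lo: "norm z \<ge> s * norm w - (1 - s)"
        using norm_triangle_ineq2[of "s *\<^sub>R w" "- ((1 - s) *\<^sub>R axis d 1 :: real ^ 'n)"] s by (simp add: z add.commute)
      have zd: "z $ d = (1 - s) + s * w $ d"
        by (simp add: z)
      have wd: "w $ d - \<tau> * norm w > 0" using w by (simp add: C_def)
      have "z $ d - \<tau> * norm z > 0"
      proof (cases "\<tau> \<ge> 0")
        case True
        have "\<tau> * norm z \<le> \<tau> * ((1 - s) + s * norm w)"
          using up True by (rule mult_left_mono)
        then have "z $ d - \<tau> * norm z \<ge> (1 - s) * (1 - \<tau>) + s * (w $ d - \<tau> * norm w)"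
          by (simp add: zd algebra_simps)
        moreover have "(1 - s) * (1 - \<tau>) + s * (w $ d - \<tau> * norm w) > 0"
          using s wd \<open>\<tau> < 1\<close> by (cases "s = 0") (auto intro: add_nonneg_pos)
        ultimately show ?thesis by linarith
      next
        case False
        then have "(- \<tau>) * norm z \<ge> (- \<tau>) * (s * norm w - (1 - s))"
          using lo by (intro mult_left_mono) auto
        then have "z $ d - \<tau> * norm z \<ge> (1 - s) * (1 + \<tau>) + s * (w $ d - \<tau> * norm w)"
          by (simp add: zd algebra_simps)
        moreover have "(1 - s) * (1 + \<tau>) + s * (w $ d - \<tau> * norm w) > 0" if "s \<noteq> 0"
          using s wd \<tau>1 that by (auto intro: add_nonneg_pos)
        moreover have "z $ d - \<tau> * norm z > 0" if "s = 0"
          using e that by (simp add: z C_def)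
        ultimately show ?thesis by fastforce
      qed
      then show "z \<in> C" by (simp add: C_def)
    qed
    then have "connected C" by (rule starlike_imp_connected)
    moreover have C0: "w \<noteq> 0" if "w \<in> C" for w
      using that by (auto simp: C_def)
    then have "continuous_on C (\<lambda>w. a + r *\<^sub>R (w /\<^sub>R norm w))"
      by (intro continuous_intros) auto
    ultimately have "connected ((\<lambda>w. a + r *\<^sub>R (w /\<^sub>R norm w)) ` C)"
      by (rule connected_continuous_image[rotated])
    also have "(\<lambda>w. a + r *\<^sub>R (w /\<^sub>R norm w)) ` C = sphere a r \<inter> hyp_space d"
    proof (intro set_eqI iffI)
      fix y assume "y \<in> (\<lambda>w. a + r *\<^sub>R (w /\<^sub>R norm w)) ` C"
      then obtain w where w: "w \<in> C" "y = a + r *\<^sub>R (w /\<^sub>R norm w)" by blast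
      have "norm w > 0" using C0 w(1) by simp
      then have "(w /\<^sub>R norm w) $ d > \<tau>"
        using w(1) by (simp add: C_def field_simps)
      then have "y \<in> hyp_space d"
        using H w(2) by blast
      moreover have "y \<in> sphere a r"
        using C0[OF w(1)] r by (simp add: w(2) dist_norm)
      ultimately show "y \<in> sphere a r \<inter> hyp_space d" by blast
    next
      fix y assume y: "y \<in> sphere a r \<inter> hyp_space d"
      define w where "w = (y - a) /\<^sub>R r"
      have nw: "norm w = 1"
        using y r by (simp add: w_def dist_norm norm_minus_commute)
      have yw: "y = a + r *\<^sub>R w"
        using r by (simp add: w_def)
      have "w \<in> C"
        using H[of w] y yw nw by (simp add: C_def)
      then show "y \<in> (\<lambda>w. a + r *\<^sub>R (w /\<^sub>R norm w)) ` C"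
        using nw yw by (intro image_eqI[of _ _ w]) auto
    qed
    finally show ?thesis .
  next
    case False
    have "sphere a r \<inter> hyp_space d = {}"
    proof (rule ccontr)
      assume "sphere a r \<inter> hyp_space d \<noteq> {}"
      then obtain y where "y \<in> sphere a r \<inter> hyp_space d" by blast
      then have y: "norm (y - a) = r" "y $ d > 0"
        by (auto simp: hyp_space_iff dist_norm norm_minus_commute)
      have "(y - a) $ d \<le> r"
        using component_le_norm_cart[of "y - a" d] y(1) by simp
      then show False
        using False r y(2) by (simp add: \<tau>_def field_simps)
    qed
    then show ?thesis by simp
  qed
qed

text \<open>
  A hyperplane has \<open>dN = 0\<close>, so the constant potential \<open>V = 1\<close> works, that is \<open>u = 1 / y\<^sub>d\<close>.
\<close>

lemma hyperplane_bounds_static_domain: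
  fixes d :: "'n::finite"
  assumes n: "CARD('n) \<ge> 2" and a: "a \<noteq> 0" and ne: "{y. a \<bullet> y = b} \<inter> hyp_space d \<noteq> {}"
  shows "\<exists>\<Omega>. domain_in (hyp_metric d) (hyp_space d) \<Omega> ({y. a \<bullet> y = b} \<inter> hyp_space d) \<and>
    simple_domain ({y. a \<bullet> y = b} \<inter> hyp_space d) \<and>
    non_generic (hyp_metric d) \<Omega> ({y. a \<bullet> y = b} \<inter> hyp_space d)"
proof -
  define \<phi> where "\<phi> q = a \<bullet> q - b" for q
  have g: "grad \<phi> p = a" for p
    unfolding \<phi>_def by (rule grad_plane_eq)
  have grad0: "grad (\<lambda>_::real ^ 'n. c) p = 0" for p c
    by (simp add: vec_eq_iff partial_const)
  obtain p0 where p0: "a \<bullet> p0 = b" "p0 \<in> hyp_space d" using ne by blast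
  have "convex ({q. a \<bullet> q < b} \<inter> hyp_space d)" "convex ({q. a \<bullet> q \<le> b} \<inter> hyp_space d)"
    by (intro convex_Int convex_hyp_space convex_halfspace_lt convex_halfspace_le)+
  then have conv: "convex {q \<in> hyp_space d. \<phi> q < 0}" "convex {q \<in> hyp_space d. \<phi> q \<le> 0}"
    by (simp_all add: \<phi>_def Int_def conj_commute)
  have sm: "smooth_on UNIV \<phi>"
    unfolding \<phi>_def by (rule smooth_on_plane_eq)
  show ?thesis
  proof (rule static_domainI[OF n sm _ ne connected_hyperplane_hyp conv,
        where N = "\<lambda>_. a /\<^sub>R norm a" and V = "\<lambda>_. 1" and ?p0.0 = p0])
    show "{y. a \<bullet> y = b} \<inter> hyp_space d = {q \<in> hyp_space d. \<phi> q = 0}"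
      by (auto simp: \<phi>_def)
    show "smooth_field_on UNIV (\<lambda>_. a /\<^sub>R norm a)"
      by (simp add: smooth_field_on_def)
    show "((a /\<^sub>R norm a) \<bullet> grad (\<lambda>_. 1) p) * (X \<bullet> Y) = 1 * (Y \<bullet> dfield (\<lambda>_. a /\<^sub>R norm a) p X)"
      for p X Y
      by (simp add: grad0 dfield_def vec_eq_iff inner_vec_def)
  qed (use a p0 in \<open>simp_all add: g[unfolded \<phi>_def] partial_const \<phi>_def\<close>)
qed

text \<open>
  For a sphere with centre \<open>a\<close>, \<open>dN\<close> is \<open>1 / r\<close> times the identity and \<open>N = (q - a) / r\<close>. The boundary condition
  asks for \<open>(q - a) \<bullet> grad V = V\<close>, which holds for functions that are homogeneous linear in \<open>q - a\<close>. To be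
  a static potential such a \<open>V\<close> must not involve the height; a second coordinate \<open>i\<close> is available in dimension
  at least two.
\<close>

lemma sphere_bounds_static_domain:
  fixes d :: "'n::finite"
  assumes n: "CARD('n) \<ge> 2" and r: "r > 0" and ne: "sphere a r \<inter> hyp_space d \<noteq> {}"
  shows "\<exists>\<Omega>. domain_in (hyp_metric d) (hyp_space d) \<Omega> (sphere a r \<inter> hyp_space d) \<and>
    simple_domain (sphere a r \<inter> hyp_space d) \<and>
    non_generic (hyp_metric d) \<Omega> (sphere a r \<inter> hyp_space d)"
proof -
  define \<phi> where "\<phi> q = (q - a) \<bullet> (q - a) - r\<^sup>2" for q
  have \<phi>: "\<phi> q = (dist a q)\<^sup>2 - r\<^sup>2" for q
    by (simp add: \<phi>_def dist_norm norm_minus_commute dot_square_norm)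
  have iff: "\<phi> q < 0 \<longleftrightarrow> dist a q < r" "\<phi> q \<le> 0 \<longleftrightarrow> dist a q \<le> r" "\<phi> q = 0 \<longleftrightarrow> dist a q = r" for q
    using r by (auto simp: \<phi> power2_eq_iff_nonneg abs_square_less_1 simp flip: abs_le_square_iff
        intro: power_strict_mono power2_less_imp_less)
  have g: "grad \<phi> p = 2 *\<^sub>R (p - a)" for p
    unfolding \<phi>_def by (rule grad_sphere_eq)
  obtain i where i: "i \<noteq> d" using exists_other_index[OF n] by blast
  define V where "V q = q $ i - a $ i" for q
  have gV: "grad V p = axis i 1" for p
    unfolding V_def by (rule grad_eqI) (auto intro!: derivative_eq_intros simp: inner_axis')
  have pV: "partial j V = (\<lambda>_. kd i j)" for j
    using gV by (metis axis_kd grad_nth)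
  obtain p where p: "dist a p = r" "p \<in> hyp_space d" using ne unfolding sphere_def by blast
  \<comment> \<open>If \<open>V\<close> vanishes at a point \<open>p\<close> of the sphere, move \<open>p\<close> slightly towards the centre, to stay in the half-space,
      and use the room gained to move in direction \<open>i\<close>.\<close>
  obtain p0 where p0: "p0 \<in> hyp_space d" "dist a p0 \<le> r" "V p0 \<noteq> 0"
  proof (cases "V p = 0")
    case True
    \<comment> \<open>Moving by \<open>s * r\<close> costs at most half of the height of \<open>p\<close>.\<close>
    define s where "s = min 1 (p $ d / (2 * r))"
    have pd: "p $ d > 0" using p(2) by (simp add: hyp_space_iff)
    have s: "0 < s" "s \<le> 1" "s * r < p $ d"
    proof -
      show "0 < s" "s \<le> 1" using pd r by (auto simp: s_def)
      have "s * r \<le> p $ d / (2 * r) * r"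
        using r by (intro mult_right_mono) (auto simp: s_def)
      then show "s * r < p $ d" using pd r by simp
    qed
    define q where "q = p + s *\<^sub>R (a - p) + (s * r) *\<^sub>R axis i 1"
    have na: "norm (p - a) = r" "norm (a - p) = r"
      using p(1) by (simp_all add: dist_norm norm_minus_commute)
    have "q - a = (1 - s) *\<^sub>R (p - a) + (s * r) *\<^sub>R axis i 1"
      by (simp add: q_def algebra_simps)
    then have "norm (q - a) \<le> (1 - s) * r + s * r"
      using norm_triangle_ineq[of "(1 - s) *\<^sub>R (p - a)" "(s * r) *\<^sub>R axis i 1"] s r na by simp
    then have "dist a q \<le> r"
      by (simp add: dist_norm norm_minus_commute algebra_simps)
    moreover have "q \<in> hyp_space d"
    proof -
      have "\<bar>(a - p) $ d\<bar> \<le> r"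
        using component_le_norm_cart[of "a - p" d] na by simp
      then have "s * (a - p) $ d \<ge> - (s * r)"
        using s(1) mult_left_mono[of "- r" "(a - p) $ d" s] by simp
      then show ?thesis
        using s(3) i by (simp add: hyp_space_iff q_def axis_def)
    qed
    moreover have "V q \<noteq> 0"
      using True s(1) r by (simp add: V_def q_def algebra_simps)
    ultimately show ?thesis using that by blast
  next
    case False
    then show ?thesis using that[of p] p by simp
  qed
  have "convex (ball a r \<inter> hyp_space d)" "convex (cball a r \<inter> hyp_space d)"
    by (intro convex_Int convex_hyp_space convex_ball convex_cball)+
  then have conv: "convex {q \<in> hyp_space d. \<phi> q < 0}" "convex {q \<in> hyp_space d. \<phi> q \<le> 0}"
    by (simp_all add: iff ball_def cball_def Int_def conj_commute)
  have sm: "smooth_on UNIV \<phi>"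
    unfolding \<phi>_def by (rule smooth_on_sphere_eq)
  have gN: "grad (\<lambda>q. ((q - a) /\<^sub>R r) $ k) p = axis k (1 / r)" for p k
    using r by (intro grad_eqI) (auto intro!: derivative_eq_intros simp: inner_axis' field_simps)
  have dN: "dfield (\<lambda>q. (q - a) /\<^sub>R r) p X = X /\<^sub>R r" for p X
    unfolding dfield_def gN by (simp add: vec_eq_iff inner_axis' field_simps)
  have smN: "smooth_field_on UNIV (\<lambda>q. (q - a) /\<^sub>R r)"
    unfolding smooth_field_on_def
    by (auto intro!: smooth_on_mult smooth_on_diff)
  have smV: "smooth_on UNIV V"
    unfolding V_def by (intro smooth_on_diff) auto
  show ?thesis
  proof (rule static_domainI[OF n sm _ ne connected_sphere_hyp[OF n r] conv _ smN _ smV _ p0(1) _ p0(3)])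
    show "sphere a r \<inter> hyp_space d = {q \<in> hyp_space d. \<phi> q = 0}"
      by (auto simp: iff)
    fix p assume p: "p \<in> sphere a r \<inter> hyp_space d"
    then have np: "norm (p - a) = r" by (simp add: dist_norm norm_minus_commute)
    show "grad \<phi> p \<noteq> 0" using np r by (auto simp: g)
    show "(p - a) /\<^sub>R r = grad \<phi> p /\<^sub>R norm (grad \<phi> p)"
      using r by (simp add: g np)
    show "(((p - a) /\<^sub>R r) \<bullet> grad V p) * (X \<bullet> Y) = V p * (Y \<bullet> dfield (\<lambda>q. (q - a) /\<^sub>R r) p X)" for X Y
      by (simp add: gV dN inner_axis inner_axis' V_def inner_commute)
  qed (use p0 i in \<open>auto simp: iff pV partial_const kd_def\<close>)
qed

section \<open>Static potentials of a domain\<close>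

lemma has_derivative_quadratic:
  fixes b :: "real ^ 'n::finite"
  shows "((\<lambda>q. A * (q \<bullet> q) + b \<bullet> q + c) has_derivative (\<lambda>h. ((2 * A) *\<^sub>R p + b) \<bullet> h)) (at p)"
  by (auto intro!: derivative_eq_intros simp: inner_add_left inner_commute algebra_simps)

lemma grad_quadratic:
  fixes b :: "real ^ 'n::finite"
  shows "grad (\<lambda>q. A * (q \<bullet> q) + b \<bullet> q + c) p = (2 * A) *\<^sub>R p + b"
  by (rule grad_eqI) (rule has_derivative_quadratic)

text \<open>
  The formula holds in \<open>\<Omega>\<close> by solving the equation there, and on \<open>\<Sigma>\<close> by continuity.
\<close>

lemma static_potential_quadratic:
  fixes d :: "'n::finite"
  assumes n: "CARD('n) \<ge> 2" and \<Omega>: "open \<Omega>" "connected \<Omega>" "\<Omega> \<subseteq> hyp_space d"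
    and \<Sigma>: "\<Sigma> = hyp_space d \<inter> frontier \<Omega>" and u: "smooth_upto (\<Omega> \<union> \<Sigma>) u"
    and L: "\<And>p. p \<in> \<Omega> \<Longrightarrow> Lstar (hyp_metric d) u p = 0"
  obtains A b c where "b $ d = 0"
    "\<And>q. q \<in> \<Omega> \<union> \<Sigma> \<Longrightarrow> u q = (A * (q \<bullet> q) + b \<bullet> q + c) / q $ d"
proof -
  have sm: "smooth_on \<Omega> u"
  proof (rule smooth_on_local)
    fix p assume "p \<in> \<Omega>"
    then obtain W v where W: "open W" "p \<in> W" "smooth_on W v" "\<forall>q\<in>W \<inter> (\<Omega> \<union> \<Sigma>). u q = v q"
      using u unfolding smooth_upto_def by blast
    have "smooth_on (W \<inter> \<Omega>) u"
    proof (rule smooth_on_cong)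
      show "open (W \<inter> \<Omega>)" using W \<Omega> by blast
      show "smooth_on (W \<inter> \<Omega>) v" using smooth_on_subset[OF W(3)] by blast
      show "v q = u q" if "q \<in> W \<inter> \<Omega>" for q using W(4) that by simp
    qed
    then show "\<exists>W. open W \<and> p \<in> W \<and> smooth_on W u"
      using W \<Omega> \<open>p \<in> \<Omega>\<close> by blast
  qed
  have smV: "smooth_on \<Omega> (\<lambda>q. q $ d * u q)"
    by (intro smooth_on_mult \<Omega> sm) auto
  have hess: "partial i (partial j (\<lambda>q. q $ d * u q)) p = kd i j * (partial d (\<lambda>q. q $ d * u q) p / p $ d)"
    if "p \<in> \<Omega>" for p i j
    using Lstar_hyp_eq_0_iff_potential[OF n \<Omega>(1,3) that sm refl] L[OF that] by blast
  obtain A b c where b: "b $ d = 0"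
    and V: "\<And>q. q \<in> \<Omega> \<Longrightarrow> q $ d * u q = A * (q \<bullet> q) + b \<bullet> q + c"
    by (rule potential_quadratic[OF \<Omega> smV hess]) blast+
  define w where "w q = (A * (q \<bullet> q) + b \<bullet> q + c) / q $ d" for q
  have uw: "u q = w q" if "q \<in> \<Omega>" for q
  proof -
    have "q $ d > 0" using that \<Omega>(3) by (auto simp: hyp_space_iff)
    then show ?thesis
      using V[OF that] by (simp add: w_def field_simps)
  qed
  have "u q = w q" if "q \<in> \<Sigma>" for q
  proof -
    have qd: "q $ d > 0" and qc: "q \<in> closure \<Omega>"
      using that by (auto simp: \<Sigma> hyp_space_iff frontier_def)
    obtain W v where W: "open W" "q \<in> W" "smooth_on W v" "\<forall>q\<in>W \<inter> (\<Omega> \<union> \<Sigma>). u q = v q"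
      using u \<open>q \<in> \<Sigma>\<close> unfolding smooth_upto_def by blast
    obtain s where s: "\<forall>n. s n \<in> \<Omega>" "s \<longlonglongrightarrow> q"
      using qc unfolding closure_sequential by blast
    have "isCont v q"
      using smooth_on_continuous[OF W(1,3)] W(1,2) continuous_on_eq_continuous_at by blast
    then have lim1: "(\<lambda>n. v (s n)) \<longlonglongrightarrow> v q"
      using s(2) isCont_tendsto_compose by blast
    have lim2: "(\<lambda>n. w (s n)) \<longlonglongrightarrow> w q"
      unfolding w_def using qd by (intro tendsto_intros s(2)) auto
    have "\<forall>\<^sub>F n in sequentially. s n \<in> W"
      using topological_tendstoD[OF s(2) W(1,2)] .
    then have "\<forall>\<^sub>F n in sequentially. v (s n) = w (s n)"
      by eventually_elim (use W(4) s(1) uw in force)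
    then have "(\<lambda>n. w (s n)) \<longlonglongrightarrow> v q"
      using lim1 by (rule Lim_transform_eventually[rotated])
    then have "v q = w q"
      using lim2 LIMSEQ_unique by blast
    then show ?thesis
      using W(2,4) \<open>q \<in> \<Sigma>\<close> by simp
  qed
  then show ?thesis
    using that[OF b] uw unfolding w_def by blast
qed

section \<open>Rigidity\<close>

lemma exists_orthogonal:
  fixes v :: "real ^ 'n::finite"
  assumes "CARD('n) \<ge> 2"
  obtains X where "v \<bullet> X = 0" "X \<noteq> 0"
proof -
  fix i :: 'n
  obtain j where j: "j \<noteq> i" using exists_other_index[OF assms] by blast
  define X where "X = (if v $ i = 0 then axis i 1 else v $ j *\<^sub>R axis i 1 - v $ i *\<^sub>R axis j 1 :: real ^ 'n)"
  have "v \<bullet> X = 0"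
    by (simp add: X_def inner_diff_right inner_axis)
  moreover have "X \<noteq> 0"
  proof (cases "v $ i = 0")
    case True
    then show ?thesis by (simp add: X_def axis_eq_0_iff)
  next
    case False
    then have "X $ j \<noteq> 0" using j by (simp add: X_def axis_def)
    then show ?thesis by (metis zero_index)
  qed
  ultimately show ?thesis using that by blast
qed

lemma unit_field_derivative_orthogonal:
  fixes N :: "real ^ 'n::finite \<Rightarrow> real ^ 'n"
  assumes W: "open W" "smooth_field_on W N" "q \<in> W" and N1: "\<And>q. q \<in> W \<Longrightarrow> N q \<bullet> N q = 1"
  shows "N q \<bullet> dfield N q X = 0"
proof -
  have "((\<lambda>q. N q \<bullet> N q) has_derivative (\<lambda>h. N q \<bullet> dfield N q h + dfield N q h \<bullet> N q)) (at q)"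
    by (rule has_derivative_inner smooth_field_has_derivative[OF W])+
  from has_derivative_transform_within_open[OF this W(1,3) N1]
  have "((\<lambda>q. 1) has_derivative (\<lambda>h. N q \<bullet> dfield N q h + dfield N q h \<bullet> N q)) (at q)" .
  from has_derivative_unique[OF this has_derivative_const] show ?thesis
    by (auto simp: inner_commute dest: fun_cong[of _ _ X])
qed

text \<open>
  The heart of the rigidity. The hypothesis \<open>shape\<close> says \<open>V dN = (\<partial>\<^sub>N V) I\<close> on the tangent spaces.
  \<^item> With \<open>\<kappa> = div N / (n - 1)\<close>, which is smooth also where \<open>V\<close> vanishes, the trace gives \<open>V \<kappa> = \<partial>\<^sub>N V\<close>.
  \<^item> At a zero of \<open>V\<close> in \<open>\<Sigma>\<close> the gradient of \<open>V\<close> is nonzero and, by this identity, tangent to \<open>\<Sigma>\<close>. The zeros are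
    therefore nowhere dense in \<open>\<Sigma>\<close>, and \<open>dN = \<kappa> I\<close> holds on every tangent space by continuity: \<open>\<Sigma>\<close> is umbilic.
  \<^item> Differentiating \<open>V \<kappa> = \<partial>\<^sub>N V\<close> along a tangent vector \<open>X\<close>, the terms with \<open>grad V \<bullet> X\<close> cancel, and the
    Hessian term \<open>2 A (N \<bullet> X)\<close> vanishes. This leaves \<open>V (d\<kappa> X) = 0\<close>, so \<open>\<kappa>\<close> is locally constant, and with it
    \<open>N - \<kappa> q\<close>. No Codazzi equation is involved, so this argument includes curves in the plane, where being
    umbilic is an empty condition.
\<close>

lemma static_boundary_normal_affine_locally:
  fixes d :: "'n::finite" and b :: "real ^ 'n"
  assumes n: "CARD('n) \<ge> 2"
    and W: "open W" "W \<subseteq> hyp_space d" and \<phi>: "smooth_on W \<phi>" "\<And>q. q \<in> W \<Longrightarrow> grad \<phi> q \<noteq> 0"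
    and \<Sigma>: "W \<inter> \<Sigma> = {q \<in> W. \<phi> q = 0}"
    and N: "smooth_field_on W N" "\<And>q. q \<in> W \<Longrightarrow> N q \<bullet> N q = 1"
      "\<And>q X. q \<in> W \<Longrightarrow> N q \<bullet> X = 0 \<longleftrightarrow> grad \<phi> q \<bullet> X = 0"
    and b: "b $ d = 0" and nz: "\<not> (A = 0 \<and> b = 0 \<and> c = 0)"
    and V: "\<And>q. V q = A * (q \<bullet> q) + b \<bullet> q + c"
    and shape: "\<And>q X. q \<in> W \<inter> \<Sigma> \<Longrightarrow> N q \<bullet> X = 0 \<Longrightarrow>
        V q *\<^sub>R dfield N q X = (N q \<bullet> grad V q) *\<^sub>R X"
    and p: "p \<in> W \<inter> \<Sigma>"
  obtains W' \<kappa> m where "open W'" "p \<in> W'" "\<And>q. q \<in> W' \<inter> \<Sigma> \<Longrightarrow> N q = \<kappa> *\<^sub>R q + m"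
proof -
  define \<kappa> where "\<kappa> q = (\<Sum>k\<in>UNIV. partial k (\<lambda>q. N q $ k) q) * (1 / (real CARD('n) - 1))" for q
  have n1: "real CARD('n) - 1 > 0" using n by simp
  have gV: "grad V q = (2 * A) *\<^sub>R q + b" for q
    unfolding V[abs_def] by (rule grad_quadratic)
  have dV: "(V has_derivative (\<lambda>h. grad V q \<bullet> h)) (at q)" for q
    unfolding gV unfolding V[abs_def] by (rule has_derivative_quadratic)
  have smN: "smooth_on W (\<lambda>q. N q $ k)" for k
    using N(1) by (simp add: smooth_field_on_def)
  have sm\<kappa>: "smooth_on W \<kappa>"
    unfolding \<kappa>_def by (intro smooth_on_mult smooth_on_sum W smooth_on_partial smN) auto
  have d\<kappa>: "(\<kappa> has_derivative (\<lambda>h. grad \<kappa> q \<bullet> h)) (at q)" if "q \<in> W" for q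
    using smooth_on_has_derivative[OF W(1) sm\<kappa> that] .
  have dN: "(N has_derivative dfield N q) (at q)" if "q \<in> W" for q
    by (rule smooth_field_has_derivative[OF W(1) N(1) that])
  have lin: "linear (dfield N q)" if "q \<in> W" for q
    using dN[OF that] by (rule has_derivative_linear)
  have tan: "tangent_space \<Sigma> q = {v. N q \<bullet> v = 0}" if "q \<in> W \<inter> \<Sigma>" for q
    using level_set_tangent_space[OF W(1) \<phi>(1) _ \<phi>(2) \<Sigma>] N(3) that by simp
  have proj: "N q \<bullet> (v - (N q \<bullet> v) *\<^sub>R N q) = 0" if "q \<in> W" for q v
    using N(2)[OF that] by (simp add: inner_diff_right)
  \<comment> \<open>The trace of \<open>shape\<close>, with the basis vectors split into tangential and normal parts.\<close>
  have V\<kappa>: "V q * \<kappa> q = N q \<bullet> grad V q" if q: "q \<in> W \<inter> \<Sigma>" for q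
  proof -
    have qW: "q \<in> W" using q by blast
    let ?D = "dfield N q"
    define \<mu> where "\<mu> = N q \<bullet> grad V q"
    have comp: "V q * ?D (axis k 1) $ k = \<mu> * (1 - N q $ k * N q $ k) + V q * (N q $ k * ?D (N q) $ k)" for k
    proof -
      have e: "N q \<bullet> axis k 1 = N q $ k" by (simp add: inner_axis)
      have "V q *\<^sub>R ?D (axis k 1 - N q $ k *\<^sub>R N q) = \<mu> *\<^sub>R (axis k 1 - N q $ k *\<^sub>R N q)"
        using shape[OF q proj[OF qW, of "axis k 1"]] by (simp add: e \<mu>_def)
      then have "V q *\<^sub>R ?D (axis k 1) = \<mu> *\<^sub>R (axis k 1 - N q $ k *\<^sub>R N q) + (V q * N q $ k) *\<^sub>R ?D (N q)"
        by (simp add: linear_diff[OF lin[OF qW]] linear_scale[OF lin[OF qW]] scaleR_diff_right diff_eq_eq)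
      from arg_cong[OF this, of "\<lambda>x. x $ k"] show ?thesis
        by (simp add: axis_def)
    qed
    have "V q * \<kappa> q * (real CARD('n) - 1) = (\<Sum>k\<in>UNIV. V q * ?D (axis k 1) $ k)"
      using n1 by (simp add: \<kappa>_def dfield_def inner_axis sum_distrib_left)
    also have "\<dots> = \<mu> * (real CARD('n) - N q \<bullet> N q) + V q * (N q \<bullet> ?D (N q))"
      unfolding comp sum.distrib sum_distrib_left[symmetric] sum_subtractf by (simp add: inner_vec_def)
    also have "\<dots> = \<mu> * (real CARD('n) - 1)"
      using N(2)[OF qW] unit_field_derivative_orthogonal[OF W(1) N(1) qW N(2)] by simp
    finally show ?thesis using n1 by (simp add: \<mu>_def)
  qed
  \<comment> \<open>Continuous functions vanish on the hypersurface if they do so off the zeros of \<open>V\<close>: near a zero, the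
      curve with velocity \<open>grad V\<close> runs through points where \<open>V\<close> is positive.\<close>
  have dense: "F q = 0" if q: "q \<in> W \<inter> \<Sigma>" and F: "continuous_on W F"
    and VF: "\<And>q. q \<in> W \<inter> \<Sigma> \<Longrightarrow> V q * F q = 0" for q and F :: "real ^ 'n \<Rightarrow> real"
  proof (cases "V q = 0")
    case False
    then show ?thesis using VF[OF q] by simp
  next
    case True
    have g0: "grad V q \<noteq> 0"
    proof
      assume g: "grad V q = 0"
      have "((2 * A) *\<^sub>R q + b) $ d = 0"
        using g unfolding gV by simp
      moreover have "q $ d > 0"
        using q W(2) by (auto simp: hyp_space_iff)
      ultimately have "A = 0" using b by simp
      moreover then have "b = 0" using g by (simp add: gV)
      ultimately have "c = 0" using True V by simp
      then show False using nz \<open>A = 0\<close> \<open>b = 0\<close> by blast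
    qed
    have "grad V q \<in> tangent_space \<Sigma> q"
      using V\<kappa>[OF q] True tan[OF q] by simp
    then obtain \<gamma> where \<gamma>: "range \<gamma> \<subseteq> \<Sigma>" "\<gamma> 0 = q" "(\<gamma> has_vector_derivative grad V q) (at (0::real))"
      by (auto simp: tangent_space_def)
    have lim: "(\<gamma> \<longlongrightarrow> q) (at_right 0)"
      using has_vector_derivative_continuous[OF \<gamma>(3)] \<gamma>(2)
      by (metis continuous_within tendsto_within_subset subset_UNIV)
    have "((\<lambda>t. V (\<gamma> t)) has_real_derivative (grad V q \<bullet> grad V q)) (at 0)"
      by (rule has_derivative_imp_has_field_derivative[OF has_derivative_compose[OF
            \<gamma>(3)[unfolded has_vector_derivative_def]]]) (use dV \<gamma>(2) in auto)
    then have "\<forall>\<^sub>F t in at_right 0. V (\<gamma> t) > 0"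
      using DERIV_pos_inc_right[of "\<lambda>t. V (\<gamma> t)" _ 0] g0 True \<gamma>(2)
      by (auto simp: eventually_at_right_field)
    moreover have "\<forall>\<^sub>F t in at_right 0. \<gamma> t \<in> W"
      using topological_tendstoD[OF lim W(1)] q by blast
    ultimately have "\<forall>\<^sub>F t in at_right 0. F (\<gamma> t) = 0"
    proof eventually_elim
      case (elim t)
      then show ?case using VF[of "\<gamma> t"] \<gamma>(1) by auto
    qed
    then have "((\<lambda>t. F (\<gamma> t)) \<longlongrightarrow> 0) (at_right 0)"
      by (rule tendsto_eventually)
    moreover have "isCont F q"
      using F W(1) q continuous_on_eq_continuous_at by blast
    then have "((\<lambda>t. F (\<gamma> t)) \<longlongrightarrow> F q) (at_right 0)"
      using lim isCont_tendsto_compose by blast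
    ultimately show ?thesis
      using tendsto_unique[OF trivial_limit_at_right_real] by blast
  qed
  have contN: "continuous_on W N"
    using dN W(1) by (meson continuous_at_imp_continuous_on has_derivative_continuous)
  have umb: "dfield N q X = \<kappa> q *\<^sub>R X" if q: "q \<in> W \<inter> \<Sigma>" and X: "N q \<bullet> X = 0" for q X
  proof -
    have "dfield N q X $ k - \<kappa> q * X $ k = 0" for k
    proof -
      \<comment> \<open>Density needs an identity at all points of the hypersurface: \<open>X\<close> is projected to each tangent space.\<close>
      define P where "P q = X - (N q \<bullet> X) *\<^sub>R N q" for q
      have "dfield N q (P q) $ k - \<kappa> q * P q $ k = 0"
      proof (rule dense[OF q])
        show "continuous_on W (\<lambda>q. dfield N q (P q) $ k - \<kappa> q * P q $ k)"
          unfolding dfield_def P_def vec_lambda_beta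
          by (intro continuous_intros smooth_on_continuous_grad[OF W(1)] smooth_on_continuous[OF W(1)] smN sm\<kappa> contN)
        show "V q * (dfield N q (P q) $ k - \<kappa> q * P q $ k) = 0" if "q \<in> W \<inter> \<Sigma>" for q
        proof -
          have "V q *\<^sub>R dfield N q (P q) = (N q \<bullet> grad V q) *\<^sub>R P q"
            using shape[OF that] proj that by (auto simp: P_def)
          from arg_cong[OF this, of "\<lambda>x. x $ k"] show ?thesis
            using V\<kappa>[OF that] by (simp add: algebra_simps)
        qed
      qed
      moreover have "P q = X" by (simp add: P_def X)
      ultimately show ?thesis by simp
    qed
    then show ?thesis by (simp add: vec_eq_iff)
  qed
  have Vgrad: "V q * (grad \<kappa> q \<bullet> X) = 0" if q: "q \<in> W \<inter> \<Sigma>" and X: "N q \<bullet> X = 0" for q X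
  proof -
    have qW: "q \<in> W" using q by blast
    have dG: "((\<lambda>q. V q * \<kappa> q - N q \<bullet> ((2 * A) *\<^sub>R q + b)) has_derivative
        (\<lambda>h. (V q * (grad \<kappa> q \<bullet> h) + (grad V q \<bullet> h) * \<kappa> q)
          - (N q \<bullet> ((2 * A) *\<^sub>R h) + dfield N q h \<bullet> ((2 * A) *\<^sub>R q + b)))) (at q)"
      by (rule derivative_eq_intros dV d\<kappa>[OF qW] dN[OF qW] refl)+ simp
    have "grad (\<lambda>q. V q * \<kappa> q - N q \<bullet> ((2 * A) *\<^sub>R q + b)) q \<bullet> X = 0"
      by (rule tangent_space_imp_grad_orthogonal[OF W(1) qW, where T = \<Sigma>])
        (use dG V\<kappa> tan[OF q] X in \<open>auto simp: differentiable_def gV\<close>)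
    moreover have "grad (\<lambda>q. V q * \<kappa> q - N q \<bullet> ((2 * A) *\<^sub>R q + b)) q \<bullet> X
        = (V q * (grad \<kappa> q \<bullet> X) + (grad V q \<bullet> X) * \<kappa> q)
          - (N q \<bullet> ((2 * A) *\<^sub>R X) + dfield N q X \<bullet> ((2 * A) *\<^sub>R q + b))"
    proof -
      have "(\<lambda>q. V q * \<kappa> q - N q \<bullet> ((2 * A) *\<^sub>R q + b)) differentiable (at q)"
        using dG unfolding differentiable_def by blast
      from fun_cong[OF has_derivative_unique[OF has_derivative_grad[OF this] dG], of X] show ?thesis .
    qed
    ultimately show ?thesis
      using X by (simp add: umb[OF q X] gV inner_commute algebra_simps)
  qed
  have grad\<kappa>: "grad \<kappa> q \<bullet> X = 0" if q: "q \<in> W \<inter> \<Sigma>" and X: "N q \<bullet> X = 0" for q X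
  proof -
    have "grad \<kappa> q \<bullet> (X - (N q \<bullet> X) *\<^sub>R N q) = 0"
    proof (rule dense[OF q])
      show "continuous_on W (\<lambda>q. grad \<kappa> q \<bullet> (X - (N q \<bullet> X) *\<^sub>R N q))"
        by (intro continuous_intros smooth_on_continuous_grad[OF W(1)] sm\<kappa> contN)
    qed (use Vgrad proj in blast)
    then show ?thesis by (simp add: X)
  qed
  have pW: "p \<in> W" "p \<in> \<Sigma>" using p by auto
  obtain W1 where W1: "open W1" "p \<in> W1" "\<And>q. q \<in> W1 \<inter> \<Sigma> \<Longrightarrow> \<kappa> q = \<kappa> p"
  proof (rule level_set_locally_constant[OF W(1) \<phi>(1) pW(1) \<phi>(2)[OF pW(1)] \<Sigma> pW(2)])
    show "(\<kappa> has_derivative (\<lambda>h. grad \<kappa> q \<bullet> h)) (at q)" if "q \<in> W \<inter> \<Sigma>" for q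
      using d\<kappa> that by blast
    show "grad \<kappa> q \<bullet> X = 0" if "q \<in> W \<inter> \<Sigma>" "grad \<phi> q \<bullet> X = 0" for q X
      using grad\<kappa> N(3) that by blast
  qed blast
  have dm: "((\<lambda>q. N q - \<kappa> q *\<^sub>R q) has_derivative
      (\<lambda>h. dfield N q h - (\<kappa> q *\<^sub>R h + (grad \<kappa> q \<bullet> h) *\<^sub>R q))) (at q)" if "q \<in> W \<inter> \<Sigma>" for q
    using that by (intro has_derivative_diff has_derivative_scaleR dN d\<kappa> has_derivative_ident) auto
  have dm0: "dfield N q X - (\<kappa> q *\<^sub>R X + (grad \<kappa> q \<bullet> X) *\<^sub>R q) = 0"
    if "q \<in> W \<inter> \<Sigma>" "grad \<phi> q \<bullet> X = 0" for q X
    using umb[OF that(1)] grad\<kappa>[OF that(1)] N(3) that by auto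
  obtain W2 where W2: "open W2" "p \<in> W2" "\<And>q. q \<in> W2 \<inter> \<Sigma> \<Longrightarrow> N q - \<kappa> q *\<^sub>R q = N p - \<kappa> p *\<^sub>R p"
    by (rule level_set_locally_constant[OF W(1) \<phi>(1) pW(1) \<phi>(2)[OF pW(1)] \<Sigma> pW(2) dm dm0]) blast+
  show ?thesis
  proof (rule that[of "W1 \<inter> W2" "\<kappa> p" "N p - \<kappa> p *\<^sub>R p"])
    show "N q = \<kappa> p *\<^sub>R q + (N p - \<kappa> p *\<^sub>R p)" if "q \<in> W1 \<inter> W2 \<inter> \<Sigma>" for q
      using W1(3)[of q] W2(3)[of q] that by (simp add: algebra_simps)
  qed (use W1 W2 in auto)
qed

text \<open>
  Testing the boundary condition with the tangential projections of constant fields gives the component of the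
  identity along every tangent vector; its normal component vanishes as \<open>N\<close> has constant length.
\<close>

lemma static_boundary_shape:
  fixes d :: "'n::finite" and N :: "real ^ 'n \<Rightarrow> real ^ 'n"
  assumes W: "open W" "W \<subseteq> hyp_space d" "q \<in> W \<inter> \<Sigma>"
    and N: "smooth_field_on W N" "\<And>q. q \<in> W \<Longrightarrow> N q \<bullet> N q = 1"
    and tan: "\<And>q. q \<in> W \<inter> \<Sigma> \<Longrightarrow> tangent_space \<Sigma> q = {X. N q \<bullet> X = 0}"
    and \<nu>: "outward_unit_normal (hyp_metric d) \<Omega> \<Sigma> q (q $ d *\<^sub>R N q)"
    and V: "V differentiable (at q)" and u: "\<And>x. x \<in> insert q \<Omega> \<Longrightarrow> u x = V x / x $ d"
    and bc: "\<And>\<nu> X W Y. outward_unit_normal (hyp_metric d) \<Omega> \<Sigma> q \<nu> \<Longrightarrow> X \<in> tangent_space \<Sigma> q \<Longrightarrow>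
        open W \<Longrightarrow> q \<in> W \<Longrightarrow> smooth_field_on W Y \<Longrightarrow> (\<And>x. x \<in> W \<inter> \<Sigma> \<Longrightarrow> Y x \<in> tangent_space \<Sigma> x) \<Longrightarrow>
        normal_deriv u \<nu> q * metric_inner (hyp_metric d) q X (Y q)
          = u q * second_fund_form (hyp_metric d) \<nu> X Y q"
    and X: "N q \<bullet> X = 0"
  shows "V q *\<^sub>R dfield N q X = (N q \<bullet> grad V q) *\<^sub>R X"
proof -
  \<comment> \<open>Test fields: tangential projections of constant vectors.\<close>
  define P where "P v x = v - (N x \<bullet> v) *\<^sub>R N x" for v x
  have NP: "N x \<bullet> P v x = 0" if "x \<in> W" for v x
    using N(2)[OF that] by (simp add: P_def inner_diff_right)
  have smP: "smooth_field_on W (P v)" for v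
    using N(1) unfolding smooth_field_on_def P_def
    by (auto intro!: smooth_on_diff smooth_on_mult smooth_on_inner W)
  have qW: "q \<in> W" "q \<in> \<Sigma>" using W(3) by auto
  have Xtan: "X \<in> tangent_space \<Sigma> q" using tan[OF W(3)] X by simp
  have test: "(N q \<bullet> grad V q) * (X \<bullet> P v q) = V q * (P v q \<bullet> dfield N q X)" for v
  proof -
    have "normal_deriv u (q $ d *\<^sub>R N q) q * metric_inner (hyp_metric d) q X (P v q)
          = u q * second_fund_form (hyp_metric d) (q $ d *\<^sub>R N q) X (P v) q"
      by (rule bc[OF \<nu> Xtan W(1) qW(1) smP]) (use tan NP in auto)
    moreover have "q \<in> hyp_space d" using qW W(2) by blast
    moreover have "P v x \<bullet> N x = 0" if "x \<in> W \<inter> \<Sigma>" for x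
      using NP that by (simp add: inner_commute)
    ultimately show ?thesis
      using boundary_condition_iff[of q d \<Omega> \<Sigma> N V u W "P v" X] \<nu> V u W(1) qW N(1) smP Xtan X by blast
  qed
  define Z where "Z = V q *\<^sub>R dfield N q X - (N q \<bullet> grad V q) *\<^sub>R X"
  have "N q \<bullet> Z = 0"
    using X unit_field_derivative_orthogonal[OF W(1) N(1) qW(1) N(2)] by (simp add: Z_def inner_diff_right)
  then have PZ: "P Z q = Z" by (simp add: P_def)
  have "Z \<bullet> Z = V q * (Z \<bullet> dfield N q X) - (N q \<bullet> grad V q) * (X \<bullet> Z)"
    by (subst (2) Z_def) (simp add: inner_diff_right inner_commute)
  then have "Z \<bullet> Z = 0"
    using test[of Z] unfolding PZ by simp
  then show ?thesis by (simp add: Z_def)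
qed

text \<open>
  Smoothness of the normalization rests on that of \<open>|grad \<phi>|\<^sup>2\<close> to the power \<open>- 1 / 2\<close>.
\<close>

lemma smooth_unit_normal:
  fixes \<phi> :: "real ^ 'n::finite \<Rightarrow> real"
  assumes W: "open W" and \<phi>: "smooth_on W \<phi>" "\<And>q. q \<in> W \<Longrightarrow> grad \<phi> q \<noteq> 0"
  shows "smooth_field_on W (\<lambda>q. grad \<phi> q /\<^sub>R norm (grad \<phi> q))"
  unfolding smooth_field_on_def
proof
  fix k
  have "smooth_on W (\<lambda>q. (grad \<phi> q \<bullet> grad \<phi> q) powr (- 1 / 2) * partial k \<phi> q)"
    using \<phi> by (intro smooth_on_mult smooth_on_powr smooth_on_inner smooth_on_partial W)
      (auto simp: smooth_on_partial)
  then show "smooth_on W (\<lambda>q. (grad \<phi> q /\<^sub>R norm (grad \<phi> q)) $ k)"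
  proof (rule smooth_on_cong[OF W, rotated])
    fix q assume "q \<in> W"
    then have "norm (grad \<phi> q) > 0" using \<phi>(2) by simp
    then show "(grad \<phi> q \<bullet> grad \<phi> q) powr (- 1 / 2) * partial k \<phi> q = (grad \<phi> q /\<^sub>R norm (grad \<phi> q)) $ k"
      by (simp add: powr_minus powr_half_sqrt norm_eq_sqrt_inner)
  qed
qed

text \<open>
  The local statements fit together because the outward normal \<open>E\<close> does not depend on the defining function, and
  the coefficients of an affine formula for \<open>E\<close> are unique, hence locally constant in the point. In the
  conclusion, local defining functions express that \<open>\<kappa> q + m\<close> is a unit normal of \<open>\<Sigma>\<close>.
\<close>

lemma static_boundary_normal_affine:
  fixes d :: "'n::finite"
  assumes n: "CARD('n) \<ge> 2" and dom: "domain_in (hyp_metric d) (hyp_space d) \<Omega> \<Sigma>"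
    and con: "connected \<Sigma>" and ng: "non_generic (hyp_metric d) \<Omega> \<Sigma>"
  obtains \<kappa> m where
    "\<And>p. p \<in> \<Sigma> \<Longrightarrow> \<exists>W \<phi>. open W \<and> p \<in> W \<and> smooth_on W \<phi> \<and> grad \<phi> p \<noteq> 0 \<and>
      W \<inter> \<Sigma> = {q \<in> W. \<phi> q = 0} \<and>
      (\<forall>q\<in>W \<inter> \<Sigma>. norm (\<kappa> *\<^sub>R q + m) = 1 \<and> (\<forall>X. grad \<phi> q \<bullet> X = 0 \<longrightarrow> (\<kappa> *\<^sub>R q + m) \<bullet> X = 0))"
proof -
  have \<Omega>: "\<Omega> \<subseteq> hyp_space d" "open \<Omega>" "connected \<Omega>" and \<Sigma>: "\<Sigma> = hyp_space d \<inter> frontier \<Omega>" "\<Sigma> \<noteq> {}"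
    and chart: "\<And>p. p \<in> \<Sigma> \<Longrightarrow> \<exists>W \<phi>. open W \<and> p \<in> W \<and> W \<subseteq> hyp_space d \<and> smooth_on W \<phi> \<and>
        (\<forall>q\<in>W. \<exists>i. partial i \<phi> q \<noteq> 0) \<and>
        W \<inter> \<Omega> = {q \<in> W. \<phi> q < 0} \<and> W \<inter> \<Sigma> = {q \<in> W. \<phi> q = 0}"
    using dom unfolding domain_in_def by blast+
  obtain u where u: "smooth_upto (\<Omega> \<union> \<Sigma>) u" "\<exists>p\<in>\<Omega> \<union> \<Sigma>. u p \<noteq> 0"
      "\<forall>p\<in>\<Omega>. Lstar (hyp_metric d) u p = 0"
    and bc: "\<forall>p\<in>\<Sigma>. \<forall>\<nu> X W Y.
           outward_unit_normal (hyp_metric d) \<Omega> \<Sigma> p \<nu> \<and> X \<in> tangent_space \<Sigma> p \<and>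
           open W \<and> p \<in> W \<and> smooth_field_on W Y \<and> (\<forall>q\<in>W \<inter> \<Sigma>. Y q \<in> tangent_space \<Sigma> q)
           \<longrightarrow> normal_deriv u \<nu> p * metric_inner (hyp_metric d) p X (Y p)
               = u p * second_fund_form (hyp_metric d) \<nu> X Y p"
    using ng unfolding non_generic_def by (elim exE conjE) (rule that)
  obtain A b c where b: "b $ d = 0"
    and uV: "\<And>q. q \<in> \<Omega> \<union> \<Sigma> \<Longrightarrow> u q = (A * (q \<bullet> q) + b \<bullet> q + c) / q $ d"
    by (rule static_potential_quadratic[OF n \<Omega>(2,3,1) \<Sigma>(1) u(1) u(3)[rule_format]]) blast+
  define V where "V q = A * (q \<bullet> q) + b \<bullet> q + c" for q
  have nz: "\<not> (A = 0 \<and> b = 0 \<and> c = 0)"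
    using u(2) uV by auto
  define E where "E q = (SOME e. outward_unit_normal (hyp_metric d) \<Omega> \<Sigma> q (q $ d *\<^sub>R e))" for q
  have loc: "\<exists>W \<phi>. open W \<and> p \<in> W \<and> smooth_on W \<phi> \<and> (\<forall>q\<in>W. grad \<phi> q \<noteq> 0) \<and>
      W \<inter> \<Sigma> = {q \<in> W. \<phi> q = 0} \<and> (\<forall>q\<in>W \<inter> \<Sigma>. E q = grad \<phi> q /\<^sub>R norm (grad \<phi> q)) \<and>
      (\<exists>W' \<kappa> m. open W' \<and> p \<in> W' \<and> (\<forall>q\<in>W' \<inter> \<Sigma>. E q = \<kappa> *\<^sub>R q + m))" if p: "p \<in> \<Sigma>" for p
  proof -
    obtain W \<phi> where W: "open W" "p \<in> W" "W \<subseteq> hyp_space d" and \<phi>: "smooth_on W \<phi>"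
      and ex: "\<forall>q\<in>W. \<exists>i. partial i \<phi> q \<noteq> 0"
      and W\<Omega>: "W \<inter> \<Omega> = {q \<in> W. \<phi> q < 0}" and W\<Sigma>: "W \<inter> \<Sigma> = {q \<in> W. \<phi> q = 0}"
      using chart[OF p] by blast
    have g0: "grad \<phi> q \<noteq> 0" if "q \<in> W" for q
      using ex that by (auto simp: vec_eq_iff)
    define N where "N q = grad \<phi> q /\<^sub>R norm (grad \<phi> q)" for q
    have smN: "smooth_field_on W N"
      unfolding N_def by (rule smooth_unit_normal[OF W(1) \<phi> g0])
    have N1: "N q \<bullet> N q = 1" if "q \<in> W" for q
      using g0[OF that] by (simp add: N_def dot_square_norm power2_eq_square)
    have N0: "N q \<bullet> X = 0 \<longleftrightarrow> grad \<phi> q \<bullet> X = 0" if "q \<in> W" for q X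
      using g0[OF that] by (simp add: N_def)
    have normal: "outward_unit_normal (hyp_metric d) \<Omega> \<Sigma> q \<nu> \<longleftrightarrow> \<nu> = q $ d *\<^sub>R N q"
      if "q \<in> W \<inter> \<Sigma>" for q \<nu>
      using outward_unit_normal_hyp_iff[OF W(1) \<phi> _ g0 _ W\<Omega> W\<Sigma>] that W(3) by (auto simp: N_def)
    have tan: "tangent_space \<Sigma> q = {X. N q \<bullet> X = 0}" if "q \<in> W \<inter> \<Sigma>" for q
      using level_set_tangent_space[OF W(1) \<phi> _ g0 W\<Sigma>] N0 that by simp
    have EN: "E q = N q" if "q \<in> W \<inter> \<Sigma>" for q
    proof -
      have "outward_unit_normal (hyp_metric d) \<Omega> \<Sigma> q (q $ d *\<^sub>R E q)"
        unfolding E_def by (rule someI[of _ "N q"]) (use normal[OF that] in simp)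
      then have "q $ d *\<^sub>R E q = q $ d *\<^sub>R N q"
        using normal[OF that] by blast
      moreover have "q $ d \<noteq> 0"
        using that W(3) by (auto simp: hyp_space_iff)
      ultimately show ?thesis by simp
    qed
    have shape: "V q *\<^sub>R dfield N q X = (N q \<bullet> grad V q) *\<^sub>R X"
      if q: "q \<in> W \<inter> \<Sigma>" and X: "N q \<bullet> X = 0" for q X
    proof (rule static_boundary_shape[OF W(1,3) q smN N1 tan _ _ _ _ X])
      show "outward_unit_normal (hyp_metric d) \<Omega> \<Sigma> q (q $ d *\<^sub>R N q)"
        using normal[OF q] by blast
      show "V differentiable (at q)"
        unfolding V_def differentiable_def using has_derivative_quadratic by blast
      show "u x = V x / x $ d" if "x \<in> insert q \<Omega>" for x
        using uV[of x] q that by (auto simp: V_def)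
      show "normal_deriv u \<nu> q * metric_inner (hyp_metric d) q X (Y q)
          = u q * second_fund_form (hyp_metric d) \<nu> X Y q"
        if "outward_unit_normal (hyp_metric d) \<Omega> \<Sigma> q \<nu>" "X \<in> tangent_space \<Sigma> q"
          "open W" "q \<in> W" "smooth_field_on W Y" "\<And>x. x \<in> W \<inter> \<Sigma> \<Longrightarrow> Y x \<in> tangent_space \<Sigma> x" for \<nu> X W Y
        using bc[rule_format, of q \<nu> X W Y] q that by blast
    qed
    obtain W' \<kappa> m where "open W'" "p \<in> W'" "\<And>q. q \<in> W' \<inter> \<Sigma> \<Longrightarrow> N q = \<kappa> *\<^sub>R q + m"
      by (rule static_boundary_normal_affine_locally[OF n W(1,3) \<phi> g0 W\<Sigma> smN N1 N0 b nz V_def shape])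
        (use W(2) p in auto)
    then have "open (W \<inter> W') \<and> p \<in> W \<inter> W' \<and> (\<forall>q\<in>W \<inter> W' \<inter> \<Sigma>. E q = \<kappa> *\<^sub>R q + m)"
      using W EN by auto
    then show ?thesis
      using W \<phi> g0 W\<Sigma> EN unfolding N_def by blast
  qed
  \<comment> \<open>The coefficients are determined by \<open>E\<close> near a point, since the point is not isolated in \<open>\<Sigma>\<close>.\<close>
  define R where "R p r \<longleftrightarrow> (\<exists>W'. open W' \<and> p \<in> W' \<and> (\<forall>q\<in>W' \<inter> \<Sigma>. E q = fst r *\<^sub>R q + snd r))"
    for p and r :: "real \<times> (real ^ 'n)"
  have ex: "\<exists>r. R p r" if "p \<in> \<Sigma>" for p
    using loc[OF that] unfolding R_def by (metis fst_conv snd_conv)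
  have uniq: "r = r'" if p: "p \<in> \<Sigma>" and r: "R p r" "R p r'" for p r r'
  proof -
    obtain W1 W2 where W: "open W1" "p \<in> W1" "open W2" "p \<in> W2"
      and E1: "\<And>q. q \<in> W1 \<inter> \<Sigma> \<Longrightarrow> E q = fst r *\<^sub>R q + snd r"
      and E2: "\<And>q. q \<in> W2 \<inter> \<Sigma> \<Longrightarrow> E q = fst r' *\<^sub>R q + snd r'"
      using r unfolding R_def by blast
    obtain Z \<phi> where Z: "open Z" "p \<in> Z" "smooth_on Z \<phi>" "grad \<phi> p \<noteq> 0" "Z \<inter> \<Sigma> = {q \<in> Z. \<phi> q = 0}"
      using loc[OF p] by blast
    obtain X where X: "grad \<phi> p \<bullet> X = 0" "X \<noteq> 0"
      using exists_orthogonal[OF n] by blast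
    have "X \<in> tangent_space \<Sigma> p"
      using level_set_tangent_space[OF Z(1,3,2,4,5) p] X by simp
    then obtain \<gamma> where \<gamma>: "range \<gamma> \<subseteq> \<Sigma>" "\<gamma> 0 = p" "(\<gamma> has_vector_derivative X) (at (0::real))"
      by (auto simp: tangent_space_def)
    have "\<exists>q\<in>W1 \<inter> W2 \<inter> \<Sigma>. q \<noteq> p"
    proof (rule ccontr)
      assume "\<not> (\<exists>q\<in>W1 \<inter> W2 \<inter> \<Sigma>. q \<noteq> p)"
      then have *: "\<And>q. q \<in> W1 \<inter> W2 \<Longrightarrow> q \<in> \<Sigma> \<Longrightarrow> q = p" by blast
      have "(\<gamma> \<longlongrightarrow> p) (at 0)"
        using has_vector_derivative_continuous[OF \<gamma>(3)] \<gamma>(2) by (simp add: isCont_def)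
      then have "\<forall>\<^sub>F t in at 0. \<gamma> t \<in> W1 \<inter> W2"
        using W by (intro topological_tendstoD) auto
      then have "\<forall>\<^sub>F t in at 0. p = \<gamma> t"
        by eventually_elim (use * \<gamma>(1) in force)
      then have "(\<gamma> has_derivative (\<lambda>_. 0)) (at 0)"
        using \<gamma>(2) by (intro has_derivative_transform_eventually[OF has_derivative_const]) auto
      from has_derivative_unique[OF this \<gamma>(3)[unfolded has_vector_derivative_def]]
      have "(\<lambda>_. 0) = (\<lambda>t. t *\<^sub>R X)" .
      from fun_cong[OF this, of 1] show False using X(2) by simp
    qed
    then obtain q where q: "q \<in> W1 \<inter> \<Sigma>" "q \<in> W2 \<inter> \<Sigma>" "q \<noteq> p" by blast
    have e: "fst r *\<^sub>R q + snd r = fst r' *\<^sub>R q + snd r'" "fst r *\<^sub>R p + snd r = fst r' *\<^sub>R p + snd r'"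
      using E1 E2 q W p by (metis IntI)+
    have "(fst r - fst r') *\<^sub>R (q - p) = (fst r *\<^sub>R q + snd r) - (fst r' *\<^sub>R q + snd r')
        - ((fst r *\<^sub>R p + snd r) - (fst r' *\<^sub>R p + snd r'))"
      by (simp add: algebra_simps)
    then have "fst r = fst r'" using e q(3) by simp
    then show "r = r'" using e(1) by (simp add: prod_eq_iff)
  qed
  define r where "r p = (SOME r. R p r)" for p
  have Rr: "R p (r p)" if "p \<in> \<Sigma>" for p
    unfolding r_def using ex[OF that] by (rule someI_ex)
  have "r constant_on \<Sigma>"
  proof (rule locally_constant_imp_constant[OF con])
    fix p assume p: "p \<in> \<Sigma>"
    obtain W where W: "open W" "p \<in> W" "\<forall>q\<in>W \<inter> \<Sigma>. E q = fst (r p) *\<^sub>R q + snd (r p)"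
      using Rr[OF p] unfolding R_def by blast
    have rW: "r q = r p" if "q \<in> \<Sigma> \<inter> W" for q
    proof (rule uniq)
      show "R q (r p)" using W that unfolding R_def by blast
    qed (use that Rr in auto)
    show "\<exists>T. openin (top_of_set \<Sigma>) T \<and> p \<in> T \<and> (\<forall>x\<in>T. r x = r p)"
      by (rule exI[of _ "\<Sigma> \<inter> W"]) (use W(2) p openin_open_Int[OF W(1)] rW in blast)
  qed
  then obtain r0 where r0: "\<And>p. p \<in> \<Sigma> \<Longrightarrow> r p = r0"
    unfolding constant_on_def by blast
  have E: "E p = fst r0 *\<^sub>R p + snd r0" if "p \<in> \<Sigma>" for p
    using Rr[OF that] r0[OF that] that unfolding R_def by auto
  show ?thesis
  proof (rule that[of "fst r0" "snd r0"])
    fix p assume p: "p \<in> \<Sigma>"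
    obtain W \<phi> where W: "open W" "p \<in> W" "smooth_on W \<phi>" "\<forall>q\<in>W. grad \<phi> q \<noteq> 0"
        "W \<inter> \<Sigma> = {q \<in> W. \<phi> q = 0}" "\<forall>q\<in>W \<inter> \<Sigma>. E q = grad \<phi> q /\<^sub>R norm (grad \<phi> q)"
      using loc[OF p] by blast
    have "norm (fst r0 *\<^sub>R q + snd r0) = 1 \<and> (\<forall>X. grad \<phi> q \<bullet> X = 0 \<longrightarrow> (fst r0 *\<^sub>R q + snd r0) \<bullet> X = 0)"
      if q: "q \<in> W \<inter> \<Sigma>" for q
    proof -
      have "fst r0 *\<^sub>R q + snd r0 = grad \<phi> q /\<^sub>R norm (grad \<phi> q)"
        using E[of q] W(6) q by auto
      moreover have "grad \<phi> q \<noteq> 0" using W(4) q by blast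
      ultimately show ?thesis by simp
    qed
    then show "\<exists>W \<phi>. open W \<and> p \<in> W \<and> smooth_on W \<phi> \<and> grad \<phi> p \<noteq> 0 \<and> W \<inter> \<Sigma> = {q \<in> W. \<phi> q = 0} \<and>
      (\<forall>q\<in>W \<inter> \<Sigma>. norm (fst r0 *\<^sub>R q + snd r0) = 1 \<and>
        (\<forall>X. grad \<phi> q \<bullet> X = 0 \<longrightarrow> (fst r0 *\<^sub>R q + snd r0) \<bullet> X = 0))"
      using W by blast
  qed
qed

text \<open>
  \<open>\<Sigma>\<close> is closed in \<open>S \<inter> H\<close>, and it is open there as one hypersurface contained in another.
\<close>

lemma boundary_fills_level_set:
  fixes \<Sigma> :: "(real ^ 'n::finite) set"
  assumes chart: "\<And>p. p \<in> \<Sigma> \<Longrightarrow> \<exists>W \<phi>. open W \<and> p \<in> W \<and> smooth_on W \<phi> \<and> grad \<phi> p \<noteq> 0 \<and>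
      W \<inter> \<Sigma> = {q \<in> W. \<phi> q = 0}"
    and \<Sigma>: "\<Sigma> = H \<inter> C" "closed C" "\<Sigma> \<noteq> {}"
    and \<psi>: "smooth_on UNIV \<psi>" "\<And>p. p \<in> \<Sigma> \<Longrightarrow> grad \<psi> p \<noteq> 0" and S: "S = {q. \<psi> q = 0}"
    and sub: "\<Sigma> \<subseteq> S" and con: "connected (S \<inter> H)"
  shows "\<Sigma> = S \<inter> H"
proof -
  have "\<exists>W'. open W' \<and> p \<in> W' \<and> W' \<inter> S \<subseteq> \<Sigma>" if p: "p \<in> \<Sigma>" for p
  proof -
    obtain W \<phi> where W: "open W" "p \<in> W" "smooth_on W \<phi>" "grad \<phi> p \<noteq> 0" "W \<inter> \<Sigma> = {q \<in> W. \<phi> q = 0}"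
      using chart[OF p] by blast
    have S': "UNIV \<inter> S = {q \<in> UNIV. \<psi> q = 0}" by (simp add: S)
    obtain W' where "open W'" "p \<in> W'" "W' \<inter> S \<subseteq> \<Sigma>"
      by (rule level_set_subset_imp_open[OF W(1,3,2,4,5) p open_UNIV \<psi>(1) UNIV_I \<psi>(2)[OF p] S' sub])
    then show ?thesis by blast
  qed
  then obtain G where G: "\<And>p. p \<in> \<Sigma> \<Longrightarrow> open (G p) \<and> p \<in> G p \<and> G p \<inter> S \<subseteq> \<Sigma>"
    by metis
  have "open (\<Union>p\<in>\<Sigma>. G p)" using G by blast
  moreover have "\<Sigma> = (S \<inter> H) \<inter> (\<Union>p\<in>\<Sigma>. G p)"
    using G sub \<Sigma>(1) by blast
  ultimately have "openin (top_of_set (S \<inter> H)) \<Sigma>"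
    unfolding openin_open by blast
  moreover have "\<Sigma> = (S \<inter> H) \<inter> C" using \<Sigma>(1) sub by blast
  then have "closedin (top_of_set (S \<inter> H)) \<Sigma>"
    unfolding closedin_closed using \<Sigma>(2) by blast
  ultimately show ?thesis
    using con \<Sigma>(3) unfolding connected_clopen by blast
qed

text \<open>
  For \<open>\<kappa> \<noteq> 0\<close>, the equation \<open>|\<kappa> q + m| = 1\<close> is that of a sphere. For \<open>\<kappa> = 0\<close>, the constant \<open>m\<close> is normal to
  \<open>\<Sigma>\<close>, so \<open>m \<bullet> q\<close> is constant on \<open>\<Sigma>\<close>.
\<close>

lemma static_boundary_sphere_or_hyperplane:
  fixes d :: "'n::finite"
  assumes n: "CARD('n) \<ge> 2" and dom: "domain_in (hyp_metric d) (hyp_space d) \<Omega> \<Sigma>"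
    and simple: "simple_domain \<Sigma>" and ng: "non_generic (hyp_metric d) \<Omega> \<Sigma>"
  shows "(\<exists>a r. r > 0 \<and> \<Sigma> = sphere a r \<inter> hyp_space d) \<or> (\<exists>a b. a \<noteq> 0 \<and> \<Sigma> = {y. a \<bullet> y = b} \<inter> hyp_space d)"
proof -
  have \<Sigma>: "\<Sigma> = hyp_space d \<inter> frontier \<Omega>" "\<Sigma> \<noteq> {}"
    using dom unfolding domain_in_def by blast+
  obtain C where C: "components \<Sigma> = {C}"
    using simple unfolding simple_domain_def by blast
  then have con: "connected \<Sigma>"
    using Union_components[of \<Sigma>] in_components_connected[of C \<Sigma>] by auto
  obtain \<kappa> m where chart: "\<And>p. p \<in> \<Sigma> \<Longrightarrow> \<exists>W \<phi>. open W \<and> p \<in> W \<and> smooth_on W \<phi> \<and> grad \<phi> p \<noteq> 0 \<and>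
      W \<inter> \<Sigma> = {q \<in> W. \<phi> q = 0} \<and>
      (\<forall>q\<in>W \<inter> \<Sigma>. norm (\<kappa> *\<^sub>R q + m) = 1 \<and> (\<forall>X. grad \<phi> q \<bullet> X = 0 \<longrightarrow> (\<kappa> *\<^sub>R q + m) \<bullet> X = 0))"
    using static_boundary_normal_affine[OF n dom con ng] by blast
  have chart': "\<exists>W \<phi>. open W \<and> p \<in> W \<and> smooth_on W \<phi> \<and> grad \<phi> p \<noteq> 0 \<and> W \<inter> \<Sigma> = {q \<in> W. \<phi> q = 0}"
    if "p \<in> \<Sigma>" for p
    using chart[OF that] by blast
  have nrm: "norm (\<kappa> *\<^sub>R p + m) = 1" if "p \<in> \<Sigma>" for p
    using chart[OF that] that by blast
  show ?thesis
  proof (cases "\<kappa> = 0")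
    case False
    define a r where "a = - (1 / \<kappa>) *\<^sub>R m" and "r = 1 / \<bar>\<kappa>\<bar>"
    have r: "r > 0" using False by (simp add: r_def)
    have sub: "\<Sigma> \<subseteq> sphere a r"
    proof
      fix p assume "p \<in> \<Sigma>"
      have "\<kappa> *\<^sub>R (p - a) = \<kappa> *\<^sub>R p + m"
        using False by (simp add: a_def algebra_simps)
      then have "\<bar>\<kappa>\<bar> * norm (p - a) = 1"
        using nrm[OF \<open>p \<in> \<Sigma>\<close>] by (metis norm_scaleR)
      then show "p \<in> sphere a r"
        using False by (simp add: r_def dist_norm norm_minus_commute field_simps)
    qed
    have "\<Sigma> = sphere a r \<inter> hyp_space d"
    proof (rule boundary_fills_level_set[OF chart' \<Sigma>(1) frontier_closed \<Sigma>(2) smooth_on_sphere_eq _ _ sub])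
      show "grad (\<lambda>q. (q - a) \<bullet> (q - a) - r\<^sup>2) p \<noteq> 0" if "p \<in> \<Sigma>" for p
        using sub that r by (auto simp: grad_sphere_eq)
      show "sphere a r = {q. (q - a) \<bullet> (q - a) - r\<^sup>2 = 0}"
        using sphere_eq_iff[OF r] by blast
      show "connected (sphere a r \<inter> hyp_space d)"
        by (rule connected_sphere_hyp[OF n r])
    qed
    then show ?thesis using r by blast
  next
    case True
    then have m0: "m \<noteq> 0" using nrm \<Sigma>(2) by force
    have "(\<lambda>q. m \<bullet> q) constant_on \<Sigma>"
    proof (rule locally_constant_imp_constant[OF con])
      fix p assume p: "p \<in> \<Sigma>"
      obtain W \<phi> where W: "open W" "p \<in> W" "smooth_on W \<phi>" "grad \<phi> p \<noteq> 0" "W \<inter> \<Sigma> = {q \<in> W. \<phi> q = 0}"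
        and m: "\<And>q X. q \<in> W \<inter> \<Sigma> \<Longrightarrow> grad \<phi> q \<bullet> X = 0 \<Longrightarrow> m \<bullet> X = 0"
        using chart[OF p] True by auto
      have dm: "((\<lambda>q. m \<bullet> q) has_derivative (\<lambda>h. m \<bullet> h)) (at q)" for q
        by (auto intro!: derivative_eq_intros)
      obtain W' where W': "open W'" "p \<in> W'" "\<And>q. q \<in> W' \<inter> \<Sigma> \<Longrightarrow> m \<bullet> q = m \<bullet> p"
        by (rule level_set_locally_constant[OF W(1,3,2,4,5) p dm m]) blast+
      show "\<exists>T. openin (top_of_set \<Sigma>) T \<and> p \<in> T \<and> (\<forall>x\<in>T. m \<bullet> x = m \<bullet> p)"
        by (rule exI[of _ "\<Sigma> \<inter> W'"]) (use W' p openin_open_Int[OF W'(1)] in blast)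
    qed
    then obtain b where b: "\<And>q. q \<in> \<Sigma> \<Longrightarrow> m \<bullet> q = b"
      unfolding constant_on_def by blast
    have "\<Sigma> = {y. m \<bullet> y = b} \<inter> hyp_space d"
    proof (rule boundary_fills_level_set[OF chart' \<Sigma>(1) frontier_closed \<Sigma>(2) smooth_on_plane_eq])
      show "connected ({y. m \<bullet> y = b} \<inter> hyp_space d)"
        by (rule connected_hyperplane_hyp)
    qed (use m0 b in \<open>auto simp: grad_plane_eq\<close>)
    then show ?thesis using m0 by blast
  qed
qed

section \<open>The position of a sphere relative to the boundary at infinity\<close>

lemma tangent_space_sphere:
  fixes a :: "real ^ 'n::finite"
  assumes "r > 0" "p \<in> sphere a r"
  shows "tangent_space (sphere a r) p = {v. (p - a) \<bullet> v = 0}"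
proof -
  have "grad (\<lambda>q. (q - a) \<bullet> (q - a) - r\<^sup>2) p \<noteq> 0"
    using assms by (auto simp: grad_sphere_eq)
  moreover have "UNIV \<inter> sphere a r = {q \<in> UNIV. (q - a) \<bullet> (q - a) - r\<^sup>2 = 0}"
    using sphere_eq_iff[OF assms(1)] by blast
  ultimately show ?thesis
    using level_set_tangent_space[OF open_UNIV smooth_on_sphere_eq[of a r] UNIV_I _ _ assms(2)]
    by (simp add: grad_sphere_eq)
qed

lemma tangent_space_hyp_boundary:
  fixes d :: "'n::finite"
  assumes "p \<in> hyp_boundary d"
  shows "tangent_space (hyp_boundary d) p = {v. v $ d = 0}"
proof -
  have T: "UNIV \<inter> hyp_boundary d = {q \<in> UNIV. axis d 1 \<bullet> q - 0 = 0}"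
    by (auto simp: hyp_boundary_def inner_axis')
  have "grad (\<lambda>q. axis d 1 \<bullet> q - 0) p \<noteq> 0"
    unfolding grad_plane_eq by (simp add: axis_eq_0_iff)
  from level_set_tangent_space[OF open_UNIV smooth_on_plane_eq UNIV_I this T assms]
  show ?thesis
    unfolding grad_plane_eq by (simp add: inner_axis')
qed

text \<open>
  The three types correspond to the centre having height above, equal to, or below the radius. In the last
  case the radius vector at a point of \<open>y\<^sub>d = 0\<close> is not vertical, which is transversality.
\<close>

lemma sphere_hyp_cases:
  fixes d :: "'n::finite"
  assumes n: "CARD('n) \<ge> 2" and r: "r > 0" and ne: "sphere a r \<inter> hyp_space d \<noteq> {}"
  shows "horosphere d (sphere a r \<inter> hyp_space d) \<or> hypersphere d (sphere a r \<inter> hyp_space d) \<or>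
    geodesic_sphere d (sphere a r \<inter> hyp_space d)"
proof -
  have nth: "\<bar>y $ d - a $ d\<bar> \<le> r" if "y \<in> sphere a r" for y
    using component_le_norm_cart[of "y - a" d] that by (simp add: dist_norm norm_minus_commute)
  obtain y0 where "y0 \<in> sphere a r" "y0 \<in> hyp_space d"
    using ne by blast
  then have "y0 \<in> sphere a r" "y0 $ d > 0"
    by (simp_all add: hyp_space_iff)
  then have lower: "a $ d > - r" using nth[of y0] by simp
  consider "a $ d > r" | "a $ d = r" | "a $ d < r" by linarith
  then show ?thesis
  proof cases
    case 1
    then have "sphere a r \<subseteq> hyp_space d"
      using nth by (fastforce simp: hyp_space_iff)
    then show ?thesis
      unfolding geodesic_sphere_def using r ne by blast
  next
    case 2
    define p where "p = a - r *\<^sub>R axis d 1"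
    have p: "p \<in> sphere a r" "p \<in> hyp_boundary d"
      using r 2 by (simp_all add: p_def dist_norm hyp_boundary_def)
    have "tangent_at (sphere a r) (hyp_boundary d) p"
      unfolding tangent_at_def tangent_space_sphere[OF r p(1)] tangent_space_hyp_boundary[OF p(2)]
      using p r by (simp add: p_def inner_axis')
    then show ?thesis
      unfolding horosphere_def using r ne by blast
  next
    case 3
    obtain i where i: "i \<noteq> d" using exists_other_index[OF n] by blast
    define s where "s = sqrt (r\<^sup>2 - (a $ d)\<^sup>2)"
    have "(a $ d)\<^sup>2 < r\<^sup>2"
      using power_strict_mono[of "\<bar>a $ d\<bar>" r 2] 3 lower by simp
    then have s: "s\<^sup>2 = r\<^sup>2 - (a $ d)\<^sup>2"
      by (simp add: s_def)
    \<comment> \<open>The point of the sphere at height zero in the vertical plane of direction \<open>i\<close> through the centre.\<close>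
    define p where "p = a - (a $ d) *\<^sub>R axis d 1 + s *\<^sub>R axis i 1"
    have "(p - a) \<bullet> (p - a) = (a $ d)\<^sup>2 + s\<^sup>2"
      using i by (simp add: p_def inner_add_left inner_add_right inner_diff_left inner_diff_right
          inner_axis_axis power2_eq_square)
    then have "p \<in> sphere a r"
      using s sphere_eq_iff[OF r, of p a] by simp
    moreover have "p \<in> hyp_boundary d"
      using i by (simp add: p_def hyp_boundary_def axis_def)
    moreover have "transversal (sphere a r) (hyp_boundary d)"
      unfolding transversal_def
    proof
      fix q assume "q \<in> sphere a r \<inter> hyp_boundary d"
      then have q: "q \<in> sphere a r" "q \<in> hyp_boundary d" by auto
      define c where "c = q - a"
      have cd: "c $ d = - a $ d"
        using q(2) by (simp add: c_def hyp_boundary_def)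
      have "\<exists>j. j \<noteq> d \<and> c $ j \<noteq> 0"
      proof (rule ccontr)
        assume "\<not> (\<exists>j. j \<noteq> d \<and> c $ j \<noteq> 0)"
        then have "c = (c $ d) *\<^sub>R axis d 1"
          by (auto simp: vec_eq_iff axis_def)
        then have "norm c = \<bar>c $ d\<bar>"
          by (metis norm_axis_1 norm_scaleR mult.right_neutral)
        moreover have "norm c = r"
          using q(1) by (simp add: c_def dist_norm norm_minus_commute)
        ultimately show False
          using 3 lower cd by simp
      qed
      then obtain j where j: "j \<noteq> d" "c $ j \<noteq> 0" by blast
      have "x \<in> {v + w | v w. c \<bullet> v = 0 \<and> w $ d = 0}" for x
      proof -
        define v where "v = (x $ d) *\<^sub>R axis d 1 - (x $ d * c $ d / c $ j) *\<^sub>R (axis j 1 :: real ^ 'n)"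
        have "c \<bullet> v = 0"
          using j by (simp add: v_def inner_diff_right inner_axis)
        moreover have "(x - v) $ d = 0"
          using j by (simp add: v_def axis_def)
        moreover have "x = v + (x - v)" by simp
        ultimately show ?thesis by blast
      qed
      then show "{v + w | v w. v \<in> tangent_space (sphere a r) q \<and> w \<in> tangent_space (hyp_boundary d) q} = UNIV"
        unfolding tangent_space_sphere[OF r q(1)] tangent_space_hyp_boundary[OF q(2)] c_def[symmetric]
        by auto
    qed
    ultimately show ?thesis
      unfolding hypersphere_def using r ne by blast
  qed
qed

theorem theorem4p15:
  fixes d :: "'n::finite" and \<Sigma> :: "(real ^ 'n) set"
  assumes "CARD('n) \<ge> 2"
  shows "(\<exists>\<Omega>. domain_in (hyp_metric d) (hyp_space d) \<Omega> \<Sigma> \<and> simple_domain \<Sigma> \<and>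
              non_generic (hyp_metric d) \<Omega> \<Sigma>) \<longleftrightarrow>
         horosphere d \<Sigma> \<or> hypersphere d \<Sigma> \<or> geodesic_sphere d \<Sigma> \<or> hyperplane_section d \<Sigma>"
proof
  assume "\<exists>\<Omega>. domain_in (hyp_metric d) (hyp_space d) \<Omega> \<Sigma> \<and> simple_domain \<Sigma> \<and>
              non_generic (hyp_metric d) \<Omega> \<Sigma>"
  then obtain \<Omega> where \<Omega>: "domain_in (hyp_metric d) (hyp_space d) \<Omega> \<Sigma>" "simple_domain \<Sigma>"
      "non_generic (hyp_metric d) \<Omega> \<Sigma>" by blast
  have ne: "\<Sigma> \<noteq> {}" using \<Omega>(1) unfolding domain_in_def by blast
  from static_boundary_sphere_or_hyperplane[OF assms \<Omega>]
  show "horosphere d \<Sigma> \<or> hypersphere d \<Sigma> \<or> geodesic_sphere d \<Sigma> \<or> hyperplane_section d \<Sigma>"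
  proof (elim disjE exE conjE)
    fix a r assume "r > 0" and \<Sigma>: "\<Sigma> = sphere a r \<inter> hyp_space d"
    then show ?thesis
      using sphere_hyp_cases[OF assms \<open>r > 0\<close>] ne unfolding \<Sigma> by blast
  next
    fix a b assume "a \<noteq> 0" "\<Sigma> = {y. a \<bullet> y = b} \<inter> hyp_space d"
    then show ?thesis
      using ne unfolding hyperplane_section_def by blast
  qed
next
  assume "horosphere d \<Sigma> \<or> hypersphere d \<Sigma> \<or> geodesic_sphere d \<Sigma> \<or> hyperplane_section d \<Sigma>"
  then have "(\<exists>a r. r > 0 \<and> \<Sigma> = sphere a r \<inter> hyp_space d \<and> \<Sigma> \<noteq> {}) \<or>
      (\<exists>a b. a \<noteq> 0 \<and> \<Sigma> = {y. a \<bullet> y = b} \<inter> hyp_space d \<and> \<Sigma> \<noteq> {})"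
    unfolding horosphere_def hypersphere_def geodesic_sphere_def hyperplane_section_def by blast
  then show "\<exists>\<Omega>. domain_in (hyp_metric d) (hyp_space d) \<Omega> \<Sigma> \<and> simple_domain \<Sigma> \<and>
              non_generic (hyp_metric d) \<Omega> \<Sigma>"
    using sphere_bounds_static_domain[OF assms] hyperplane_bounds_static_domain[OF assms] by metis
qed

end
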